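(* Let $\Pi$ be a finite set of proposition symbols and $I=[a]$ with $a$ a positive integer. Every class of finite pointed $(\Pi,I)$-models definable by a countable disjunction of $(\Pi,I)$-formulae of graded multimodal logic is recognizable by a counting multichannel type automaton for $(\Pi,I)$. Moreover, if the disjunction is recursively enumerable, then the automaton can be taken to be recursively enumerable.
   Context: $(\Pi,I)$-formulae of graded multimodal logic (GMML) are generated by $\varphi ::= \top \mid p \mid \neg\varphi \mid (\varphi\land\varphi) \mid \langle\alpha\rangle_{\geq k}\varphi$ with $p\in\Pi$, $\alpha\in I$, $k\in\mathbb N$; $\langle\alpha\rangle_{=k}\varphi$ abbreviates $\langle\alpha\rangle_{\geq k}\varphi\land\neg\langle\alpha\rangle_{\geq k+1}\varphi$. A $(\Pi,I)$-model is $M=(W,(R_\alpha)_{\alpha\in I},V)$ with $W$ nonempty finite, $R_\alpha\subseteq W\times W$, $V\colon\Pi\to\wp(W)$; a pointed model is $(M,w)$; $\mathcal N^\alpha(w)=\{v:(w,v)\in R_\alpha\}$. Semantics is standard, with $(M,w)\models\langle\alpha\rangle_{\geq k}\psi$ iff $|\{v\in\mathcal N^\alpha(w):(M,v)\models\psi\}|\geq k$. A class $\mathcal K$ of finite pointed $(\Pi,I)$-models is definable by a countable disjunction if there is a countable set $S$ of formulae with $(M,w)\in\mathcal K$ iff $(M,w)\models\varphi$ for some $\varphi\in S$, for every finite pointed $(\Pi,I)$-model; the disjunction is recursively enumerable if $S$ is. Full graded multimodal types: $\tau^{(M,w)}_\varepsilon$ is the canonically ordered conjunction of $p$ ($p\in\Pi$,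 $w\in V(p)$) and $\neg p$ ($p\in\Pi$, $w\notin V(p)$), $\top$ if $\Pi=\emptyset$. For widths $\mathbf k=(\mathbf k_1,\dots,\mathbf k_n)$, $\mathbf k_i\in\mathbb N^{|I|}$, $T_{\mathbf k}$ is the set of all types of width $\mathbf k$ of finite pointed models, and for $\mathbf k_0=(k_1,\dots,k_{|I|})$, $\tau^{(M,w)}_{(\mathbf k_0,\mathbf k)}$ is the canonical conjunction of $\tau^{(M,w)}_\varepsilon$, all $\langle\alpha\rangle_{=\ell}\tau$ ($1\le\ell\le k_\alpha-1$, $\tau\in T_{\mathbf k}$) true at $(M,w)$, all $\langle\alpha\rangle_{\geq k_\alpha}\tau$ ($\tau\in T_{\mathbf k}$) true at $(M,w)$, and all $\langle\alpha\rangle_{=|\mathcal N^\alpha(w)|}\top$ with $k_\alpha>|\mathcal N^\alpha(w)|$. The full type of depth $0$ is $\tau^{(M,w)}_0=\tau^{(M,w)}_\varepsilon$; the full type of depth $n+1$ is $\tau^{(M,w)}_{n+1}=\tau^{(M,w)}_{(\mathbf k_1,\dots,\mathbf k_{n+1})}$ for any widths with $k_{i,\alpha}>\max\{|\mathcal N^\alpha(v)|:(w,v)\in(\bigcup_\beta R_\beta)^{i-1}\}$. $\mathcal T$ is the set of all full types (all depths). A multiset over $X$ is a function $X\to\mathbb N$; $\mathfrak m(X)$ is the set of multisets over $X$. A counting multichannel message passing automaton (CMMPA) for $(\Pi,I)$ is $A=(Q,\pi,\delta,F)$ with $Q$ a nonempty countable set, $\pi\colon\wp(\Pi)\to Q$,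 $\delta\colon\mathfrak m(Q)^{|I|}\times Q\to Q$, $F\subseteq Q$. On a finite model $M$, $f_0(w)=\pi(\{p\in\Pi:w\in V(p)\})$ and $f_{t+1}(w)=\delta(N_1,\dots,N_{|I|},f_t(w))$, where $N_\alpha$ is the multiset of values $f_t(v)$, $v\in\mathcal N^\alpha(w)$. $A$ accepts $(M,w)$ if $f_t(w)\in F$ for some $t\in\mathbb N$; $A$ recognizes $\mathcal K$ if it accepts exactly the finite pointed models in $\mathcal K$. $A$ is recursively enumerable if $F$ is recursively enumerable and $\delta$ is computable. A counting multichannel type automaton for $(\Pi,I)$ is a CMMPA with state set $\mathcal T$, $\pi(\Pi')$ the depth-$0$ type (conjunction of $p\in\Pi'$ and $\neg p$ for $p\in\Pi\setminus\Pi'$), arbitrary $F\subseteq\mathcal T$, and, when all types in $N_1,\dots,N_{|I|}$ and $\tau$ have the same depth, $\delta(N_1,\dots,N_{|I|},\tau)=\tau_0\land\bigwedge\{\langle\alpha\rangle_{=k}\sigma:\alpha\in I,\ 1\le k\le|N_\alpha|,\ \sigma\text{ occurs exactly }k\text{ times in }N_\alpha\}\land\bigwedge\{\langle\alpha\rangle_{=|N_\alpha|}\top:\alpha\in I\}$, where $\tau_0$ is the depth-$0$ type occurring in $\tau$ outside the scope of any diamond (other inputs are mapped arbitrarily). Its state at $(M,w)$ in round $n$ is $\tau^{(M,w)}_n$. *)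

theory Defs
  imports Main "HOL-Library.Multiset" "HOL-Library.Nat_Bijection" "HOL-Library.Countable_Set"
begin

datatype fm = Top | Prop nat | Neg fm | Conj fm fm | Dia nat nat fm
  (* Dia alpha k phi  is  <alpha>_{>= k} phi *)

fun wf_fm :: "nat set \<Rightarrow> nat set \<Rightarrow> fm \<Rightarrow> bool" where
  "wf_fm P I Top = True"
| "wf_fm P I (Prop p) = (p \<in> P)"
| "wf_fm P I (Neg f) = wf_fm P I f"
| "wf_fm P I (Conj f g) = (wf_fm P I f \<and> wf_fm P I g)"
| "wf_fm P I (Dia a k f) = (a \<in> I \<and> wf_fm P I f)"

definition diaeq :: "nat \<Rightarrow> nat \<Rightarrow> fm \<Rightarrow> fm" where
  "diaeq a k f = Conj (Dia a k f) (Neg (Dia a (Suc k) f))"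

fun fm_enc :: "fm \<Rightarrow> nat" where
  "fm_enc Top = prod_encode (0, 0)"
| "fm_enc (Prop p) = prod_encode (1, p)"
| "fm_enc (Neg f) = prod_encode (2, fm_enc f)"
| "fm_enc (Conj f g) = prod_encode (3, prod_encode (fm_enc f, fm_enc g))"
| "fm_enc (Dia a k f) = prod_encode (4, prod_encode (a, prod_encode (k, fm_enc f)))"

fun conj_list :: "fm list \<Rightarrow> fm" where
  "conj_list [] = Top"
| "conj_list [f] = f"
| "conj_list (f # fs) = Conj f (conj_list fs)"

definition cconj :: "fm set \<Rightarrow> fm" where
  "cconj X = conj_list (map (the_inv fm_enc) (sorted_list_of_set (fm_enc ` X)))"

record 'w kmodel =
  mW :: "'w set"
  mR :: "nat \<Rightarrow> ('w \<times> 'w) set"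
  mV :: "nat \<Rightarrow> 'w set"

definition is_model :: "nat set \<Rightarrow> nat set \<Rightarrow> 'w kmodel \<Rightarrow> bool" where
  "is_model P I M \<longleftrightarrow> finite (mW M) \<and> mW M \<noteq> {}
     \<and> (\<forall>a. mR M a \<subseteq> mW M \<times> mW M) \<and> (\<forall>a. a \<notin> I \<longrightarrow> mR M a = {})
     \<and> (\<forall>p. mV M p \<subseteq> mW M) \<and> (\<forall>p. p \<notin> P \<longrightarrow> mV M p = {})"

definition pointed_model :: "nat set \<Rightarrow> nat set \<Rightarrow> 'w kmodel \<Rightarrow> 'w \<Rightarrow> bool" where
  "pointed_model P I M w \<longleftrightarrow> is_model P I M \<and> w \<in> mW M"

definition nbrs :: "'w kmodel \<Rightarrow> nat \<Rightarrow> 'w \<Rightarrow> 'w set" where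
  "nbrs M a w = {v. (w, v) \<in> mR M a}"

fun sat :: "'w kmodel \<Rightarrow> 'w \<Rightarrow> fm \<Rightarrow> bool" where
  "sat M w Top = True"
| "sat M w (Prop p) = (w \<in> mV M p)"
| "sat M w (Neg f) = (\<not> sat M w f)"
| "sat M w (Conj f g) = (sat M w f \<and> sat M w g)"
| "sat M w (Dia a k f) = (k \<le> card {v. (w, v) \<in> mR M a \<and> sat M v f})"

definition disj_defines :: "nat set \<Rightarrow> nat set \<Rightarrow> fm set \<Rightarrow> ('w kmodel \<times> 'w) set \<Rightarrow> bool" where
  "disj_defines P I S K \<longleftrightarrow> countable S \<and> (\<forall>f\<in>S. wf_fm P I f)
     \<and> K \<subseteq> {(M, w). pointed_model P I M w}
     \<and> (\<forall>M w. pointed_model P I M w \<longrightarrow> ((M, w) \<in> K \<longleftrightarrow> (\<exists>f\<in>S. sat M w f)))"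

definition eps0 :: "nat set \<Rightarrow> nat set \<Rightarrow> fm" where
  "eps0 P P' = cconj ((\<lambda>p. if p \<in> P' then Prop p else Neg (Prop p)) ` P)"

definition eps :: "nat set \<Rightarrow> 'w kmodel \<Rightarrow> 'w \<Rightarrow> fm" where
  "eps P M w = eps0 P {p \<in> P. w \<in> mV M p}"

text \<open>The type of width (k0, k) given the set T of all types of width k.
  A width vector in N^|I| is a function nat => nat (only values on I matter).\<close>
definition typeT :: "nat set \<Rightarrow> nat set \<Rightarrow> fm set \<Rightarrow> (nat \<Rightarrow> nat) \<Rightarrow> 'w kmodel \<Rightarrow> 'w \<Rightarrow> fm" where
  "typeT P I T k0 M w = cconj ({eps P M w}
     \<union> {diaeq a l t | a l t. a \<in> I \<and> 1 \<le> l \<and> l \<le> k0 a - 1 \<and> t \<in> T \<and> sat M w (diaeq a l t)}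
     \<union> {Dia a (k0 a) t | a t. a \<in> I \<and> t \<in> T \<and> sat M w (Dia a (k0 a) t)}
     \<union> {diaeq a (card (nbrs M a w)) Top | a. a \<in> I \<and> card (nbrs M a w) < k0 a})"

text \<open>Tset P I ks: the set of all types of width ks of finite pointed models
  (finite models over nat represent all finite models up to isomorphism).\<close>
fun Tset :: "nat set \<Rightarrow> nat set \<Rightarrow> (nat \<Rightarrow> nat) list \<Rightarrow> fm set" where
  "Tset P I [] = {eps P M w | (M :: nat kmodel) w. pointed_model P I M w}"
| "Tset P I (k0 # ks) = {typeT P I (Tset P I ks) k0 M w | (M :: nat kmodel) w. pointed_model P I M w}"

fun gtype :: "nat set \<Rightarrow> nat set \<Rightarrow> (nat \<Rightarrow> nat) list \<Rightarrow> 'w kmodel \<Rightarrow> 'w \<Rightarrow> fm" where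
  "gtype P I [] M w = eps P M w"
| "gtype P I (k0 # ks) M w = typeT P I (Tset P I ks) k0 M w"

definition widths :: "nat set \<Rightarrow> 'w kmodel \<Rightarrow> 'w \<Rightarrow> nat \<Rightarrow> (nat \<Rightarrow> nat) list" where
  "widths I M w n = map (\<lambda>i a. Suc (Max {card (nbrs M a v) | v.
        (w, v) \<in> (\<Union>b\<in>I. mR M b) ^^ (i - 1)})) [1..<Suc n]"

definition full_type :: "nat set \<Rightarrow> nat set \<Rightarrow> nat \<Rightarrow> 'w kmodel \<Rightarrow> 'w \<Rightarrow> fm" where
  "full_type P I n M w = gtype P I (widths I M w n) M w"

definition FT :: "nat set \<Rightarrow> nat set \<Rightarrow> nat \<Rightarrow> fm set" where
  "FT P I n = {full_type P I n M w | (M :: nat kmodel) w. pointed_model P I M w}"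

definition Types :: "nat set \<Rightarrow> nat set \<Rightarrow> fm set" where
  "Types P I = (\<Union>n. FT P I n)"

text \<open>An automaton is (pi, delta, F); the |I|-tuple of multisets is a function on indices.\<close>
type_synonym 'q cmmpa = "(nat set \<Rightarrow> 'q) \<times> ((nat \<Rightarrow> 'q multiset) \<Rightarrow> 'q \<Rightarrow> 'q) \<times> 'q set"

fun run :: "'q cmmpa \<Rightarrow> nat set \<Rightarrow> nat set \<Rightarrow> 'w kmodel \<Rightarrow> nat \<Rightarrow> 'w \<Rightarrow> 'q" where
  "run (pi, delta, F) P I M 0 w = pi {p \<in> P. w \<in> mV M p}"
| "run (pi, delta, F) P I M (Suc t) w =
     delta (\<lambda>a. if a \<in> I then image_mset (run (pi, delta, F) P I M t) (mset_set (nbrs M a w)) else {#})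
           (run (pi, delta, F) P I M t w)"

definition accepts :: "'q cmmpa \<Rightarrow> nat set \<Rightarrow> nat set \<Rightarrow> 'w kmodel \<Rightarrow> 'w \<Rightarrow> bool" where
  "accepts A P I M w \<longleftrightarrow> (\<exists>t. run A P I M t w \<in> snd (snd A))"

definition recognizes :: "'q cmmpa \<Rightarrow> nat set \<Rightarrow> nat set \<Rightarrow> ('w kmodel \<times> 'w) set \<Rightarrow> bool" where
  "recognizes A P I K \<longleftrightarrow>
     (\<forall>M w. pointed_model P I M w \<longrightarrow> (accepts A P I M w \<longleftrightarrow> (M, w) \<in> K))"

fun conj_subterms :: "fm \<Rightarrow> fm set" where
  "conj_subterms (Conj f g) = insert (Conj f g) (conj_subterms f \<union> conj_subterms g)"
| "conj_subterms f = {f}"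

definition typ0 :: "nat set \<Rightarrow> fm \<Rightarrow> fm" where
  "typ0 P t = (THE d. d \<in> {eps0 P P' | P'. P' \<subseteq> P} \<and> d \<in> conj_subterms t)"

definition type_automaton :: "nat set \<Rightarrow> nat set \<Rightarrow> fm cmmpa \<Rightarrow> bool" where
  "type_automaton P I A \<longleftrightarrow> (case A of (pi, delta, F) \<Rightarrow>
     (\<forall>P'. P' \<subseteq> P \<longrightarrow> pi P' = eps0 P P')
     \<and> F \<subseteq> Types P I
     \<and> (\<forall>N t. t \<in> Types P I \<and> (\<forall>a\<in>I. set_mset (N a) \<subseteq> Types P I) \<longrightarrow> delta N t \<in> Types P I)
     \<and> (\<forall>N t n. t \<in> FT P I n \<and> (\<forall>a\<in>I. set_mset (N a) \<subseteq> FT P I n) \<longrightarrow>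
          delta N t = cconj ({typ0 P t}
             \<union> {diaeq a k s | a k s. a \<in> I \<and> 1 \<le> k \<and> k \<le> size (N a) \<and> count (N a) s = k}
             \<union> {diaeq a (size (N a)) Top | a. a \<in> I})))"

datatype recf = Zr | Sc | Pj nat | Cn recf "recf list" | Pr recf recf | Mn recf

inductive reval :: "recf \<Rightarrow> nat list \<Rightarrow> nat \<Rightarrow> bool" where
  "reval Zr xs 0"
| "reval Sc (x # xs) (Suc x)"
| "i < length xs \<Longrightarrow> reval (Pj i) xs (xs ! i)"
| "list_all2 (\<lambda>g y. reval g xs y) gs ys \<Longrightarrow> reval f ys z \<Longrightarrow> reval (Cn f gs) xs z"
| "reval f xs z \<Longrightarrow> reval (Pr f g) (0 # xs) z"
| "reval (Pr f g) (n # xs) y \<Longrightarrow> reval g (y # n # xs) z \<Longrightarrow> reval (Pr f g) (Suc n # xs) z"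
| "reval f (y # xs) 0 \<Longrightarrow> (\<forall>i<y. \<exists>m. reval f (i # xs) (Suc m)) \<Longrightarrow> reval (Mn f) xs y"

definition re_set :: "nat set \<Rightarrow> bool" where
  "re_set A \<longleftrightarrow> (\<exists>c. \<forall>x. x \<in> A \<longleftrightarrow> (\<exists>y. reval c [x] y))"

definition ms_enc :: "fm multiset \<Rightarrow> nat" where
  "ms_enc N = list_encode (sorted_list_of_multiset (image_mset fm_enc N))"

definition input_enc :: "nat \<Rightarrow> (nat \<Rightarrow> fm multiset) \<Rightarrow> fm \<Rightarrow> nat" where
  "input_enc a N t = list_encode (map (\<lambda>b. ms_enc (N b)) [1..<Suc a] @ [fm_enc t])"

definition re_automaton :: "nat set \<Rightarrow> nat \<Rightarrow> fm cmmpa \<Rightarrow> bool" where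
  "re_automaton P a A \<longleftrightarrow> (case A of (pi, delta, F) \<Rightarrow>
     re_set (fm_enc ` F)
     \<and> (\<exists>c. \<forall>N t. t \<in> Types P {1..a} \<and> (\<forall>b\<in>{1..a}. set_mset (N b) \<subseteq> Types P {1..a}) \<longrightarrow>
            reval c [input_enc a N t] (fm_enc (delta N t))))"

end

theory Submission
  imports Defs
begin

text \<open>Let \<open>dtype n\<close> be the state that the type automaton ought to have in round \<open>n\<close>. A point satisfies the
  depth-\<open>n\<close> type of another point only if both have the same one, and then the two agree on all formulae of
  modal depth at most \<open>n\<close>. Hence the automaton whose accepting states are the types entailing a formula
  of \<open>S\<close> of at most their depth recognizes the disjunction: a point accepted through a type of an
  accidental depth still satisfies that type as a formula. The transition function produces types because a
  disjoint union of finite models below a fresh root realizes any multiset of successor types.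

  For computability it suffices to describe things by semidecidable predicates: an enumerable set is the same
  as a semidecidable one, and a function with semidecidable graph is computed by searching for a value
  together with a witness. Semidecidability passes to inductively defined predicates, and the truth values of
  formulae on types form one, with a rule per connective. The transition function must also decide whether
  its input types have a common depth. If they do not, then some input has a depth-\<open>n\<close> type at a point with a
  path of length \<open>n\<close>, which pins down the depth, and another input contradicts it by a similar path; both facts
  are semidecidable.\<close>

section \<open>Canonical types of fixed depth\<close>

text \<open>A type does not determine its depth: a point without successors has the same type at
  every positive depth, and in general a type stops growing once no path from the point is as long
  as the depth. The round number can therefore not be read off from a state. Recognition avoids this
  by using types as formulae, and judgements about types carry the depth explicitly. Types exclude
  each other because of the conjunct that fixes the number of successors: without it, the counts in
  a type would only say that its successor multiset is contained in that of the point. Realizing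
  arbitrary successor multisets is also what makes evaluation sound: there a type is given by its
  code alone, and truth at it has a meaning only once some model realizes it. Full types are defined
  by widths that depend on the point and count over all types of the remaining widths, whereas
  \<open>dtype\<close> recurses on the depth alone; identifying the two takes an argument of its
  own.\<close>

lemma inj_fm_enc: "inj fm_enc"
proof (rule injI)
  fix x y show "fm_enc x = fm_enc y \<Longrightarrow> x = y"
    by (induction x arbitrary: y; case_tac y; auto)
qed

lemma sat_conj_list: "sat M w (conj_list fs) \<longleftrightarrow> (\<forall>f\<in>set fs. sat M w f)"
  by (induction fs rule: conj_list.induct) auto

lemma set_map_the_inv_fm_enc:
  assumes "finite X"
  shows "set (map (the_inv fm_enc) (sorted_list_of_set (fm_enc ` X))) = X"
  using assms by (force simp: the_inv_f_f[OF inj_fm_enc] image_image)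

lemma sat_cconj: "finite X \<Longrightarrow> sat M w (cconj X) \<longleftrightarrow> (\<forall>f\<in>X. sat M w f)"
  unfolding cconj_def sat_conj_list using set_map_the_inv_fm_enc by metis

lemma conj_subterms_self: "f \<in> conj_subterms f"
  by (cases f) auto

lemma conj_subterms_sat: "d \<in> conj_subterms t \<Longrightarrow> sat M w t \<Longrightarrow> sat M w d"
  by (induction t) auto

lemma conj_subterms_conj_list: "f \<in> set fs \<Longrightarrow> f \<in> conj_subterms (conj_list fs)"
  by (induction fs rule: conj_list.induct) (auto simp: conj_subterms_self)

lemma conj_subterms_cconj: "finite X \<Longrightarrow> f \<in> X \<Longrightarrow> f \<in> conj_subterms (cconj X)"
  unfolding cconj_def by (rule conj_subterms_conj_list) (use set_map_the_inv_fm_enc in blast)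

lemma sat_eps0:
  assumes "finite P" "E \<subseteq> P"
  shows "sat M w (eps0 P E) \<longleftrightarrow> E = {p \<in> P. w \<in> mV M p}"
proof -
  have "sat M w (eps0 P E) \<longleftrightarrow> (\<forall>p\<in>P. sat M w (if p \<in> E then Prop p else Neg (Prop p)))"
    unfolding eps0_def using assms(1) by (simp add: sat_cconj del: if_image_distrib)
  also have "\<dots> \<longleftrightarrow> (\<forall>p\<in>P. p \<in> E \<longleftrightarrow> w \<in> mV M p)" by auto
  finally show ?thesis using assms(2) by auto
qed

lemma sat_diaeq: "sat M w (diaeq a k f) \<longleftrightarrow> card {v \<in> nbrs M a w. sat M v f} = k"
  by (auto simp: diaeq_def nbrs_def)

lemma count_image_mset_set:
  "finite A \<Longrightarrow> count (image_mset g (mset_set A)) s = card {v \<in> A. g v = s}"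
proof (induction A rule: finite_induct)
  case (insert x A)
  have "{v \<in> insert x A. g v = s} = (if g x = s then insert x {v \<in> A. g v = s} else {v \<in> A. g v = s})"
    by auto
  with insert show ?case by simp
qed simp

text \<open>Counting over the support of \<open>N a\<close> alone keeps the set visibly finite;
  \<open>conjuncts_of_succs_eq\<close> matches it with the range
  \<open>1 \<le> k \<le> size (N a)\<close> in the transition function of a type automaton.\<close>

definition conjuncts_of_succs :: "nat set \<Rightarrow> nat set \<Rightarrow> nat set \<Rightarrow> (nat \<Rightarrow> fm multiset) \<Rightarrow> fm set" where
  "conjuncts_of_succs P I E N = {eps0 P E} \<union> {diaeq a (count (N a) s) s | a s. a \<in> I \<and> s \<in># N a}
     \<union> {diaeq a (size (N a)) Top | a. a \<in> I}"

definition type_of_succs :: "nat set \<Rightarrow> nat set \<Rightarrow> nat set \<Rightarrow> (nat \<Rightarrow> fm multiset) \<Rightarrow> fm" where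
  "type_of_succs P I E N = cconj (conjuncts_of_succs P I E N)"

abbreviation val :: "nat set \<Rightarrow> 'w kmodel \<Rightarrow> 'w \<Rightarrow> nat set" where
  "val P M w \<equiv> {p \<in> P. w \<in> mV M p}"

fun dtype :: "nat set \<Rightarrow> nat set \<Rightarrow> nat \<Rightarrow> 'w kmodel \<Rightarrow> 'w \<Rightarrow> fm" where
  "dtype P I 0 M w = eps0 P (val P M w)"
| "dtype P I (Suc n) M w = type_of_succs P I (val P M w) (\<lambda>a. image_mset (dtype P I n M) (mset_set (nbrs M a w)))"

lemma conjuncts_of_succs_eq: "conjuncts_of_succs P I E N = {eps0 P E}
  \<union> {diaeq a k s | a k s. a \<in> I \<and> 1 \<le> k \<and> k \<le> size (N a) \<and> count (N a) s = k}
  \<union> {diaeq a (size (N a)) Top | a. a \<in> I}"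
proof -
  have "{diaeq a (count (N a) s) s | a s. a \<in> I \<and> s \<in># N a} =
    {diaeq a k s | a k s. a \<in> I \<and> 1 \<le> k \<and> k \<le> size (N a) \<and> count (N a) s = k}"
  proof (intro set_eqI iffI; clarify)
    fix a s assume "a \<in> I" "s \<in># N a"
    then show "\<exists>a' k s'. diaeq a (count (N a) s) s = diaeq a' k s' \<and> a' \<in> I \<and> 1 \<le> k \<and> k \<le> size (N a') \<and> count (N a') s' = k"
      by (intro exI[of _ a] exI[of _ "count (N a) s"] exI[of _ s]) (auto simp: count_le_size Suc_le_eq)
  next
    fix a s assume "a \<in> I" "1 \<le> count (N a) s"
    then show "\<exists>a' s'. diaeq a (count (N a) s) s = diaeq a' (count (N a') s') s' \<and> a' \<in> I \<and> s' \<in># N a'"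
      by (intro exI[of _ a] exI[of _ s]) (auto simp: Suc_le_eq)
  qed
  then show ?thesis by (simp add: conjuncts_of_succs_def)
qed

lemma finite_conjuncts_of_succs: "finite I \<Longrightarrow> finite (conjuncts_of_succs P I E N)"
proof -
  assume "finite I"
  have "{diaeq a (count (N a) s) s | a s. a \<in> I \<and> s \<in># N a} =
      (\<lambda>(a, s). diaeq a (count (N a) s) s) ` (SIGMA a:I. set_mset (N a))"
    by auto
  then show ?thesis using \<open>finite I\<close> by (simp add: conjuncts_of_succs_def)
qed

lemma type_of_succs_cong: "(\<And>a. a \<in> I \<Longrightarrow> N a = N' a) \<Longrightarrow> type_of_succs P I E N = type_of_succs P I E N'"
proof -
  assume "\<And>a. a \<in> I \<Longrightarrow> N a = N' a"
  then have "conjuncts_of_succs P I E N = conjuncts_of_succs P I E N'" unfolding conjuncts_of_succs_def by (smt (verit) Collect_cong)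
  then show ?thesis by (simp add: type_of_succs_def)
qed

lemma pointed_nbrs: "pointed_model P I M w \<Longrightarrow> v \<in> nbrs M a w \<Longrightarrow> pointed_model P I M v"
  by (auto simp: pointed_model_def is_model_def nbrs_def)

lemma finite_nbrs: "pointed_model P I M w \<Longrightarrow> finite (nbrs M a w)"
proof -
  assume "pointed_model P I M w"
  then have "finite (mW M)" "nbrs M a w \<subseteq> mW M"
    by (auto simp: pointed_model_def is_model_def nbrs_def)
  then show ?thesis by (rule finite_subset[rotated])
qed

lemma sat_type_of_succs:
  assumes "finite P" "finite I" "E \<subseteq> P"
  shows "sat M w (type_of_succs P I E N) \<longleftrightarrow> E = val P M w \<and>
    (\<forall>a\<in>I. card (nbrs M a w) = size (N a) \<and> (\<forall>s\<in>#N a. card {v \<in> nbrs M a w. sat M v s} = count (N a) s))"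
proof -
  have "sat M w (type_of_succs P I E N) \<longleftrightarrow> (\<forall>f\<in>conjuncts_of_succs P I E N. sat M w f)"
    unfolding type_of_succs_def by (rule sat_cconj[OF finite_conjuncts_of_succs[OF assms(2)]])
  also have "\<dots> \<longleftrightarrow> sat M w (eps0 P E) \<and> (\<forall>a\<in>I. \<forall>s\<in>#N a. sat M w (diaeq a (count (N a) s) s))
      \<and> (\<forall>a\<in>I. sat M w (diaeq a (size (N a)) Top))"
    by (auto simp: conjuncts_of_succs_def)
  finally show ?thesis unfolding sat_diaeq sat_eps0[OF assms(1,3)] by auto
qed

text \<open>The counts for \<open>s \<in># N a\<close> make \<open>N a\<close> a submultiset of the
  multiset of the types \<open>g v\<close> of the successors; as the degree conjunct makes both
  equally large, nothing is left over for types outside \<open>N a\<close>.\<close>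

lemma sat_type_of_succs_types:
  assumes "finite P" "finite I" "E \<subseteq> P" "pointed_model P I M w"
    and g: "\<And>a s v. a \<in> I \<Longrightarrow> s \<in># N a \<Longrightarrow> v \<in> nbrs M a w \<Longrightarrow> sat M v s \<longleftrightarrow> g v = s"
  shows "sat M w (type_of_succs P I E N) \<longleftrightarrow> E = val P M w \<and>
    (\<forall>a\<in>I. image_mset g (mset_set (nbrs M a w)) = N a)"
proof -
  have "(card (nbrs M a w) = size (N a) \<and> (\<forall>s\<in>#N a. card {v \<in> nbrs M a w. sat M v s} = count (N a) s))
    \<longleftrightarrow> image_mset g (mset_set (nbrs M a w)) = N a" (is "?L \<longleftrightarrow> ?G = _") if "a \<in> I" for a
  proof -
    have fin: "finite (nbrs M a w)" using assms(4) by (rule finite_nbrs)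
    have c: "card {v \<in> nbrs M a w. sat M v s} = count ?G s" if "s \<in># N a" for s
    proof -
      have "{v \<in> nbrs M a w. sat M v s} = {v \<in> nbrs M a w. g v = s}"
        using g[OF \<open>a \<in> I\<close> that] by auto
      then show ?thesis by (simp only: count_image_mset_set[OF fin])
    qed
    have sz: "size ?G = card (nbrs M a w)" by simp
    show ?thesis
    proof
      assume L: ?L
      have "N a \<subseteq># ?G"
      proof (rule mset_subset_eqI)
        fix s show "count (N a) s \<le> count ?G s"
          using L c[of s] by (cases "s \<in># N a") (auto simp: not_in_iff)
      qed
      moreover have "size (N a) = size ?G" using L sz by simp
      ultimately show "?G = N a" by (metis mset_subset_size nat_neq_iff subset_mset.le_neq_trans)
    next
      assume "?G = N a" then show ?L using c sz by metis
    qed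
  qed
  then show ?thesis unfolding sat_type_of_succs[OF assms(1-3)] by (intro conj_cong ball_cong refl)
qed

text \<open>Exclusiveness of the types of depth \<open>n\<close> is a premise, so that the statement
  serves both inside the induction that proves it (\<open>sat_dtype\<close>) and afterwards, to
  describe equality of types.\<close>

lemma sat_dtype_Suc:
  assumes "finite P" "finite I" "pointed_model P I M w" "pointed_model P I M' w'"
    and IH: "\<And>v v'. pointed_model P I M v \<Longrightarrow> pointed_model P I M' v' \<Longrightarrow>
      sat M v (dtype P I n M' v') \<longleftrightarrow> dtype P I n M v = dtype P I n M' v'"
  shows "sat M w (dtype P I (Suc n) M' w') \<longleftrightarrow> val P M' w' = val P M w \<and>
    (\<forall>a\<in>I. image_mset (dtype P I n M) (mset_set (nbrs M a w)) = image_mset (dtype P I n M') (mset_set (nbrs M' a w')))"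
  unfolding dtype.simps
proof (rule sat_type_of_succs_types[OF assms(1,2) _ assms(3)])
  fix a s v assume "a \<in> I" "s \<in># image_mset (dtype P I n M') (mset_set (nbrs M' a w'))" "v \<in> nbrs M a w"
  moreover from this obtain v' where "v' \<in> nbrs M' a w'" "s = dtype P I n M' v'"
    using finite_nbrs[OF assms(4)] by auto
  ultimately show "sat M v s \<longleftrightarrow> dtype P I n M v = s"
    using IH pointed_nbrs assms(3,4) by metis
qed auto

lemma sat_dtype:
  fixes M M' :: "'w kmodel"
  assumes "finite P" "finite I" "pointed_model P I M w" "pointed_model P I M' w'"
  shows "sat M w (dtype P I n M' w') \<longleftrightarrow> dtype P I n M w = dtype P I n M' w'"
  using assms(3,4)
proof (induction n arbitrary: M M' w w')
  case 0
  have "sat M w (eps0 P (val P M w))" "sat M w (eps0 P (val P M' w')) \<longleftrightarrow> val P M' w' = val P M w"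
    by (subst sat_eps0; use assms in auto)+
  then show ?case by auto
next
  case (Suc n)
  note star = sat_dtype_Suc[OF assms(1,2) _ _ Suc.IH]
  show ?case
  proof
    assume "sat M w (dtype P I (Suc n) M' w')"
    then show "dtype P I (Suc n) M w = dtype P I (Suc n) M' w'"
      using star[OF Suc.prems] by (auto intro: type_of_succs_cong)
  next
    assume "dtype P I (Suc n) M w = dtype P I (Suc n) M' w'"
    \<comment> \<open>Every point satisfies its own type, which is here rewritten to the equal type
      of \<open>w'\<close>.\<close>
    then show "sat M w (dtype P I (Suc n) M' w')"
      using star[OF Suc.prems(1) Suc.prems(1)] by simp
  qed
qed

text \<open>Types are compared as formulae, not by taking canonical conjunctions apart: equality is
  turned into satisfaction, which exposes the successor multisets.\<close>

lemma dtype_Suc_eq_iff: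
  fixes M M' :: "'w kmodel"
  assumes "finite P" "finite I" "pointed_model P I M w" "pointed_model P I M' w'"
  shows "dtype P I (Suc n) M w = dtype P I (Suc n) M' w' \<longleftrightarrow> val P M' w' = val P M w \<and>
    (\<forall>a\<in>I. image_mset (dtype P I n M) (mset_set (nbrs M a w)) = image_mset (dtype P I n M') (mset_set (nbrs M' a w')))"
  unfolding sat_dtype[OF assms, of "Suc n", symmetric]
  by (rule sat_dtype_Suc[OF assms sat_dtype[OF assms(1,2)]])

section \<open>Modal depth, and the formulae that a type decides\<close>

fun md :: "fm \<Rightarrow> nat" where
  "md Top = 0" | "md (Prop p) = 0" | "md (Neg f) = md f"
| "md (Conj f g) = max (md f) (md g)" | "md (Dia a k f) = Suc (md f)"

lemma md_conj_list: "f \<in> set fs \<Longrightarrow> md f \<le> md (conj_list fs)"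
  by (induction fs rule: conj_list.induct) auto

lemma md_conj_list_le: "(\<And>f. f \<in> set fs \<Longrightarrow> md f \<le> n) \<Longrightarrow> md (conj_list fs) \<le> n"
  by (induction fs rule: conj_list.induct) auto

lemma md_cconj: "finite X \<Longrightarrow> f \<in> X \<Longrightarrow> md f \<le> md (cconj X)"
  unfolding cconj_def by (rule md_conj_list) (use set_map_the_inv_fm_enc in blast)

lemma md_cconj_le: "finite X \<Longrightarrow> (\<And>f. f \<in> X \<Longrightarrow> md f \<le> n) \<Longrightarrow> md (cconj X) \<le> n"
  unfolding cconj_def by (rule md_conj_list_le) (use set_map_the_inv_fm_enc in blast)

text \<open>Truth of \<open>f\<close> at a successor depends only on its depth-\<open>n\<close>
  type, so a predicate \<open>Q\<close> on types expresses it. The number of successors satisfying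
  \<open>f\<close> is then the size of a filtered multiset of types, and equal types have equal
  multisets.\<close>

lemma dtype_determines_sat_Suc:
  fixes M M' :: "'w kmodel"
  assumes "finite P" "finite I" "pointed_model P I M w" "pointed_model P I M' w'" "a \<in> I"
    and IH: "\<And>(M :: 'w kmodel) (M' :: 'w kmodel) v v'. pointed_model P I M v \<Longrightarrow> pointed_model P I M' v' \<Longrightarrow>
      dtype P I n M v = dtype P I n M' v' \<Longrightarrow> sat M v f \<longleftrightarrow> sat M' v' f"
    and eq: "dtype P I (Suc n) M w = dtype P I (Suc n) M' w'"
  shows "card {v \<in> nbrs M a w. sat M v f} = card {v \<in> nbrs M' a w'. sat M' v f}"
proof -
  define Q where "Q s \<longleftrightarrow> (\<exists>(M :: 'w kmodel) v. pointed_model P I M v \<and> dtype P I n M v = s \<and> sat M v f)" for s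
  have Q: "Q (dtype P I n M v) \<longleftrightarrow> sat M v f" if "pointed_model P I M v" for M :: "'w kmodel" and v
  proof
    assume "Q (dtype P I n M v)"
    then obtain M0 :: "'w kmodel" and v0 where "pointed_model P I M0 v0"
      "dtype P I n M0 v0 = dtype P I n M v" "sat M0 v0 f"
      unfolding Q_def by auto
    then show "sat M v f" using IH[of M0 v0 M v] that by simp
  qed (use that Q_def in auto)
  have "card {v \<in> nbrs M a w. sat M v f} = size (filter_mset Q (image_mset (dtype P I n M) (mset_set (nbrs M a w))))"
    if "pointed_model P I M w" for M :: "'w kmodel" and w
  proof -
    have "{v \<in> nbrs M a w. sat M v f} = {v \<in> nbrs M a w. Q (dtype P I n M v)}"
      using Q pointed_nbrs[OF that] by blast
    then show ?thesis by (simp add: filter_mset_image_mset o_def filter_mset_mset_set finite_nbrs[OF that])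
  qed
  then show ?thesis using eq assms dtype_Suc_eq_iff[OF assms(1-4)] by metis
qed

lemma dtype_determines_sat:
  fixes M M' :: "'w kmodel"
  assumes "finite P" "finite I" "pointed_model P I M w" "pointed_model P I M' w'"
    and "md f \<le> n" "dtype P I n M w = dtype P I n M' w'" "wf_fm P I f"
  shows "sat M w f \<longleftrightarrow> sat M' w' f"
  using assms(3-)
proof (induction f arbitrary: M M' w w' n)
  case (Prop p)
  have "val P M w = val P M' w'"
  proof (cases n)
    case 0
    have "sat M w (eps0 P (val P M w))" by (subst sat_eps0) (use assms in auto)
    then have "sat M w (eps0 P (val P M' w'))" using Prop 0 by simp
    then show ?thesis by (subst (asm) sat_eps0) (use assms in auto)
  next
    case (Suc m)
    then show ?thesis using Prop dtype_Suc_eq_iff[OF assms(1,2) Prop.prems(1,2)] by auto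
  qed
  then show ?case using Prop by auto
next
  case (Dia a k f)
  then obtain m where n: "n = Suc m" and m: "md f \<le> m" by (cases n) auto
  have "card {v \<in> nbrs M a w. sat M v f} = card {v \<in> nbrs M' a w'. sat M' v f}"
  proof (rule dtype_determines_sat_Suc[OF assms(1,2) Dia.prems(1,2)])
    show "a \<in> I" using Dia.prems(5) by simp
    show "dtype P I (Suc m) M w = dtype P I (Suc m) M' w'" using Dia.prems(4) n by simp
    show "sat M v f \<longleftrightarrow> sat M' v' f" if "pointed_model P I M v" "pointed_model P I M' v'"
      "dtype P I m M v = dtype P I m M' v'" for M :: "'w kmodel" and M' :: "'w kmodel" and v v'
      using Dia.IH[OF that(1,2) m that(3)] Dia.prems(5) by simp
  qed
  then show ?case by (simp add: nbrs_def)
next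
  case (Neg f)
  show ?case using Neg.IH[OF Neg.prems(1,2) _ Neg.prems(4)] Neg.prems(3,5) by simp
next
  case (Conj f g)
  show ?case using Conj.IH[OF Conj.prems(1,2) _ Conj.prems(4)] Conj.prems(3,5) by simp
qed simp

lemma md_eps0: "finite P \<Longrightarrow> md (eps0 P E) = 0"
proof -
  assume "finite P"
  then have "md (eps0 P E) \<le> 0" unfolding eps0_def by (intro md_cconj_le) auto
  then show ?thesis by simp
qed

lemma md_diaeq: "md (diaeq a k s) = Suc (md s)"
  by (simp add: diaeq_def)

lemma md_type_of_succs_le:
  assumes "finite P" "finite I" "\<And>a s. a \<in> I \<Longrightarrow> s \<in># N a \<Longrightarrow> md s \<le> n"
  shows "md (type_of_succs P I E N) \<le> Suc n"
  unfolding type_of_succs_def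
  by (rule md_cconj_le[OF finite_conjuncts_of_succs[OF assms(2)]]) (use assms md_eps0 in \<open>auto simp: conjuncts_of_succs_def md_diaeq\<close>)

lemma md_type_of_succs_ge: "finite I \<Longrightarrow> a \<in> I \<Longrightarrow> s \<in># N a \<Longrightarrow> Suc (md s) \<le> md (type_of_succs P I E N)"
  unfolding type_of_succs_def using md_cconj[OF finite_conjuncts_of_succs, of I "diaeq a (count (N a) s) s" P E N]
  by (auto simp: conjuncts_of_succs_def md_diaeq)

lemma md_type_of_succs_ge1: "finite I \<Longrightarrow> I \<noteq> {} \<Longrightarrow> 1 \<le> md (type_of_succs P I E N)"
proof -
  assume "finite I" "I \<noteq> {}"
  then obtain a where "a \<in> I" by blast
  then have "diaeq a (size (N a)) Top \<in> conjuncts_of_succs P I E N" by (auto simp: conjuncts_of_succs_def)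
  from md_cconj[OF finite_conjuncts_of_succs[OF \<open>finite I\<close>] this] show ?thesis by (simp add: type_of_succs_def md_diaeq)
qed

lemma md_dtype_le:
  assumes "finite P" "finite I" "pointed_model P I M w"
  shows "md (dtype P I n M w) \<le> n"
  using assms(3)
proof (induction n arbitrary: w)
  case 0 then show ?case by (simp add: md_eps0[OF assms(1)])
next
  case (Suc n)
  show ?case unfolding dtype.simps
  proof (rule md_type_of_succs_le[OF assms(1,2)])
    fix a s assume "s \<in># image_mset (dtype P I n M) (mset_set (nbrs M a w))"
    then obtain v where "v \<in> nbrs M a w" "s = dtype P I n M v" using finite_nbrs[OF Suc.prems] by auto
    then show "md s \<le> n" using Suc.IH[OF pointed_nbrs[OF Suc.prems]] by simp
  qed
qed

section \<open>Paths, stabilization of types and uniqueness of the depth\<close>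

fun haspath :: "nat set \<Rightarrow> nat \<Rightarrow> 'w kmodel \<Rightarrow> 'w \<Rightarrow> bool" where
  "haspath I 0 M w = True"
| "haspath I (Suc k) M w = (\<exists>a\<in>I. \<exists>v\<in>nbrs M a w. haspath I k M v)"

text \<open>Each edge of the path adds one level of nesting through a \<open>diaeq\<close> conjunct.
  At its end one more level comes from the degree conjuncts, which occur in any type of positive
  depth because \<open>I\<close> is nonempty; hence the strict inequality.\<close>

lemma md_dtype_haspath:
  assumes "finite P" "finite I" "I \<noteq> {}" "pointed_model P I M w" "haspath I n M w" "n < m"
  shows "n < md (dtype P I m M w)"
  using assms(4-)
proof (induction n arbitrary: w m)
  case 0
  then show ?case using md_type_of_succs_ge1[OF assms(2,3)] by (cases m) (auto simp: Suc_le_eq)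
next
  case (Suc n)
  then obtain m' where m: "m = Suc m'" "n < m'" by (cases m) auto
  from Suc obtain a v where v: "a \<in> I" "v \<in> nbrs M a w" "haspath I n M v" by auto
  have "n < md (dtype P I m' M v)" 
    by (rule Suc.IH[OF pointed_nbrs[OF Suc.prems(1) v(2)] v(3) m(2)])
  also have "Suc (md (dtype P I m' M v)) \<le> md (dtype P I m M w)"
    unfolding m dtype.simps by (rule md_type_of_succs_ge[OF assms(2) v(1)]) (use v finite_nbrs[OF Suc.prems(1)] in auto)
  finally show ?case by simp
qed

text \<open>No path from the point reaches the level at which the unfoldings to depth
  \<open>n\<close> and to depth \<open>m\<close> start to differ. For \<open>n = 0\<close> the
  assumption is contradictory, as the empty path always exists.\<close>

lemma dtype_stable:
  assumes "finite P" "finite I" "pointed_model P I M w" "\<not> haspath I n M w" "n \<le> m"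
  shows "dtype P I m M w = dtype P I n M w"
  using assms(3-)
proof (induction n arbitrary: w m)
  case (Suc n)
  then obtain m' where m: "m = Suc m'" "n \<le> m'" by (cases m) auto
  show ?case unfolding m dtype.simps
  proof (rule type_of_succs_cong, rule image_mset_cong)
    fix a v assume "a \<in> I" "v \<in># mset_set (nbrs M a w)"
    then show "dtype P I m' M v = dtype P I n M v"
      using Suc m finite_nbrs pointed_nbrs by (metis elem_mset_set haspath.simps(2))
  qed
qed simp

text \<open>A long enough path makes the modal depth of a type expose its depth: the modal depth
  never exceeds the depth, but does exceed the length of any path shorter than the depth.\<close>

lemma dtype_depth_unique:
  fixes M M' :: "'w kmodel"
  assumes "finite P" "finite I" "I \<noteq> {}" "pointed_model P I M w" "pointed_model P I M' w'"
    and eq: "dtype P I n M w = dtype P I m M' w'" and "haspath I (min n m) M w"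
  shows "n = m"
proof (rule ccontr)
  assume "n \<noteq> m"
  then consider "n < m" | "m < n" by linarith
  then show False
  proof cases
    case 1
    \<comment> \<open>The path starts at \<open>w\<close>, while the deeper type belongs to
      \<open>w'\<close>. As \<open>w\<close> satisfies its own depth-\<open>n\<close> type, which
      equals that one, its own depth-\<open>m\<close> type is the same.\<close>
    have "sat M w (dtype P I m M' w')" using sat_dtype[OF assms(1,2,4,4), of n] eq by simp
    then have "dtype P I m M w = dtype P I n M w" using sat_dtype[OF assms(1,2,4,5)] eq by simp
    then show False using md_dtype_haspath[OF assms(1-4), of n m] md_dtype_le[OF assms(1,2,4), of n] assms 1
      by simp
  next
    case 2
    then show False using md_dtype_haspath[OF assms(1-4), of m n] md_dtype_le[OF assms(1,2,5), of m] assms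
      by simp
  qed
qed

section \<open>Transport between models, and realization of prescribed successors\<close>

text \<open>The successors in \<open>M'\<close> of a point in the image of \<open>g\<close> are
  exactly the images of its successors in \<open>M\<close>. The image is thus a generated submodel
  isomorphic to \<open>M\<close>, and neither types nor formulae look beyond it.\<close>

lemma dtype_embedding:
  assumes M: "is_model P I M" and inj: "inj_on g (mW M)"
    and nb: "\<And>a v. v \<in> mW M \<Longrightarrow> nbrs M' a (g v) = g ` nbrs M a v"
    and V: "\<And>p v. v \<in> mW M \<Longrightarrow> g v \<in> mV M' p \<longleftrightarrow> v \<in> mV M p"
    and v: "v \<in> mW M"
  shows "dtype P I n M' (g v) = dtype P I n M v" "sat M' (g v) f \<longleftrightarrow> sat M v f"
proof -
  have sub: "nbrs M a v \<subseteq> mW M" for a v using M by (auto simp: is_model_def nbrs_def)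
  have fin: "finite (nbrs M a v)" for a v
    using M sub by (meson finite_subset is_model_def)
  show "dtype P I n M' (g v) = dtype P I n M v" using v
  proof (induction n arbitrary: v)
    case 0 then show ?case by (simp add: V)
  next
    case (Suc n)
    have "image_mset (dtype P I n M') (mset_set (nbrs M' a (g v))) = image_mset (dtype P I n M) (mset_set (nbrs M a v))" for a
    proof -
      have "mset_set (nbrs M' a (g v)) = image_mset g (mset_set (nbrs M a v))"
        unfolding nb[OF Suc.prems] by (rule image_mset_mset_set[symmetric]) (meson inj inj_on_subset sub)
      then show ?thesis using fin Suc.IH[OF subsetD[OF sub]]
        by (auto simp: multiset.map_comp intro!: image_mset_cong)
    qed
    then show ?case by (simp add: V[OF Suc.prems])
  qed
  show "sat M' (g v) f \<longleftrightarrow> sat M v f" using v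
  proof (induction f arbitrary: v)
    case (Dia a k f)
    have "{u \<in> nbrs M' a (g v). sat M' u f} = g ` {u \<in> nbrs M a v. sat M u f}"
      unfolding nb[OF Dia.prems] using Dia.IH sub by blast
    moreover have "inj_on g {u \<in> nbrs M a v. sat M u f}"
      by (rule inj_on_subset[OF inj]) (use sub in blast)
    ultimately have "card {u \<in> nbrs M' a (g v). sat M' u f} = card {u \<in> nbrs M a v. sat M u f}"
      by (simp add: card_image)
    then show ?case by (simp add: nbrs_def)
  qed (auto simp: V)
qed

text \<open>\<open>Tset\<close>, \<open>FT\<close> and \<open>dtypes\<close> quantify over models
  with worlds in \<open>nat\<close>, while the class to be recognized has worlds in an arbitrary
  type; this is the bridge.\<close>

lemma nat_copy:
  fixes M :: "'w kmodel"
  assumes "pointed_model P I M w"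
  obtains M' :: "nat kmodel" and w' where "pointed_model P I M' w'"
    "\<And>n. dtype P I n M' w' = dtype P I n M w" "\<And>f. sat M' w' f \<longleftrightarrow> sat M w f"
proof -
  have M: "is_model P I M" and w: "w \<in> mW M" using assms by (auto simp: pointed_model_def)
  then obtain g :: "'w \<Rightarrow> nat" where g: "inj_on g (mW M)"
    using finite_imp_inj_to_nat_seg[of "mW M"] unfolding is_model_def by auto
  define M' where "M' = \<lparr>mW = g ` mW M, mR = (\<lambda>a. map_prod g g ` mR M a), mV = (\<lambda>p. g ` mV M p)\<rparr>"
  have R: "mR M a \<subseteq> mW M \<times> mW M" and V: "mV M p \<subseteq> mW M" for a p using M by (auto simp: is_model_def)
  have nb: "nbrs M' a (g v) = g ` nbrs M a v" if "v \<in> mW M" for a v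
  proof -
    have "x = v" if "(x, y) \<in> mR M a" "g x = g v" for x y
      using that R \<open>v \<in> mW M\<close> inj_onD[OF g] by blast
    then show ?thesis by (fastforce simp: M'_def nbrs_def)
  qed
  have VV: "g v \<in> mV M' p \<longleftrightarrow> v \<in> mV M p" if "v \<in> mW M" for p v
    using that V[of p] g by (auto simp: M'_def inj_on_def)
  have "is_model P I M'" using M by (fastforce simp: is_model_def M'_def)
  then have "pointed_model P I M' (g w)" using w by (auto simp: pointed_model_def M'_def)
  then show thesis using that dtype_embedding[OF M g nb VV w] by blast
qed

definition dtypes :: "nat set \<Rightarrow> nat set \<Rightarrow> nat \<Rightarrow> fm set" where
  "dtypes P I n = {dtype P I n M w | (M :: nat kmodel) w. pointed_model P I M w}"

lemma dtype_in_dtypes: "pointed_model P I M w \<Longrightarrow> dtype P I n M w \<in> dtypes P I n"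
proof -
  assume "pointed_model P I M w"
  then obtain M' :: "nat kmodel" and w' where "pointed_model P I M' w'" "\<And>n. dtype P I n M' w' = dtype P I n M w"
    by (rule nat_copy) (rule that)
  then show ?thesis unfolding dtypes_def by (intro CollectI exI[of _ M'] exI[of _ w']) simp
qed

lemma join_model:
  assumes "finite I" "E \<subseteq> P" and N: "\<And>a. a \<in> I \<Longrightarrow> set_mset (N a) \<subseteq> dtypes P I n"
  obtains M :: "nat kmodel" and w where "pointed_model P I M w" "val P M w = E"
    "\<forall>a\<in>I. image_mset (dtype P I n M) (mset_set (nbrs M a w)) = N a"
proof -
  have "\<exists>(M :: nat kmodel) w. s \<in> dtypes P I n \<longrightarrow> pointed_model P I M w \<and> dtype P I n M w = s" for s
    by (auto simp: dtypes_def)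
  then obtain Ms :: "fm \<Rightarrow> nat kmodel" and ws where
    Ms: "\<And>s. s \<in> dtypes P I n \<Longrightarrow> pointed_model P I (Ms s) (ws s) \<and> dtype P I n (Ms s) (ws s) = s"
    by metis
  \<comment> \<open>Listing \<open>N a\<close> gives repeated types separate copies of a model,
    indexed by their position.\<close>
  obtain ls where ls: "\<And>a. mset (ls a) = N a" using ex_mset[of "N _"] by metis
  \<comment> \<open>World \<open>v\<close> of the copy for label \<open>a\<close> and position
    \<open>i\<close>; the \<open>Suc\<close> keeps \<open>0\<close> free for the new root.\<close>
  define code where "code a i v = Suc (prod_encode (a, prod_encode (i, v)))" for a i v :: nat
  have code_eq: "code a i v = code a' i' v' \<longleftrightarrow> a = a' \<and> i = i' \<and> v = v'" for a i v a' i' v'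
    by (auto simp: code_def)
  have code_pos: "code a i v \<noteq> 0" "0 \<noteq> code a i v" for a i v by (auto simp: code_def)
  define J where "J = {(a, i). a \<in> I \<and> i < length (ls a)}"
  define piece where "piece a i = Ms (ls a ! i)" for a i
  define root where "root a i = ws (ls a ! i)" for a i
  have piece: "pointed_model P I (piece a i) (root a i)" "dtype P I n (piece a i) (root a i) = ls a ! i"
    if "(a, i) \<in> J" for a i
  proof -
    have "ls a ! i \<in> dtypes P I n" using that N[of a] ls[of a] unfolding J_def
      by (metis (no_types, lifting) case_prodD mem_Collect_eq nth_mem set_mset_mset subsetD)
    then show "pointed_model P I (piece a i) (root a i)" "dtype P I n (piece a i) (root a i) = ls a ! i"
      using Ms by (auto simp: piece_def root_def)
  qed
  define M where "M = \<lparr>mW = insert 0 {code a i v | a i v. (a, i) \<in> J \<and> v \<in> mW (piece a i)},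
    mR = (\<lambda>c. {(0, code c i (root c i)) | i. (c, i) \<in> J} \<union>
       {(code a i u, code a i v) | a i u v. (a, i) \<in> J \<and> (u, v) \<in> mR (piece a i) c}),
    mV = (\<lambda>p. (if p \<in> E then {0} else {}) \<union> {code a i v | a i v. (a, i) \<in> J \<and> v \<in> mV (piece a i) p})\<rparr>"
  have finJ: "finite J"
  proof -
    have "J = (SIGMA a:I. {..<length (ls a)})" by (auto simp: J_def)
    then show ?thesis using assms(1) by simp
  qed
  have im: "is_model P I (piece a i)" if "(a, i) \<in> J" for a i
    using piece(1)[OF that] by (simp add: pointed_model_def)
  have R: "mR (piece a i) c \<subseteq> mW (piece a i) \<times> mW (piece a i)" "c \<notin> I \<Longrightarrow> mR (piece a i) c = {}"
    "mV (piece a i) p \<subseteq> mW (piece a i)" "p \<notin> P \<Longrightarrow> mV (piece a i) p = {}" if "(a, i) \<in> J" for a i c p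
    using im[OF that] by (auto simp: is_model_def)
  have root: "root a i \<in> mW (piece a i)" if "(a, i) \<in> J" for a i
    using piece(1)[OF that] by (simp add: pointed_model_def)
  have W: "mW M = insert 0 (\<Union>(a, i)\<in>J. code a i ` mW (piece a i))"
    by (auto simp: M_def)
  then have W': "0 \<in> mW M" "\<And>a i v. (a, i) \<in> J \<Longrightarrow> v \<in> mW (piece a i) \<Longrightarrow> code a i v \<in> mW M"
    by auto
  have "finite (mW M)" unfolding W using finJ im by (auto simp: is_model_def)
  then have "is_model P I M" unfolding is_model_def
  proof (intro conjI allI impI)
    show "mW M \<noteq> {}" by (simp add: W)
    show "mR M c \<subseteq> mW M \<times> mW M" for c
    proof (rule subrelI)
      fix x y assume "(x, y) \<in> mR M c"
      then consider i where "x = 0" "y = code c i (root c i)" "(c, i) \<in> J"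
        | a i u v where "x = code a i u" "y = code a i v" "(a, i) \<in> J" "(u, v) \<in> mR (piece a i) c"
        unfolding M_def by auto
      then show "(x, y) \<in> mW M \<times> mW M"
      proof cases
        case 1 then show ?thesis using W' root by auto
      next
        case 2 then show ?thesis using W'(2) R(1)[OF 2(3)] by blast
      qed
    qed
    show "mR M c = {}" if "c \<notin> I" for c using R(2)[OF _ that] that by (auto simp: M_def J_def)
    show "mV M p \<subseteq> mW M" for p
    proof
      fix x assume "x \<in> mV M p"
      then consider "x = 0" | a i v where "x = code a i v" "(a, i) \<in> J" "v \<in> mV (piece a i) p"
        unfolding M_def by (auto split: if_splits)
      then show "x \<in> mW M" by cases (use W' R(3) in blast)+
    qed
    show "mV M p = {}" if "p \<notin> P" for p using R(4)[OF _ that] that assms(2) by (auto simp: M_def)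
  qed
  then have pm: "pointed_model P I M 0" by (simp add: pointed_model_def W)
  have dt: "dtype P I n M (code a i v) = dtype P I n (piece a i) v" if "(a, i) \<in> J" "v \<in> mW (piece a i)" for a i v
  proof (rule dtype_embedding(1)[OF im[OF that(1)] _ _ _ that(2)])
    show "inj_on (code a i) (mW (piece a i))" by (auto simp: inj_on_def code_eq)
    show "nbrs M c (code a i u) = code a i ` nbrs (piece a i) c u" for c u
      using that(1) by (auto simp: M_def nbrs_def code_eq code_pos)
    show "code a i u \<in> mV M p \<longleftrightarrow> u \<in> mV (piece a i) p" for p u
      using that(1) by (auto simp: M_def code_eq code_pos)
  qed
  have "val P M 0 = E" using assms(2) by (auto simp: M_def code_pos)
  moreover have "image_mset (dtype P I n M) (mset_set (nbrs M c 0)) = N c" if "c \<in> I" for c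
  proof -
    have "nbrs M c 0 = (\<lambda>i. code c i (root c i)) ` {..<length (ls c)}"
      using that by (auto simp: M_def nbrs_def code_pos J_def)
    moreover have "inj_on (\<lambda>i. code c i (root c i)) {..<length (ls c)}" by (auto simp: inj_on_def code_eq)
    ultimately have "mset_set (nbrs M c 0) = image_mset (\<lambda>i. code c i (root c i)) (mset_set {..<length (ls c)})"
      by (simp add: image_mset_mset_set)
    then have "image_mset (dtype P I n M) (mset_set (nbrs M c 0)) = image_mset (\<lambda>i. ls c ! i) (mset_set {..<length (ls c)})"
      using that piece(2) root dt by (auto simp: multiset.map_comp J_def intro!: image_mset_cong)
    also have "\<dots> = mset (map (\<lambda>i. ls c ! i) [0..<length (ls c)])"
      by (simp only: mset_map mset_upt atLeast0LessThan)
    also have "\<dots> = N c" by (simp add: map_nth ls del: mset_map)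
    finally show ?thesis .
  qed
  ultimately show thesis using that pm by blast
qed

section \<open>Full types are canonical types\<close>

definition typeset :: "nat set \<Rightarrow> nat set \<Rightarrow> fm set \<Rightarrow> (nat \<Rightarrow> nat) \<Rightarrow> 'w kmodel \<Rightarrow> 'w \<Rightarrow> fm set" where
  "typeset P I T k0 M w = {eps P M w}
     \<union> {diaeq a l t | a l t. a \<in> I \<and> 1 \<le> l \<and> l \<le> k0 a - 1 \<and> t \<in> T \<and> sat M w (diaeq a l t)}
     \<union> {Dia a (k0 a) t | a t. a \<in> I \<and> t \<in> T \<and> sat M w (Dia a (k0 a) t)}
     \<union> {diaeq a (card (nbrs M a w)) Top | a. a \<in> I \<and> card (nbrs M a w) < k0 a}"

lemma finite_typeset:
  assumes "finite I" "finite T"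
  shows "finite (typeset P I T k0 M w)"
proof -
  have "typeset P I T k0 M w \<subseteq> {eps P M w}
     \<union> (\<lambda>(a, l, t). diaeq a l t) ` (SIGMA a:I. {..k0 a} \<times> T)
     \<union> (\<lambda>(a, t). Dia a (k0 a) t) ` (I \<times> T)
     \<union> (\<lambda>a. diaeq a (card (nbrs M a w)) Top) ` I"
    unfolding typeset_def by force
  then show ?thesis by (rule finite_subset) (use assms in simp)
qed

lemma Tset_eq: "Tset P I ks = {gtype P I ks M w | (M :: nat kmodel) w. pointed_model P I M w}"
  by (cases ks) auto

text \<open>All types of one width are canonical conjunctions of subsets of a single finite pool
  \<open>U\<close>. Even the degrees in it are bounded, since a degree conjunct occurs only below
  the width.\<close>

lemma finite_Tset:
  assumes "finite P" "finite I"
  shows "finite (Tset P I ks)"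
proof (induction ks)
  case Nil
  have "Tset P I [] \<subseteq> eps0 P ` Pow P" by (auto simp: eps_def)
  then show ?case by (rule finite_subset) (use assms in simp)
next
  case (Cons k0 ks)
  define U where "U = eps0 P ` Pow P
     \<union> (\<lambda>(a, l, t). diaeq a l t) ` (SIGMA a:I. {..k0 a} \<times> Tset P I ks)
     \<union> (\<lambda>(a, t). Dia a (k0 a) t) ` (I \<times> Tset P I ks)
     \<union> (\<lambda>(a, l). diaeq a l Top) ` (SIGMA a:I. {..k0 a})"
  have "finite U" using assms Cons by (simp add: U_def)
  have "typeset P I (Tset P I ks) k0 M w \<subseteq> U" for M :: "nat kmodel" and w
    unfolding typeset_def U_def eps_def by (intro Un_mono) force+
  then have "Tset P I (k0 # ks) \<subseteq> cconj ` Pow U"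
    unfolding Tset.simps typeT_def typeset_def[symmetric] by blast
  then show ?case by (rule finite_subset) (use \<open>finite U\<close> in simp)
qed

lemma sat_typeT:
  assumes "finite P" "finite I" "finite T"
  shows "sat M w (typeT P I T k0 M' w') \<longleftrightarrow> val P M' w' = val P M w \<and> (\<forall>a\<in>I.
    (\<forall>t\<in>T. let c' = card {v \<in> nbrs M' a w'. sat M' v t}; c = card {v \<in> nbrs M a w. sat M v t} in
       (1 \<le> c' \<and> c' \<le> k0 a - 1 \<longrightarrow> c = c') \<and> (k0 a \<le> c' \<longrightarrow> k0 a \<le> c))
    \<and> (card (nbrs M' a w') < k0 a \<longrightarrow> card (nbrs M a w) = card (nbrs M' a w')))"
proof -
  have "sat M w (typeT P I T k0 M' w') \<longleftrightarrow> (\<forall>f\<in>typeset P I T k0 M' w'. sat M w f)"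
    unfolding typeT_def typeset_def[symmetric] by (rule sat_cconj[OF finite_typeset[OF assms(2,3)]])
  also have "\<dots> \<longleftrightarrow> sat M w (eps0 P (val P M' w')) \<and> (\<forall>a\<in>I.
    (\<forall>t\<in>T. \<forall>l. 1 \<le> l \<and> l \<le> k0 a - 1 \<and> sat M' w' (diaeq a l t) \<longrightarrow> sat M w (diaeq a l t)) \<and>
    (\<forall>t\<in>T. sat M' w' (Dia a (k0 a) t) \<longrightarrow> sat M w (Dia a (k0 a) t)) \<and>
    (card (nbrs M' a w') < k0 a \<longrightarrow> sat M w (diaeq a (card (nbrs M' a w')) Top)))"
    unfolding typeset_def eps_def ball_Un by (simp del: sat.simps) (auto simp del: sat.simps)
  finally show ?thesis unfolding sat_diaeq sat_eps0[OF assms(1) Collect_subset] Let_def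
    by (auto simp: nbrs_def)
qed

lemma sat_gtype_self:
  assumes "finite P" "finite I"
  shows "sat M w (gtype P I ks M w)"
proof (cases ks)
  case Nil then show ?thesis by (simp add: eps_def sat_eps0[OF assms(1) Collect_subset])
next
  case (Cons k0 ks')
  then show ?thesis by (simp add: sat_typeT[OF assms finite_Tset[OF assms]] Let_def)
qed

text \<open>When all degrees lie below the widths, no count reaches a threshold: the
  \<open>Dia\<close> conjuncts disappear, the exact counts cover precisely the support of
  \<open>N a\<close>, and every degree is recorded. The fact is applied to a point itself and to any
  other point whose type holds there.\<close>

lemma typeset_eq_conjuncts_of_succs:
  assumes "val P M w = E"
    and "\<And>a. a \<in> I \<Longrightarrow> set_mset (N a) \<subseteq> T \<and> card (nbrs M a w) = size (N a) \<and> size (N a) < k0 a"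
    and c: "\<And>a t. a \<in> I \<Longrightarrow> t \<in> T \<Longrightarrow> card {v \<in> nbrs M a w. sat M v t} = count (N a) t"
  shows "typeset P I T k0 M w = conjuncts_of_succs P I E N"
proof -
  have lt: "count (N a) t < k0 a" if "a \<in> I" for a t
    using assms(2)[OF that] count_le_size[of "N a" t] by linarith
  have "{Dia a (k0 a) t | a t. a \<in> I \<and> t \<in> T \<and> sat M w (Dia a (k0 a) t)} = {}"
  proof -
    have "\<not> sat M w (Dia a (k0 a) t)" if "a \<in> I" "t \<in> T" for a t
      using lt[OF that(1), of t] c[OF that] by (simp add: nbrs_def)
    then show ?thesis by blast
  qed
  moreover have "{diaeq a l t | a l t. a \<in> I \<and> 1 \<le> l \<and> l \<le> k0 a - 1 \<and> t \<in> T \<and> sat M w (diaeq a l t)}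
    = {diaeq a (count (N a) s) s | a s. a \<in> I \<and> s \<in># N a}" (is "?A = ?B")
  proof
    show "?A \<subseteq> ?B" using c by (fastforce simp: sat_diaeq count_eq_zero_iff[symmetric])
    show "?B \<subseteq> ?A"
    proof clarify
      fix a s assume as: "a \<in> I" "s \<in># N a"
      then have "s \<in> T" "1 \<le> count (N a) s" "count (N a) s \<le> k0 a - 1"
        using assms(2)[of a] lt[of a s] by (auto simp: Suc_le_eq)
      then show "\<exists>a' l t. diaeq a (count (N a) s) s = diaeq a' l t \<and> a' \<in> I \<and> 1 \<le> l \<and> l \<le> k0 a' - 1 \<and> t \<in> T \<and> sat M w (diaeq a' l t)"
        using as c[of a s] by (intro exI[of _ a] exI[of _ "count (N a) s"] exI[of _ s]) (simp add: sat_diaeq)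
    qed
  qed
  moreover have "{diaeq a (card (nbrs M a w)) Top | a. a \<in> I \<and> card (nbrs M a w) < k0 a} = {diaeq a (size (N a)) Top | a. a \<in> I}"
    using assms(2) by (intro Collect_cong) metis
  ultimately show ?thesis unfolding typeset_def conjuncts_of_succs_def eps_def assms(1) by (simp only: Un_empty_right)
qed

section \<open>Widths above all degrees\<close>

fun wide :: "nat set \<Rightarrow> (nat \<Rightarrow> nat) list \<Rightarrow> 'w kmodel \<Rightarrow> 'w \<Rightarrow> bool" where
  "wide I [] M w = True"
| "wide I (k # ks) M w = (\<forall>a\<in>I. card (nbrs M a w) < k a \<and> (\<forall>v\<in>nbrs M a w. wide I ks M v))"

text \<open>Types of a small width are not mutually exclusive: a type that counts up to \<open>k\<close> may hold at points
  with additional successors. At a point whose degrees stay below the widths this cannot happen. There, by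
  induction, every successor satisfies exactly one type, so the counts over all types add up to the degree,
  and the inequalities imposed by a type that holds leave no slack.\<close>

lemma gtype_wide:
  fixes M :: "nat kmodel"
  assumes "finite P" "finite I" "pointed_model P I M w" "wide I ks M w"
  shows "gtype P I ks M w = dtype P I (length ks) M w \<and>
    (\<forall>(M' :: nat kmodel) w'. pointed_model P I M' w' \<longrightarrow> sat M w (gtype P I ks M' w') \<longrightarrow>
       gtype P I ks M' w' = dtype P I (length ks) M w)"
  using assms(3,4)
proof (induction ks arbitrary: w)
  case Nil
  then show ?case by (auto simp: eps_def sat_eps0[OF assms(1) Collect_subset])
next
  case (Cons k0 ks)
  define T where "T = Tset P I ks"
  define n where "n = length ks"
  define N where "N a = image_mset (dtype P I n M) (mset_set (nbrs M a w))" for a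
  have finT: "finite T" unfolding T_def by (rule finite_Tset[OF assms(1,2)])
  note fin = finite_nbrs[OF Cons.prems(1)]
  have IH: "gtype P I ks M v = dtype P I n M v" "t \<in> T \<Longrightarrow> sat M v t \<Longrightarrow> t = dtype P I n M v"
    if "a \<in> I" "v \<in> nbrs M a w" for a v t
    using Cons.IH[OF pointed_nbrs[OF Cons.prems(1) that(2)]] Cons.prems(2) that
    unfolding T_def Tset_eq n_def by auto
  have satT: "sat M v t \<longleftrightarrow> dtype P I n M v = t" if "a \<in> I" "v \<in> nbrs M a w" "t \<in> T" for a v t
    using IH[OF that(1,2)] sat_gtype_self[OF assms(1,2), of M v ks] that(3) by metis
  have NT: "set_mset (N a) \<subseteq> T" if a: "a \<in> I" for a
  proof
    fix s assume "s \<in># N a"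
    then obtain v where "v \<in> nbrs M a w" "s = gtype P I ks M v"
      using fin IH(1)[OF a] unfolding N_def by auto
    then show "s \<in> T" using pointed_nbrs[OF Cons.prems(1)] unfolding T_def Tset_eq by blast
  qed
  have c: "card {v \<in> nbrs M a w. sat M v t} = count (N a) t" if "a \<in> I" "t \<in> T" for a t
  proof -
    have "{v \<in> nbrs M a w. sat M v t} = {v \<in> nbrs M a w. dtype P I n M v = t}"
      using satT that by blast
    then show ?thesis by (simp add: N_def count_image_mset_set[OF fin])
  qed
  have sz: "card (nbrs M a w) = size (N a)" for a by (simp add: N_def)
  have lt: "size (N a) < k0 a" if "a \<in> I" for a using Cons.prems(2) that sz by simp
  have target: "dtype P I (length (k0 # ks)) M w = cconj (conjuncts_of_succs P I (val P M w) N)"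
    by (simp add: n_def[symmetric] type_of_succs_def N_def[abs_def])
  have "typeset P I T k0 M w = conjuncts_of_succs P I (val P M w) N"
    by (rule typeset_eq_conjuncts_of_succs) (use NT c sz lt in auto)
  moreover have "typeset P I T k0 M' w' = conjuncts_of_succs P I (val P M w) N"
    if pm': "pointed_model P I M' w'" and sat: "sat M w (typeT P I T k0 M' w')" for M' :: "nat kmodel" and w'
  proof (rule typeset_eq_conjuncts_of_succs)
    note S = sat[unfolded sat_typeT[OF assms(1,2) finT] Let_def]
    show "val P M' w' = val P M w" using S by blast
    define c' where "c' a t = card {v \<in> nbrs M' a w'. sat M' v t}" for a t
    have c'_lt: "c' a t < k0 a" and c'_eq: "1 \<le> c' a t \<Longrightarrow> c' a t = count (N a) t" if "a \<in> I" "t \<in> T" for a t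
    proof -
      have S1: "(1 \<le> c' a t \<and> c' a t \<le> k0 a - 1 \<longrightarrow> count (N a) t = c' a t) \<and>
          (k0 a \<le> c' a t \<longrightarrow> k0 a \<le> count (N a) t)"
        using bspec[OF conjunct1[OF bspec[OF conjunct2[OF S] that(1)]] that(2)] unfolding c'_def c[OF that] .
      show "c' a t < k0 a"
      proof (rule ccontr)
        assume "\<not> c' a t < k0 a"
        then have "k0 a \<le> count (N a) t" using S1 by simp
        then show False using lt[OF that(1)] count_le_size[of "N a" t] by linarith
      qed
      then have "c' a t \<le> k0 a - 1" by linarith
      then show "1 \<le> c' a t \<Longrightarrow> c' a t = count (N a) t" using S1 by simp
    qed
    have size_sum: "size (N a) = (\<Sum>t\<in>T. count (N a) t)" if "a \<in> I" for a
      unfolding size_multiset_overloaded_eq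
      by (rule sum.mono_neutral_left[OF finT NT[OF that]]) (simp add: not_in_iff[symmetric])
    \<comment> \<open>Each successor of \<open>w'\<close> satisfies at least its own type, so the
      classes cover all successors. They may overlap, as nothing is known about the degrees beyond
      \<open>w'\<close>; hence only an inequality.\<close>
    have deg_le: "card (nbrs M' a w') \<le> (\<Sum>t\<in>T. c' a t)" if "a \<in> I" for a
    proof -
      have "nbrs M' a w' \<subseteq> (\<Union>t\<in>T. {v \<in> nbrs M' a w'. sat M' v t})"
      proof
        fix v assume v: "v \<in> nbrs M' a w'"
        have "gtype P I ks M' v \<in> T"
          unfolding T_def Tset_eq using pointed_nbrs[OF pm' v] by blast
        then show "v \<in> (\<Union>t\<in>T. {v \<in> nbrs M' a w'. sat M' v t})"
          using v sat_gtype_self[OF assms(1,2), of M' v ks] by auto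
      qed
      then have "card (nbrs M' a w') \<le> card (\<Union>t\<in>T. {v \<in> nbrs M' a w'. sat M' v t})"
        by (rule card_mono[rotated]) (use finT finite_nbrs[OF pm'] in auto)
      also have "\<dots> \<le> (\<Sum>t\<in>T. c' a t)" unfolding c'_def by (rule card_UN_le[OF finT])
      finally show ?thesis .
    qed
    have le: "c' a t \<le> count (N a) t" if "a \<in> I" "t \<in> T" for a t
      using c'_eq[OF that] by (cases "c' a t") auto
    have deg: "card (nbrs M' a w') = size (N a)" if "a \<in> I" for a
    proof -
      \<comment> \<open>This puts the degree of \<open>w'\<close> below the width, so its type does
        record the degree, and \<open>w\<close> satisfies that conjunct.\<close>
      have "card (nbrs M' a w') \<le> size (N a)"
        using deg_le[OF that] sum_mono[of T "c' a" "count (N a)"] le[OF that] size_sum[OF that] by simp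
      then show ?thesis using conjunct2[OF bspec[OF conjunct2[OF S] that]] lt[OF that] sz by simp
    qed
    show "set_mset (N a) \<subseteq> T \<and> card (nbrs M' a w') = size (N a) \<and> size (N a) < k0 a" if "a \<in> I" for a
      using NT deg lt that by auto
    show "card {v \<in> nbrs M' a w'. sat M' v t} = count (N a) t" if "a \<in> I" "t \<in> T" for a t
    proof -
      have "(\<Sum>t\<in>T. c' a t) = (\<Sum>t\<in>T. count (N a) t)"
        using deg_le[OF that(1)] sum_mono[of T "c' a" "count (N a)"] le[OF that(1)] size_sum[OF that(1)] deg[OF that(1)] by simp
      then have "c' a t = count (N a) t"
        using le[OF that(1)] finT that(2) by (metis sum_mono_inv)
      then show ?thesis by (simp add: c'_def)
    qed
  qed
  ultimately show ?case unfolding target gtype.simps T_def[symmetric]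
    unfolding typeT_def typeset_def[symmetric]
    by (intro conjI allI impI arg_cong[where f = cconj])
qed

lemma wide_if:
  assumes "\<And>i v a. i < length ks \<Longrightarrow> (w, v) \<in> (\<Union>b\<in>I. mR M b) ^^ i \<Longrightarrow> a \<in> I \<Longrightarrow> card (nbrs M a v) < (ks ! i) a"
  shows "wide I ks M w"
  using assms
proof (induction ks arbitrary: w)
  case (Cons k ks)
  have "card (nbrs M a w) < k a" if "a \<in> I" for a using Cons.prems[of 0 w a] that by simp
  moreover have "wide I ks M v" if "a \<in> I" "v \<in> nbrs M a w" for a v
  proof (rule Cons.IH)
    fix i u b assume "i < length ks" "(v, u) \<in> (\<Union>b\<in>I. mR M b) ^^ i" "b \<in> I"
    moreover have "(w, v) \<in> (\<Union>b\<in>I. mR M b)" using that by (auto simp: nbrs_def)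
    ultimately show "card (nbrs M b u) < (ks ! i) b"
      using Cons.prems[of "Suc i" u b] relpow_Suc_I2[of w v "\<Union>b\<in>I. mR M b" u i] by simp
  qed
  ultimately show ?case by simp
qed simp

text \<open>The list entry at position \<open>i\<close> exceeds the degrees of all points reached in
  exactly \<open>i\<close> steps; its definition counts from 1, hence the \<open>i - 1\<close>
  there. The maximum is meaningful because reachable points stay in the finite set of
  worlds.\<close>

lemma wide_widths:
  assumes "pointed_model P I M w"
  shows "wide I (widths I M w n) M w"
proof (rule wide_if)
  fix i v a assume i: "i < length (widths I M w n)" and v: "(w, v) \<in> (\<Union>b\<in>I. mR M b) ^^ i"
  define S where "S = {card (nbrs M a v) | v. (w, v) \<in> (\<Union>b\<in>I. mR M b) ^^ i}"
  have "u \<in> mW M" if "(w, u) \<in> (\<Union>b\<in>I. mR M b) ^^ i" for u i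
    using that
    by (induction i arbitrary: u) (use assms in \<open>auto simp: pointed_model_def is_model_def\<close>)
  then have "S \<subseteq> (\<lambda>v. card (nbrs M a v)) ` mW M" by (auto simp: S_def)
  then have "finite S" using assms by (auto simp: pointed_model_def is_model_def intro: finite_subset)
  then have "card (nbrs M a v) \<le> Max S" using v by (intro Max_ge) (auto simp: S_def)
  then show "card (nbrs M a v) < (widths I M w n ! i) a"
    using i by (simp add: widths_def S_def nth_map less_Suc_eq_le del: upt_Suc)
qed

lemma FT_eq_dtypes: "finite P \<Longrightarrow> finite I \<Longrightarrow> FT P I n = dtypes P I n"
  using gtype_wide[OF _ _ _ wide_widths] unfolding FT_def dtypes_def full_type_def
  by (intro Collect_cong ex_cong1) (auto simp: widths_def simp del: upt_Suc)

text \<open>The depth-0 conjunct is unique for a semantic reason: all conjuncts of a satisfied formula hold,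
  and only one depth-0 type holds at a given point.\<close>

lemma typ0_eq:
  assumes "finite P" "E \<subseteq> P" "eps0 P E \<in> conj_subterms t" "sat M w t"
  shows "typ0 P t = eps0 P E"
  unfolding typ0_def
proof (rule the_equality)
  show "eps0 P E \<in> {eps0 P P' | P'. P' \<subseteq> P} \<and> eps0 P E \<in> conj_subterms t" using assms by blast
  fix d assume "d \<in> {eps0 P P' | P'. P' \<subseteq> P} \<and> d \<in> conj_subterms t"
  then obtain E' where E': "d = eps0 P E'" "E' \<subseteq> P" "d \<in> conj_subterms t" by blast
  have "E = val P M w" "E' = val P M w"
    using conj_subterms_sat[OF _ assms(4)] assms(3) E' sat_eps0[OF assms(1)] assms(2) by metis+
  then show "d = eps0 P E" using E' by simp
qed

lemma typ0_dtype:
  assumes "finite P" "finite I" "pointed_model P I M w"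
  shows "typ0 P (dtype P I n M w) = eps0 P (val P M w)"
proof (rule typ0_eq[OF assms(1) Collect_subset])
  show "sat M w (dtype P I n M w)" using sat_dtype[OF assms assms(3)] by simp
  show "eps0 P (val P M w) \<in> conj_subterms (dtype P I n M w)"
  proof (cases n)
    case (Suc m)
    show ?thesis unfolding Suc dtype.simps type_of_succs_def
      by (rule conj_subterms_cconj[OF finite_conjuncts_of_succs[OF assms(2)]]) (simp add: conjuncts_of_succs_def)
  qed (simp add: conj_subterms_self)
qed

section \<open>Semidecidable predicates\<close>

inductive_cases reval_ZrE: "reval Zr xs y"
inductive_cases reval_ScE: "reval Sc xs y"
inductive_cases reval_PjE: "reval (Pj i) xs y"
inductive_cases reval_CnE: "reval (Cn f gs) xs y"
inductive_cases reval_Pr0E: "reval (Pr f g) (0 # xs) y"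
inductive_cases reval_PrSucE: "reval (Pr f g) (Suc n # xs) y"
inductive_cases reval_PrE: "reval (Pr f g) xs y"
inductive_cases reval_MnE: "reval (Mn f) xs y"

text \<open>Serves to draw conclusions from a halting search: the value 0 on which it stopped must
  be the value that the test is known to have.\<close>

lemma reval_deterministic: "reval c xs y \<Longrightarrow> reval c xs y' \<Longrightarrow> y' = y"
proof (induction arbitrary: y' rule: reval.induct)
  case (4 xs gs ys f z)
  from 4(4) obtain ys' where ys': "list_all2 (\<lambda>g y. reval g xs y) gs ys'" "reval f ys' y'"
    by (rule reval_CnE)
  have "ys' = ys"
  proof (rule nth_equalityI)
    show "length ys' = length ys" 
      using list_all2_lengthD[OF 4(1)] list_all2_lengthD[OF ys'(1)] by simp
    fix i assume "i < length ys'"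
    then show "ys' ! i = ys ! i"
      
      using list_all2_nthD2[OF 4(1)] list_all2_nthD2[OF ys'(1)] list_all2_lengthD[OF 4(1)] list_all2_lengthD[OF ys'(1)]
      by auto
  qed
  then show ?case using 4(2) ys'(2) by simp
next
  case (7 f y xs)
  from 7(4) have y': "reval f (y' # xs) 0" "\<forall>i<y'. \<exists>m. reval f (i # xs) (Suc m)"
    by (auto elim: reval_MnE)
  show ?case
  proof (rule linorder_cases[of y' y])
    assume "y' < y"
    then obtain m where "\<forall>x. reval f (y' # xs) x \<longrightarrow> x = Suc m" using 7(3) by blast
    then show ?thesis using y'(1) by blast
  next
    assume "y < y'"
    then obtain m where "reval f (y # xs) (Suc m)" using y'(2) by blast
    then show ?thesis using 7(2) by blast
  qed simp
next
  case (6 f g n xs y z)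
  from 6(5) obtain y2 where "reval (Pr f g) (n # xs) y2" "reval g (y2 # n # xs) y'"
    by (rule reval_PrSucE)
  then show ?case using 6 by simp
next
  case (5 f xs z g)
  from 5(3) show ?case by (rule reval_Pr0E) (use 5 in simp)
qed (auto elim: reval_ZrE reval_ScE reval_PjE)

section \<open>Total recursive functions of several arguments\<close>

definition computable_n :: "nat \<Rightarrow> (nat list \<Rightarrow> nat) \<Rightarrow> bool" where
  "computable_n k f \<longleftrightarrow> (\<exists>c. \<forall>xs. length xs = k \<longrightarrow> reval c xs (f xs))"

lemma computable_n_cong: "computable_n k f \<Longrightarrow> (\<And>xs. length xs = k \<Longrightarrow> f xs = g xs) \<Longrightarrow> computable_n k g"
  unfolding computable_n_def by metis

lemma computable_n_nth: "i < k \<Longrightarrow> computable_n k (\<lambda>xs. xs ! i)"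
  unfolding computable_n_def using reval.intros(3) by metis

lemma computable_n_Cn:
  assumes "computable_n (length gs) f" "\<And>g. g \<in> set gs \<Longrightarrow> computable_n k g"
  shows "computable_n k (\<lambda>xs. f (map (\<lambda>g. g xs) gs))"
proof -
  obtain c where c: "\<And>ys. length ys = length gs \<Longrightarrow> reval c ys (f ys)"
    using assms(1) unfolding computable_n_def by blast
  obtain d where d: "\<And>g xs. g \<in> set gs \<Longrightarrow> length xs = k \<Longrightarrow> reval (d g) xs (g xs)"
    using assms(2) unfolding computable_n_def by metis
  have "reval (Cn c (map d gs)) xs (f (map (\<lambda>g. g xs) gs))" if "length xs = k" for xs
    by (rule reval.intros(4)[where ys = "map (\<lambda>g. g xs) gs"]) (use c d that in \<open>auto simp: list_all2_conv_all_nth\<close>)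
  then show ?thesis unfolding computable_n_def by blast
qed

lemma computable_n_Suc: "computable_n k f \<Longrightarrow> computable_n k (\<lambda>xs. Suc (f xs))"
proof -
  assume f: "computable_n k f"
  have "computable_n (length [f]) (\<lambda>xs. Suc (hd xs))"
    unfolding computable_n_def by (intro exI[of _ Sc]) (auto simp: length_Suc_conv intro: reval.intros)
  from computable_n_Cn[OF this, of k] f show ?thesis by simp
qed

lemma computable_n_const: "computable_n k (\<lambda>_. m)"
proof (induction m)
  case 0 show ?case unfolding computable_n_def by (auto intro: reval.intros)
qed (rule computable_n_Suc)

lemma computable_n_rec:
  assumes "computable_n k b" "computable_n (Suc (Suc k)) s" "computable_n k m"
  shows "computable_n k (\<lambda>xs. rec_nat (b xs) (\<lambda>n y. s (y # n # xs)) (m xs))"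
proof -
  obtain cb where cb: "\<And>xs. length xs = k \<Longrightarrow> reval cb xs (b xs)"
    using assms(1) unfolding computable_n_def by blast
  obtain cs where cs: "\<And>xs. length xs = Suc (Suc k) \<Longrightarrow> reval cs xs (s xs)"
    using assms(2) unfolding computable_n_def by blast
  have "reval (Pr cb cs) (n # xs) (rec_nat (b xs) (\<lambda>n y. s (y # n # xs)) n)" if "length xs = k" for n xs
  proof (induction n)
    case 0
    then show ?case using cb[OF that] by (auto intro: reval.intros(5))
  next
    case (Suc n)
    show ?case by (rule reval.intros(6)[OF Suc]) (use cs that in simp)
  qed
  then have "computable_n (Suc k) (\<lambda>zs. rec_nat (b (tl zs)) (\<lambda>n y. s (y # n # tl zs)) (hd zs))"
    unfolding computable_n_def by (intro exI[of _ "Pr cb cs"]) (auto simp: length_Suc_conv)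
  \<comment> \<open>\<open>Pr\<close> expects the recursion argument in front of the parameters;
    composing with \<open>m\<close> and all projections produces that list from
    \<open>xs\<close>.\<close>
  then have "computable_n k (\<lambda>xs. (\<lambda>zs. rec_nat (b (tl zs)) (\<lambda>n y. s (y # n # tl zs)) (hd zs))
      (map (\<lambda>g. g xs) (m # map (\<lambda>i xs. xs ! i) [0..<k])))"
    by (intro computable_n_Cn) (use assms(3) in \<open>auto intro: computable_n_nth\<close>)
  then show ?thesis
  proof (rule computable_n_cong)
    fix xs :: "nat list" assume "length xs = k"
    then have "map (\<lambda>g. g xs) (map (\<lambda>i xs. xs ! i) [0..<k]) = xs"
      by (auto intro: nth_equalityI)
    then show "(\<lambda>zs. rec_nat (b (tl zs)) (\<lambda>n y. s (y # n # tl zs)) (hd zs))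
      (map (\<lambda>g. g xs) (m # map (\<lambda>i xs. xs ! i) [0..<k])) = rec_nat (b xs) (\<lambda>n y. s (y # n # xs)) (m xs)"
      by simp
  qed
qed

lemma computable_n_Least:
  assumes "computable_n (Suc k) f" "\<And>xs. length xs = k \<Longrightarrow> \<exists>y. f (y # xs) = 0"
  shows "computable_n k (\<lambda>xs. LEAST y. f (y # xs) = 0)"
proof -
  obtain c where c: "\<And>xs. length xs = Suc k \<Longrightarrow> reval c xs (f xs)"
    using assms(1) unfolding computable_n_def by blast
  have "reval (Mn c) xs (LEAST y. f (y # xs) = 0)" if "length xs = k" for xs
  proof (rule reval.intros(7), goal_cases)
    case 1
    have "f ((LEAST y. f (y # xs) = 0) # xs) = 0" by (rule LeastI_ex[OF assms(2)[OF that]])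
    then show ?case using c[of "(LEAST y. f (y # xs) = 0) # xs"] that by simp
  next
    case 2
    show ?case
    proof (intro allI impI)
      fix i assume "i < (LEAST y. f (y # xs) = 0)"
      then have "f (i # xs) \<noteq> 0" by (rule not_less_Least)
      then show "\<exists>m. reval c (i # xs) (Suc m)" using c[of "i # xs"] that by (metis length_Cons not0_implies_Suc)
    qed
  qed
  then show ?thesis unfolding computable_n_def by blast
qed

lemma computable_n_add:
  assumes "computable_n k f" "computable_n k g" shows "computable_n k (\<lambda>xs. f xs + g xs)"
proof -
  have "rec_nat a (\<lambda>n y. Suc y) b = a + b" for a b by (induction b) auto
  moreover have "computable_n k (\<lambda>xs. rec_nat (f xs) (\<lambda>n y. (\<lambda>zs. Suc (zs ! 0)) (y # n # xs)) (g xs))"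
    by (intro computable_n_rec computable_n_Suc computable_n_nth assms) simp
  ultimately show ?thesis by simp
qed

lemma computable_n_diff:
  assumes "computable_n k f" "computable_n k g" shows "computable_n k (\<lambda>xs. f xs - g xs)"
proof -
  have pred: "computable_n k' (\<lambda>xs. h xs - 1)" if "computable_n k' h" for k' h
  proof -
    have "rec_nat 0 (\<lambda>n y. n) b = b - 1" for b :: nat by (cases b) auto
    moreover have "computable_n k' (\<lambda>xs. rec_nat 0 (\<lambda>n y. (\<lambda>zs. zs ! 1) (y # n # xs)) (h xs))"
      by (intro computable_n_rec computable_n_const computable_n_nth that) simp
    ultimately show ?thesis by simp
  qed
  have "rec_nat a (\<lambda>n y. y - 1) b = a - b" for a b :: nat by (induction b) auto
  moreover have "computable_n k (\<lambda>xs. rec_nat (f xs) (\<lambda>n y. (\<lambda>zs. zs ! 0 - 1) (y # n # xs)) (g xs))"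
    by (intro computable_n_rec pred computable_n_nth assms) simp
  ultimately show ?thesis by simp
qed

lemma computable_n_triangle: "computable_n k f \<Longrightarrow> computable_n k (\<lambda>xs. triangle (f xs))"
proof -
  assume f: "computable_n k f"
  have "rec_nat 0 (\<lambda>n y. y + Suc n) b = triangle b" for b by (induction b) auto
  moreover have "computable_n k (\<lambda>xs. rec_nat 0 (\<lambda>n y. (\<lambda>zs. zs ! 0 + Suc (zs ! 1)) (y # n # xs)) (f xs))"
    by (intro computable_n_rec computable_n_const computable_n_add computable_n_Suc computable_n_nth f) simp_all
  ultimately show ?thesis by simp
qed

section \<open>Unary recursive functions and Cantor pairing\<close>

text \<open>From here on several arguments are packed by \<open>pair\<close>, so that closure rules
  need not mention arities.\<close>

definition computable :: "(nat \<Rightarrow> nat) \<Rightarrow> bool" where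
  "computable f \<longleftrightarrow> (\<exists>c. \<forall>x. reval c [x] (f x))"

abbreviation pair :: "nat \<Rightarrow> nat \<Rightarrow> nat" where
  "pair x y \<equiv> prod_encode (x, y)"

definition pfst :: "nat \<Rightarrow> nat" where "pfst p = fst (prod_decode p)"
definition psnd :: "nat \<Rightarrow> nat" where "psnd p = snd (prod_decode p)"

lemma pfst_pair [simp]: "pfst (pair x y) = x" and psnd_pair [simp]: "psnd (pair x y) = y"
  by (simp_all add: pfst_def psnd_def)

lemma pair_pfst_psnd [simp]: "pair (pfst p) (psnd p) = p"
  by (simp add: pfst_def psnd_def)

lemma computable_n_pair: "computable_n k f \<Longrightarrow> computable_n k g \<Longrightarrow> computable_n k (\<lambda>xs. pair (f xs) (g xs))"
  unfolding prod_encode_def prod.case by (intro computable_n_add computable_n_triangle)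

lemma computable_iff: "computable f \<longleftrightarrow> computable_n 1 (\<lambda>xs. f (xs ! 0))"
  unfolding computable_def computable_n_def by (intro ex_cong1) (auto simp: length_Suc_conv)

lemma computable_cong: "computable f \<Longrightarrow> (\<And>x. f x = g x) \<Longrightarrow> computable g"
  by (simp add: computable_def)

lemma computable_compose: "computable f \<Longrightarrow> computable g \<Longrightarrow> computable (\<lambda>x. f (g x))"
proof -
  assume "computable f" "computable g"
  then show ?thesis unfolding computable_iff
    using computable_n_Cn[of "[\<lambda>xs. g (xs ! 0)]" "\<lambda>xs. f (xs ! 0)" 1] by simp
qed

lemma computable_id: "computable (\<lambda>x. x)"
  unfolding computable_iff by (rule computable_n_nth) simp

lemma computable_const: "computable (\<lambda>_. m)"
  unfolding computable_iff by (rule computable_n_const)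

lemma computable_Suc: "computable f \<Longrightarrow> computable (\<lambda>x. Suc (f x))"
  unfolding computable_iff by (rule computable_n_Suc)

lemma computable_add: "computable f \<Longrightarrow> computable g \<Longrightarrow> computable (\<lambda>x. f x + g x)"
  unfolding computable_iff by (rule computable_n_add)

lemma computable_diff: "computable f \<Longrightarrow> computable g \<Longrightarrow> computable (\<lambda>x. f x - g x)"
  unfolding computable_iff by (rule computable_n_diff)

lemma computable_pair: "computable f \<Longrightarrow> computable g \<Longrightarrow> computable (\<lambda>x. pair (f x) (g x))"
  unfolding computable_iff by (rule computable_n_pair)

lemma triangle_mono: "x \<le> y \<Longrightarrow> triangle x \<le> triangle y"
  by (induction rule: dec_induct) auto

text \<open>Cantor pairing numbers the pairs diagonal by diagonal, with \<open>triangle s\<close>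
  the first code on diagonal \<open>s\<close>. The diagonal of \<open>p\<close> is the least
  \<open>s\<close> with \<open>p < triangle (Suc s)\<close>, written as a vanishing truncated
  difference to fit the minimization operator.\<close>

lemma Least_triangle: "(LEAST s. Suc p - triangle (Suc s) = 0) = pfst p + psnd p"
proof (rule Least_equality)
  have p: "p = triangle (pfst p + psnd p) + pfst p"
    using pair_pfst_psnd[of p] by (simp add: prod_encode_def)
  show "Suc p - triangle (Suc (pfst p + psnd p)) = 0" by (subst p) simp
  fix s assume "Suc p - triangle (Suc s) = 0"
  then have "p < triangle (Suc s)" by simp
  show "pfst p + psnd p \<le> s"
  proof (rule ccontr)
    assume "\<not> pfst p + psnd p \<le> s"
    then have "triangle (Suc s) \<le> triangle (pfst p + psnd p)" by (intro triangle_mono) simp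
    then show False using p \<open>p < triangle (Suc s)\<close> by linarith
  qed
qed

lemma computable_pfst_psnd: "computable pfst" "computable psnd"
proof -
  have s: "computable_n 1 (\<lambda>xs. LEAST s. (\<lambda>zs. Suc (zs ! 1) - triangle (Suc (zs ! 0))) (s # xs) = 0)"
  proof (rule computable_n_Least)
    show "computable_n (Suc 1) (\<lambda>zs. Suc (zs ! 1) - triangle (Suc (zs ! 0)))"
      by (intro computable_n_diff computable_n_Suc computable_n_triangle computable_n_nth) simp_all
    show "\<exists>y. Suc ((y # xs) ! 1) - triangle (Suc ((y # xs) ! 0)) = 0" for xs :: "nat list"
    proof (intro exI)
      have "n \<le> triangle n" for n by (induction n) auto
      from this[of "Suc (xs ! 0)"] show "Suc ((xs ! 0 # xs) ! 1) - triangle (Suc ((xs ! 0 # xs) ! 0)) = 0"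
        by simp
    qed
  qed
  then have sum: "computable_n 1 (\<lambda>xs. pfst (xs ! 0) + psnd (xs ! 0))"
    by (simp only: nth_Cons_0 nth_Cons_Suc One_nat_def Least_triangle)
  have "computable_n 1 (\<lambda>xs. xs ! 0 - triangle (pfst (xs ! 0) + psnd (xs ! 0)))"
    by (intro computable_n_diff computable_n_triangle computable_n_nth sum) simp
  moreover have "p - triangle (pfst p + psnd p) = pfst p" for p
    using pair_pfst_psnd[of p] by (simp add: prod_encode_def)
  ultimately have f: "computable_n 1 (\<lambda>xs. pfst (xs ! 0))" by simp
  have "computable_n 1 (\<lambda>xs. (pfst (xs ! 0) + psnd (xs ! 0)) - pfst (xs ! 0))"
    by (intro computable_n_diff sum f)
  with f show "computable pfst" "computable psnd" unfolding computable_iff by simp_all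
qed

lemmas computable_pfst = computable_compose[OF computable_pfst_psnd(1)]
  and computable_psnd = computable_compose[OF computable_pfst_psnd(2)]

lemma computable_compose2:
  assumes "computable (\<lambda>p. h (pfst p) (psnd p))" "computable f" "computable g"
  shows "computable (\<lambda>x. h (f x) (g x))"
  using computable_compose[OF assms(1) computable_pair[OF assms(2,3)]] by simp

lemma computable_rec:
  assumes "computable b" "computable (\<lambda>p. s (pfst p) (pfst (psnd p)) (psnd (psnd p)))" "computable m"
  shows "computable (\<lambda>x. rec_nat (b x) (\<lambda>n y. s y n x) (m x))"
proof -
  have "computable_n 3 (\<lambda>zs. pair (zs ! 0) (pair (zs ! 1) (zs ! 2)))"
    by (intro computable_n_pair computable_n_nth) simp_all
  then have "computable_n 3 (\<lambda>zs. s (zs ! 0) (zs ! 1) (zs ! 2))"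
    using computable_n_Cn[of "[\<lambda>zs. pair (zs ! 0) (pair (zs ! 1) (zs ! 2))]"
      "\<lambda>xs. (\<lambda>p. s (pfst p) (pfst (psnd p)) (psnd (psnd p))) (xs ! 0)" 3] assms(2)
    unfolding computable_iff by simp
  then have "computable_n 1 (\<lambda>xs. rec_nat (b (xs ! 0))
      (\<lambda>n y. (\<lambda>zs. s (zs ! 0) (zs ! 1) (zs ! 2)) (y # n # xs)) (m (xs ! 0)))"
    by (intro computable_n_rec) (use assms in \<open>simp_all add: computable_iff numeral_3_eq_3\<close>)
  then show ?thesis unfolding computable_iff by (simp add: numeral_2_eq_2)
qed

lemma computable_Least:
  assumes "computable (\<lambda>p. f (pfst p) (psnd p))" "\<And>x. \<exists>y. f y x = 0"
  shows "computable (\<lambda>x. LEAST y. f y x = 0)"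
proof -
  have "computable_n 2 (\<lambda>zs. pair (zs ! 0) (zs ! 1))"
    by (intro computable_n_pair computable_n_nth) simp_all
  then have "computable_n 2 (\<lambda>zs. f (zs ! 0) (zs ! 1))"
    using computable_n_Cn[of "[\<lambda>zs. pair (zs ! 0) (zs ! 1)]" "\<lambda>xs. (\<lambda>p. f (pfst p) (psnd p)) (xs ! 0)" 2] assms(1)
    unfolding computable_iff by simp
  then have "computable_n 1 (\<lambda>xs. LEAST y. (\<lambda>zs. f (zs ! 0) (zs ! 1)) (y # xs) = 0)"
    by (intro computable_n_Least) (use assms(2) in \<open>simp_all add: numeral_2_eq_2\<close>)
  then show ?thesis unfolding computable_iff by simp
qed

section \<open>Decidable predicates\<close>

text \<open>Truth is the value 0 because that is what \<open>Mn\<close> searches for.\<close>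

definition decidable :: "(nat \<Rightarrow> bool) \<Rightarrow> bool" where
  "decidable A \<longleftrightarrow> computable (\<lambda>x. if A x then 0 else 1)"

lemma decidable_cong: "decidable A \<Longrightarrow> (\<And>x. A x \<longleftrightarrow> B x) \<Longrightarrow> decidable B"
  by (simp add: decidable_def)

lemma decidable_zero: "computable f \<Longrightarrow> decidable (\<lambda>x. f x = 0)"
proof -
  assume "computable f"
  then have "computable (\<lambda>x. 1 - (1 - f x))" by (intro computable_diff computable_const)
  moreover have "(1 - (1 - f x)) = (if f x = 0 then 0 else 1)" for x by simp
  ultimately show ?thesis unfolding decidable_def by (rule computable_cong)
qed

lemma decidable_le: "computable f \<Longrightarrow> computable g \<Longrightarrow> decidable (\<lambda>x. f x \<le> g x)"
  using decidable_zero[OF computable_diff, of f g] by simp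

lemma decidable_less: "computable f \<Longrightarrow> computable g \<Longrightarrow> decidable (\<lambda>x. f x < g x)"
  using decidable_le[OF computable_Suc, of f g] by (simp add: Suc_le_eq)

lemma decidable_conj: "decidable A \<Longrightarrow> decidable B \<Longrightarrow> decidable (\<lambda>x. A x \<and> B x)"
proof -
  assume "decidable A" "decidable B"
  then have "decidable (\<lambda>x. (if A x then 0 else 1) + (if B x then 0 else 1) = (0::nat))"
    unfolding decidable_def[of A] decidable_def[of B] by (intro decidable_zero computable_add)
  moreover have "((if A x then 0 else 1) + (if B x then 0 else 1) = (0::nat)) = (A x \<and> B x)" for x by simp
  ultimately show ?thesis by (rule decidable_cong)
qed

lemma decidable_not: "decidable A \<Longrightarrow> decidable (\<lambda>x. \<not> A x)"
proof -
  assume "decidable A"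
  then have "computable (\<lambda>x. 1 - (if A x then 0 else 1))" unfolding decidable_def by (intro computable_diff computable_const)
  moreover have "1 - (if A x then 0 else 1) = (if \<not> A x then 0 else 1 :: nat)" for x by simp
  ultimately show ?thesis unfolding decidable_def by (rule computable_cong)
qed

lemma decidable_disj: "decidable A \<Longrightarrow> decidable B \<Longrightarrow> decidable (\<lambda>x. A x \<or> B x)"
  using decidable_not[OF decidable_conj[OF decidable_not decidable_not], of A B] by simp

lemma decidable_eq: "computable f \<Longrightarrow> computable g \<Longrightarrow> decidable (\<lambda>x. f x = g x)"
  using decidable_conj[OF decidable_le decidable_le, of f g g f] by (simp add: eq_iff)

lemma computable_if: "decidable A \<Longrightarrow> computable f \<Longrightarrow> computable g \<Longrightarrow> computable (\<lambda>x. if A x then f x else g x)"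
proof -
  assume A: "decidable A" and f: "computable f" and g: "computable g"
  \<comment> \<open>A recursion of length 0 or 1 acts as a case distinction.\<close>
  have "computable (\<lambda>x. rec_nat (f x) (\<lambda>n y. (\<lambda>_ _ x. g x) y n x) (if A x then 0 else 1))"
    using f computable_compose[OF g computable_psnd[OF computable_psnd[OF computable_id]]] A[unfolded decidable_def] by (rule computable_rec)
  moreover have "rec_nat (f x) (\<lambda>n y. (\<lambda>_ _ x. g x) y n x) (if A x then 0 else 1) = (if A x then f x else g x)" for x
    by simp
  ultimately show ?thesis by (rule computable_cong)
qed

lemma decidable_compose: "decidable A \<Longrightarrow> computable f \<Longrightarrow> decidable (\<lambda>x. A (f x))"
  unfolding decidable_def by (rule computable_compose)

lemma decidable_compose2:
  assumes "decidable (\<lambda>p. A (pfst p) (psnd p))" "computable f" "computable g"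
  shows "decidable (\<lambda>x. A (f x) (g x))"
  using decidable_compose[OF assms(1) computable_pair[OF assms(2,3)]] by simp

lemma decidable_ball:
  assumes "decidable (\<lambda>p. A (pfst p) (psnd p))" "computable m"
  shows "decidable (\<lambda>x. \<forall>i<m x. A i x)"
proof -
  have "computable (\<lambda>x. rec_nat 0 (\<lambda>n y. if y = 0 \<and> A n x then 0 else 1) (m x))"
    by (intro computable_rec computable_const computable_if decidable_conj decidable_zero decidable_compose2[OF assms(1)]
      computable_pfst computable_psnd computable_id assms(2))
  moreover have "rec_nat 0 (\<lambda>n y. if y = 0 \<and> A n x then 0 else 1) k = (if \<forall>i<k. A i x then 0 else (1::nat))" for k x
    by (induction k) (auto simp: less_Suc_eq)
  ultimately show ?thesis unfolding decidable_def by (rule computable_cong)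
qed

section \<open>Arithmetic of list codes\<close>

text \<open>\<open>list_encode (x # xs)\<close> is \<open>Suc (pair x (list_encode xs))\<close>,
  hence the subtraction. The empty list has code 0 and \<open>tlc 0 = 0\<close>, so
  \<open>dropc\<close> stays at 0 past the end, and \<open>lenc\<close> finds the length as the
  first such position.\<close>

definition hdc :: "nat \<Rightarrow> nat" where "hdc L = pfst (L - 1)"
definition tlc :: "nat \<Rightarrow> nat" where "tlc L = psnd (L - 1)"
definition dropc :: "nat \<Rightarrow> nat \<Rightarrow> nat" where "dropc L i = rec_nat L (\<lambda>_ y. tlc y) i"
definition nthc :: "nat \<Rightarrow> nat \<Rightarrow> nat" where "nthc L i = hdc (dropc L i)"
definition lenc :: "nat \<Rightarrow> nat" where "lenc L = (LEAST i. dropc L i = 0)"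

lemma tlc_list_encode: "tlc (list_encode xs) = list_encode (tl xs)"
proof (cases xs)
  case Nil
  have "prod_decode 0 = (0, 0)" 
    using prod_encode_inverse[of "(0, 0)"] by (simp add: prod_encode_def)
  then show ?thesis using Nil by (simp add: tlc_def psnd_def)
qed (simp add: tlc_def)

lemma dropc_list_encode: "dropc (list_encode xs) i = list_encode (drop i xs)"
  unfolding dropc_def by (induction i) (auto simp: tlc_list_encode drop_Suc tl_drop)

lemma nthc_list_encode [simp]: "i < length xs \<Longrightarrow> nthc (list_encode xs) i = xs ! i"
  by (simp add: nthc_def dropc_list_encode hdc_def flip: Cons_nth_drop_Suc)

lemma list_encode_eq_0: "list_encode xs = 0 \<longleftrightarrow> xs = []"
  by (cases xs) auto

lemma lenc_list_encode [simp]: "lenc (list_encode xs) = length xs"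
  unfolding lenc_def dropc_list_encode list_encode_eq_0
  by (rule Least_equality) auto

lemma computable_hdc: "computable f \<Longrightarrow> computable (\<lambda>x. hdc (f x))" and computable_tlc: "computable f \<Longrightarrow> computable (\<lambda>x. tlc (f x))"
  unfolding hdc_def tlc_def by (intro computable_pfst computable_psnd computable_diff computable_const; assumption)+

lemma computable_dropc: "computable f \<Longrightarrow> computable g \<Longrightarrow> computable (\<lambda>x. dropc (f x) (g x))"
  unfolding dropc_def by (intro computable_rec computable_tlc computable_pfst computable_id)

lemma computable_nthc: "computable f \<Longrightarrow> computable g \<Longrightarrow> computable (\<lambda>x. nthc (f x) (g x))"
  unfolding nthc_def by (intro computable_hdc computable_dropc)

lemma computable_lenc: "computable f \<Longrightarrow> computable (\<lambda>x. lenc (f x))"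
proof -
  assume f: "computable f"
  have "computable (\<lambda>x. LEAST i. dropc x i = 0)"
  proof (rule computable_Least)
    show "computable (\<lambda>p. dropc (psnd p) (pfst p))" by (intro computable_dropc computable_psnd computable_pfst computable_id)
    show "\<exists>i. dropc L i = 0" for L
      using dropc_list_encode[of "list_decode L" "length (list_decode L)"] by auto
  qed
  from computable_compose[OF this f] show ?thesis by (simp add: lenc_def)
qed

section \<open>Closure properties of semidecidable predicates\<close>

text \<open>Projections of decidable predicates: in this form, closure under conjunction and
  quantifiers amounts to packing witnesses.\<close>

definition semidec :: "(nat \<Rightarrow> bool) \<Rightarrow> bool" where
  "semidec A \<longleftrightarrow> (\<exists>D. decidable D \<and> (\<forall>x. A x \<longleftrightarrow> (\<exists>w. D (pair w x))))"

lemma semidec_cong: "semidec A \<Longrightarrow> (\<And>x. A x \<longleftrightarrow> B x) \<Longrightarrow> semidec B"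
  by (simp add: semidec_def)

lemma semidec_dec: "decidable A \<Longrightarrow> semidec A"
  unfolding semidec_def using decidable_compose[of A psnd] computable_pfst_psnd(2) by (intro exI[of _ "\<lambda>x. A (psnd x)"]) simp

lemma semidec_compose: "semidec A \<Longrightarrow> computable f \<Longrightarrow> semidec (\<lambda>x. A (f x))"
proof -
  assume "semidec A" and f: "computable f"
  then obtain D where D: "decidable D" "\<And>x. A x \<longleftrightarrow> (\<exists>w. D (pair w x))" unfolding semidec_def by blast
  have "decidable (\<lambda>p. D (pair (pfst p) (f (psnd p))))"
    by (intro decidable_compose[OF D(1)] computable_pair computable_pfst computable_compose[OF f] computable_psnd computable_id)
  then show ?thesis unfolding semidec_def D(2)
    by (intro exI[of _ "\<lambda>p. D (pair (pfst p) (f (psnd p)))"]) simp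
qed

lemma semidec_compose2:
  assumes "semidec (\<lambda>p. A (pfst p) (psnd p))" "computable f" "computable g"
  shows "semidec (\<lambda>x. A (f x) (g x))"
  using semidec_compose[OF assms(1) computable_pair[OF assms(2,3)]] by simp

lemma semidec_compose3:
  assumes "semidec (\<lambda>p. A (pfst p) (pfst (psnd p)) (psnd (psnd p)))" "computable f" "computable g" "computable h"
  shows "semidec (\<lambda>x. A (f x) (g x) (h x))"
  using semidec_compose[OF assms(1) computable_pair[OF assms(2) computable_pair[OF assms(3,4)]]] by simp

lemma semidec_conj: "semidec A \<Longrightarrow> semidec B \<Longrightarrow> semidec (\<lambda>x. A x \<and> B x)"
proof -
  assume "semidec A" "semidec B"
  then obtain D E where D: "decidable D" "\<And>x. A x \<longleftrightarrow> (\<exists>w. D (pair w x))"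
    and E: "decidable E" "\<And>x. B x \<longleftrightarrow> (\<exists>w. E (pair w x))" unfolding semidec_def by blast
  have "decidable (\<lambda>p. D (pair (pfst (pfst p)) (psnd p)) \<and> E (pair (psnd (pfst p)) (psnd p)))"
    by (intro decidable_conj decidable_compose[OF D(1)] decidable_compose[OF E(1)] computable_pair computable_pfst computable_psnd computable_id)
  moreover have "A x \<and> B x \<longleftrightarrow> (\<exists>w. D (pair (pfst (pfst (pair w x))) (psnd (pair w x)))
      \<and> E (pair (psnd (pfst (pair w x))) (psnd (pair w x))))" for x
    unfolding D(2) E(2) by (metis pfst_pair psnd_pair)
  ultimately show ?thesis unfolding semidec_def by blast
qed

lemma semidec_disj: "semidec A \<Longrightarrow> semidec B \<Longrightarrow> semidec (\<lambda>x. A x \<or> B x)"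
proof -
  assume "semidec A" "semidec B"
  then obtain D E where D: "decidable D" "\<And>x. A x \<longleftrightarrow> (\<exists>w. D (pair w x))"
    and E: "decidable E" "\<And>x. B x \<longleftrightarrow> (\<exists>w. E (pair w x))" unfolding semidec_def by blast
  have "decidable (\<lambda>p. D p \<or> E p)" by (intro decidable_disj D E)
  moreover have "A x \<or> B x \<longleftrightarrow> (\<exists>w. D (pair w x) \<or> E (pair w x))" for x
    unfolding D(2) E(2) by blast
  ultimately show ?thesis unfolding semidec_def by blast
qed

lemma semidec_ex:
  assumes "semidec (\<lambda>p. A (pfst p) (psnd p))"
  shows "semidec (\<lambda>x. \<exists>y. A y x)"
proof -
  obtain D where D: "decidable D" "\<And>p. A (pfst p) (psnd p) \<longleftrightarrow> (\<exists>w. D (pair w p))"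
    using assms unfolding semidec_def by blast
  have D': "A y x \<longleftrightarrow> (\<exists>w. D (pair w (pair y x)))" for x y using D(2)[of "pair y x"] by simp
  have "decidable (\<lambda>p. D (pair (psnd (pfst p)) (pair (pfst (pfst p)) (psnd p))))"
    by (intro decidable_compose[OF D(1)] computable_pair computable_pfst computable_psnd computable_id)
  moreover have "(\<exists>y. A y x) \<longleftrightarrow> (\<exists>w. (\<lambda>p. D (pair (psnd (pfst p)) (pair (pfst (pfst p)) (psnd p)))) (pair w x))" for x
    unfolding D' pfst_pair psnd_pair by (metis pfst_pair psnd_pair)
  ultimately show ?thesis unfolding semidec_def by blast
qed

text \<open>Collection: the finitely many witnesses are stored in one list.\<close>

lemma semidec_ball:
  assumes "semidec (\<lambda>p. A (pfst p) (psnd p))" and m: "computable m"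
  shows "semidec (\<lambda>x. \<forall>i<m x. A i x)"
proof -
  obtain D where D: "decidable D" "\<And>p. A (pfst p) (psnd p) \<longleftrightarrow> (\<exists>w. D (pair w p))"
    using assms unfolding semidec_def by blast
  have D': "A y x \<longleftrightarrow> (\<exists>w. D (pair w (pair y x)))" for x y using D(2)[of "pair y x"] by simp
  have "decidable (\<lambda>p. \<forall>i<m (psnd p). D (pair (nthc (pfst p) i) (pair i (psnd p))))"
    by (intro decidable_ball decidable_compose[OF D(1)] computable_pair computable_nthc computable_pfst computable_psnd computable_id computable_compose[OF m])
  moreover have "(\<forall>i<m x. A i x) \<longleftrightarrow>
      (\<exists>w. \<forall>i<m (psnd (pair w x)). D (pair (nthc (pfst (pair w x)) i) (pair i (psnd (pair w x)))))" for x
  proof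
    assume "\<forall>i<m x. A i x"
    then obtain W where W: "\<And>i. i < m x \<Longrightarrow> D (pair (W i) (pair i x))" unfolding D' by metis
    show "\<exists>w. \<forall>i<m (psnd (pair w x)). D (pair (nthc (pfst (pair w x)) i) (pair i (psnd (pair w x))))"
      by (rule exI[of _ "list_encode (map W [0..<m x])"]) (simp add: W)
  qed (auto simp: D')
  ultimately show ?thesis unfolding semidec_def by blast
qed

lemma semidec_eq: "computable f \<Longrightarrow> computable g \<Longrightarrow> semidec (\<lambda>x. f x = g x)"
  and semidec_le: "computable f \<Longrightarrow> computable g \<Longrightarrow> semidec (\<lambda>x. f x \<le> g x)"
  and semidec_less: "computable f \<Longrightarrow> computable g \<Longrightarrow> semidec (\<lambda>x. f x < g x)"
  and semidec_neq: "computable f \<Longrightarrow> computable g \<Longrightarrow> semidec (\<lambda>x. f x \<noteq> g x)"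
  by (intro semidec_dec decidable_eq decidable_le decidable_less decidable_not; assumption)+

lemma semidec_const: "semidec (\<lambda>_. b)"
  by (rule semidec_dec, cases b) (auto simp: decidable_def intro: computable_const)

lemma semidec_finite: "finite A \<Longrightarrow> computable f \<Longrightarrow> semidec (\<lambda>x. f x \<in> A)"
proof (induction A rule: finite_induct)
  case (insert y A)
  then have "semidec (\<lambda>x. f x = y \<or> f x \<in> A)" by (intro semidec_disj semidec_eq computable_const) auto
  then show ?case by simp
qed (simp add: semidec_const)

text \<open>With these rules \<open>intro\<close> follows the syntax of a predicate. This is why
  later notions are written with positive connectives, existential and bounded universal
  quantifiers, and arithmetic of codes.\<close>

lemmas semidec_intros = semidec_conj semidec_disj semidec_ex semidec_ball semidec_eq semidec_le semidec_less semidec_neq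
  computable_id computable_const computable_Suc computable_add computable_diff computable_pair computable_pfst computable_psnd computable_nthc computable_lenc
  computable_hdc computable_tlc computable_if decidable_eq decidable_le decidable_less decidable_conj decidable_disj decidable_not

text \<open>The second conclusion, that any result is a solution, rests on determinism; it turns
  halting into a test for the existence of a solution.\<close>

lemma program_search:
  assumes "decidable (\<lambda>p. E (pfst p) (psnd p))"
  obtains c where "\<forall>x. (\<exists>z. E z x) \<longrightarrow> reval c [x] (LEAST z. E z x)" "\<forall>x z. reval c [x] z \<longrightarrow> E z x"
proof -
  have "computable_n 2 (\<lambda>zs. pair (zs ! 0) (zs ! 1))" by (intro computable_n_pair computable_n_nth) simp_all
  then have "computable_n 2 (\<lambda>zs. if E (zs ! 0) (zs ! 1) then 0 else 1)"
    using computable_n_Cn[of "[\<lambda>zs. pair (zs ! 0) (zs ! 1)]" "\<lambda>xs. (\<lambda>p. if E (pfst p) (psnd p) then 0 else 1) (xs ! 0)" 2] assms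
    unfolding decidable_def computable_iff by simp
  then obtain c where c: "\<And>zs. length zs = 2 \<Longrightarrow> reval c zs (if E (zs ! 0) (zs ! 1) then 0 else 1)"
    unfolding computable_n_def by blast
  have c2: "reval c [z, x] (if E z x then 0 else 1)" for z x using c[of "[z, x]"] by simp
  show thesis
  proof (rule that, safe)
    fix x z assume ex: "E z x"
    have "E (LEAST z. E z x) x" using ex by (rule LeastI)
    show "reval (Mn c) [x] (LEAST z. E z x)"
    proof (rule reval.intros(7))
      show "reval c [LEAST z. E z x, x] 0"
        using c2[of "LEAST z. E z x" x] \<open>E (LEAST z. E z x) x\<close> by simp
      show "\<forall>i<LEAST z. E z x. \<exists>m. reval c [i, x] (Suc m)"
      proof (intro allI impI)
        fix i assume "i < (LEAST z. E z x)"
        then have "\<not> E i x" by (rule not_less_Least)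
        then show "\<exists>m. reval c [i, x] (Suc m)" using c2[of i x] by auto
      qed
    qed
  next
    fix x z assume "reval (Mn c) [x] z"
    then have "reval c [z, x] 0" by (auto elim: reval_MnE)
    then show "E z x" using reval_deterministic[OF c2[of z x], of 0] by (cases "E z x") auto
  qed
qed

lemma re_set_semidec: "semidec A \<Longrightarrow> re_set {x. A x}"
proof -
  assume "semidec A"
  then obtain D where D: "decidable D" "\<And>x. A x \<longleftrightarrow> (\<exists>w. D (pair w x))" unfolding semidec_def by blast
  have "decidable (\<lambda>p. D (pair (pfst p) (psnd p)))" using D(1) by simp
  then obtain c where c: "\<forall>x. (\<exists>w. D (pair w x)) \<longrightarrow> reval c [x] (LEAST w. D (pair w x))"
    "\<forall>x w. reval c [x] w \<longrightarrow> D (pair w x)" by (rule program_search)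
  show ?thesis unfolding re_set_def mem_Collect_eq D(2) using c by blast
qed

lemma program_of_semidec_graph:
  assumes "semidec (\<lambda>p. G (pfst p) (psnd p))"
  obtains c where "\<forall>x. (\<exists>y. G x y) \<longrightarrow> (\<exists>y. G x y \<and> reval c [x] y)"
proof -
  obtain D where D: "decidable D" "\<And>p. G (pfst p) (psnd p) \<longleftrightarrow> (\<exists>w. D (pair w p))"
    using assms unfolding semidec_def by blast
  have D': "G x y \<longleftrightarrow> (\<exists>w. D (pair w (pair x y)))" for x y using D(2)[of "pair x y"] by simp
  define E where "E z x = D (pair (psnd z) (pair x (pfst z)))" for z x
  have "decidable (\<lambda>p. E (pfst p) (psnd p))"
    unfolding E_def by (intro decidable_compose[OF D(1)] computable_pair computable_pfst computable_psnd computable_id)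
  then obtain c where c: "\<forall>x. (\<exists>z. E z x) \<longrightarrow> reval c [x] (LEAST z. E z x)" "\<forall>x z. reval c [x] z \<longrightarrow> E z x"
    by (rule program_search)
  obtain d where d: "\<And>x. reval d [x] (pfst x)" using computable_pfst_psnd(1) unfolding computable_def by blast
  show thesis
  proof (rule that, intro allI impI)
    fix x assume "\<exists>y. G x y"
    then obtain y w where "D (pair w (pair x y))" using D' by blast
    then have "\<exists>z. E z x" unfolding E_def by (intro exI[of _ "pair y w"]) simp
    then obtain z where z: "reval c [x] z" "E z x" using c by blast
    then have "reval (Cn d [c]) [x] (pfst z)"
      by (intro reval.intros(4)[where ys = "[z]"]) (simp_all add: d)
    moreover have "G x (pfst z)" using z(2) unfolding D' E_def by blast
    ultimately show "\<exists>y. G x y \<and> reval (Cn d [c]) [x] y" by blast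
  qed
qed

section \<open>Inductively defined predicates\<close>

text \<open>A single relation \<open>st\<close> carries all rules of an inductive definition: it
  relates the code of a finite list of premises to the conclusion.\<close>

inductive der :: "(nat \<Rightarrow> nat \<Rightarrow> bool) \<Rightarrow> nat \<Rightarrow> bool" for st where
  "(\<And>y. y \<in> set us \<Longrightarrow> der st y) \<Longrightarrow> st (list_encode us) x \<Longrightarrow> der st x"

text \<open>A derivation tree flattened into a list, conclusion first. The premises of an entry
  stand at strictly later positions, which excludes circular justification.\<close>

definition derivation :: "(nat \<Rightarrow> nat \<Rightarrow> bool) \<Rightarrow> nat list \<Rightarrow> bool" where
  "derivation st H \<longleftrightarrow> (\<forall>i<length H. \<exists>us. st (list_encode us) (H ! i) \<and>
     (\<forall>j<length us. \<exists>k. i < k \<and> k < length H \<and> H ! k = us ! j))"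

lemma derivation_append: "derivation st H \<Longrightarrow> derivation st H' \<Longrightarrow> derivation st (H @ H')"
  unfolding derivation_def
proof (intro allI impI)
  assume H: "\<forall>i<length H. \<exists>us. st (list_encode us) (H ! i) \<and>
     (\<forall>j<length us. \<exists>k. i < k \<and> k < length H \<and> H ! k = us ! j)"
    and H': "\<forall>i<length H'. \<exists>us. st (list_encode us) (H' ! i) \<and>
     (\<forall>j<length us. \<exists>k. i < k \<and> k < length H' \<and> H' ! k = us ! j)"
  fix i assume i: "i < length (H @ H')"
  show "\<exists>us. st (list_encode us) ((H @ H') ! i) \<and>
     (\<forall>j<length us. \<exists>k. i < k \<and> k < length (H @ H') \<and> (H @ H') ! k = us ! j)"
  proof (cases "i < length H")
    case True
    then obtain us where us: "st (list_encode us) (H ! i)"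
      "\<And>j. j < length us \<Longrightarrow> \<exists>k. i < k \<and> k < length H \<and> H ! k = us ! j" using H by blast
    have "\<exists>k. i < k \<and> k < length (H @ H') \<and> (H @ H') ! k = us ! j" if j: "j < length us" for j
      using us(2)[OF j] by (auto simp: nth_append)
    moreover have "st (list_encode us) ((H @ H') ! i)" using us(1) True by (simp add: nth_append)
    ultimately show ?thesis by blast
  next
    case False
    then have "i - length H < length H'" using i by simp
    then obtain us where us: "st (list_encode us) (H' ! (i - length H))"
      "\<And>j. j < length us \<Longrightarrow> \<exists>k. i - length H < k \<and> k < length H' \<and> H' ! k = us ! j" using H' by blast
    have "\<exists>k. i < k \<and> k < length (H @ H') \<and> (H @ H') ! k = us ! j" if j: "j < length us" for j
    proof -
      obtain k where "i - length H < k" "k < length H'" "H' ! k = us ! j" using us(2)[OF j] by blast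
      then show ?thesis using False by (intro exI[of _ "length H + k"]) (auto simp: nth_append)
    qed
    moreover have "st (list_encode us) ((H @ H') ! i)" using us(1) False by (simp add: nth_append)
    ultimately show ?thesis by blast
  qed
qed

lemma derivation_Cons:
  assumes "derivation st H" "set us \<subseteq> set H" "st (list_encode us) x"
  shows "derivation st (x # H)"
  unfolding derivation_def
proof (intro allI impI)
  fix i assume i: "i < length (x # H)"
  show "\<exists>us. st (list_encode us) ((x # H) ! i) \<and>
     (\<forall>j<length us. \<exists>k. i < k \<and> k < length (x # H) \<and> (x # H) ! k = us ! j)"
  proof (cases i)
    case 0
    have "\<exists>k. 0 < k \<and> k < length (x # H) \<and> (x # H) ! k = us ! j" if j: "j < length us" for j
    proof -
      have "us ! j \<in> set H" using assms(2) j by auto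
      then obtain k where "k < length H" "H ! k = us ! j" by (auto simp: in_set_conv_nth)
      then show ?thesis by (intro exI[of _ "Suc k"]) simp
    qed
    then show ?thesis using 0 assms(3) by auto
  next
    case (Suc i')
    then obtain us where us: "st (list_encode us) (H ! i')"
      "\<And>j. j < length us \<Longrightarrow> \<exists>k. i' < k \<and> k < length H \<and> H ! k = us ! j"
      using assms(1) i unfolding derivation_def by auto
    have "\<exists>k. i < k \<and> k < length (x # H) \<and> (x # H) ! k = us ! j" if j: "j < length us" for j
    proof -
      obtain k where "i' < k" "k < length H" "H ! k = us ! j" using us(2)[OF j] by blast
      then show ?thesis using Suc by (intro exI[of _ "Suc k"]) simp
    qed
    then show ?thesis using Suc us(1) by auto
  qed
qed

lemma der_iff_derivation: "der st x \<longleftrightarrow> (\<exists>H. derivation st H \<and> H \<noteq> [] \<and> H ! 0 = x)"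
proof
  assume "der st x"
  then show "\<exists>H. derivation st H \<and> H \<noteq> [] \<and> H ! 0 = x"
  proof induction
    case (1 us x)
    have "\<exists>H. derivation st H \<and> set us \<subseteq> set H" using "1.IH"
    proof (induction us)
      case Nil show ?case by (intro exI[of _ "[]"]) (simp add: derivation_def)
    next
      case (Cons u us)
      then obtain H H' where H: "derivation st H" "set us \<subseteq> set H"
        and H': "derivation st H'" "H' \<noteq> []" "H' ! 0 = u" by (meson list.set_intros)
      then have "u \<in> set H'" by (cases H') auto
      then show ?case using H H' derivation_append[OF H'(1) H(1)] by (intro exI[of _ "H' @ H"]) auto
    qed
    then obtain H where "derivation st H" "set us \<subseteq> set H" by blast
    then show ?case using derivation_Cons[of st H us x] "1.hyps"(2) by (intro exI[of _ "x # H"]) simp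
  qed
next
  assume "\<exists>H. derivation st H \<and> H \<noteq> [] \<and> H ! 0 = x"
  then obtain H where H: "derivation st H" "H \<noteq> []" "H ! 0 = x" by blast
  have "i < length H \<Longrightarrow> der st (H ! i)" for i
  \<comment> \<open>The premises of an entry are closer to the end of the list.\<close>
  proof (induction "length H - i" arbitrary: i rule: less_induct)
    case less
    then obtain us where us: "st (list_encode us) (H ! i)"
      "\<And>j. j < length us \<Longrightarrow> \<exists>k. i < k \<and> k < length H \<and> H ! k = us ! j"
      using H(1) unfolding derivation_def by blast
    show ?case
    proof (rule der.intros[where us = us])
      show "st (list_encode us) (H ! i)" by (rule us(1))
    next
      fix y assume "y \<in> set us"
      then obtain j where "j < length us" "us ! j = y" by (auto simp: in_set_conv_nth)
      then obtain k where "i < k" "k < length H" "H ! k = y" using us(2) by auto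
      then show "der st y" using less(1)[of k] by auto
    qed
  qed
  then show "der st x" using H by auto
qed

lemma ex_list_code: "(\<exists>xs. Q (list_encode xs)) \<longleftrightarrow> (\<exists>h. Q h)"
  by (metis list_decode_inverse)

lemma semidec_der:
  assumes "semidec (\<lambda>p. st (pfst p) (psnd p))"
  shows "semidec (der st)"
proof -
  have "semidec (\<lambda>x. \<exists>h. 0 < lenc h \<and> nthc h 0 = x \<and> (\<forall>i<lenc h. \<exists>u. st u (nthc h i) \<and>
     (\<forall>j<lenc u. \<exists>k. i < k \<and> k < lenc h \<and> nthc h k = nthc u j)))"
    by (intro semidec_intros semidec_compose2[OF assms])
  then show ?thesis
  proof (rule semidec_cong)
    fix x
    have e: "(\<exists>k. i < k \<and> k < length H \<and> nthc (list_encode H) k = v) \<longleftrightarrow>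
      (\<exists>k. i < k \<and> k < length H \<and> H ! k = v)" for H i v
      by (intro ex_cong1) auto
    have u: "(\<exists>u. st u y \<and> (\<forall>j<lenc u. \<exists>k. i < k \<and> k < length H \<and> nthc (list_encode H) k = nthc u j)) \<longleftrightarrow>
      (\<exists>us. st (list_encode us) y \<and> (\<forall>j<length us. \<exists>k. i < k \<and> k < length H \<and> H ! k = us ! j))" for y i H
      unfolding ex_list_code[of "\<lambda>u. st u y \<and> _ u", symmetric]
      by (simp add: e)
    have "(\<forall>i<lenc (list_encode H). \<exists>u. st u (nthc (list_encode H) i) \<and>
      (\<forall>j<lenc u. \<exists>k. i < k \<and> k < lenc (list_encode H) \<and> nthc (list_encode H) k = nthc u j)) \<longleftrightarrow> derivation st H" for H
      unfolding lenc_list_encode u derivation_def by (intro all_cong) simp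
    then show "(\<exists>h. 0 < lenc h \<and> nthc h 0 = x \<and> (\<forall>i<lenc h. \<exists>u. st u (nthc h i) \<and>
     (\<forall>j<lenc u. \<exists>k. i < k \<and> k < lenc h \<and> nthc h k = nthc u j))) \<longleftrightarrow> der st x"
      unfolding der_iff_derivation
      by (subst ex_list_code[symmetric]) (intro ex_cong1, auto)
  qed
qed

section \<open>Program evaluation as a semidecidable predicate\<close>

lemma list_decode_ne: "L \<noteq> 0 \<Longrightarrow> list_decode L = hdc L # list_decode (tlc L)"
proof -
  assume "L \<noteq> 0"
  then obtain x xs where "list_decode L = x # xs"
    by (metis list.exhaust list_decode_inverse list_encode.simps(1))
  then have "L = list_encode (x # xs)" by (metis list_decode_inverse)
  then show ?thesis by (simp add: hdc_def tlc_def)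
qed

lemma list_decode_code: "list_decode (Suc (pair x L)) = x # list_decode L"
  by (metis list_encode.simps(2) list_encode_inverse list_decode_inverse)

lemma lenc_eq: "lenc L = length (list_decode L)"
  by (metis lenc_list_encode list_decode_inverse)

lemma nthc_eq: "i < length (list_decode L) \<Longrightarrow> nthc L i = list_decode L ! i"
  by (metis nthc_list_encode list_decode_inverse)

text \<open>All intermediate values of the recursion are stored in one code \<open>V\<close>, which
  trades the recursion for a bounded quantifier.\<close>

lemma reval_Pr_iff: "reval (Pr f g) (n # xs) y \<longleftrightarrow>
  (\<exists>V. reval f xs (nthc V 0) \<and> (\<forall>i<n. reval g (nthc V i # i # xs) (nthc V (Suc i))) \<and> nthc V n = y)"
proof
  have "reval (Pr f g) (n # xs) y \<Longrightarrow> \<exists>vs. length vs = Suc n \<and> reval f xs (vs ! 0) \<and>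
      (\<forall>i<n. reval g (vs ! i # i # xs) (vs ! Suc i)) \<and> vs ! n = y"
  proof (induction n arbitrary: y)
    case 0
    then show ?case by (intro exI[of _ "[y]"]) (auto elim: reval_Pr0E)
  next
    case (Suc n)
    from Suc(2) obtain z where z: "reval (Pr f g) (n # xs) z" "reval g (z # n # xs) y"
      by (rule reval_PrSucE)
    from Suc(1)[OF z(1)] obtain vs where vs: "length vs = Suc n" "reval f xs (vs ! 0)"
      "\<forall>i<n. reval g (vs ! i # i # xs) (vs ! Suc i)" "vs ! n = z" by blast
    then show ?case using z(2)
      by (intro exI[of _ "vs @ [y]"]) (auto simp: nth_append less_Suc_eq)
  qed
  then show "\<exists>V. reval f xs (nthc V 0) \<and> (\<forall>i<n. reval g (nthc V i # i # xs) (nthc V (Suc i))) \<and> nthc V n = y"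
    if r: "reval (Pr f g) (n # xs) y"
  proof -
    obtain vs where vs: "length vs = Suc n" "reval f xs (vs ! 0)"
      "\<forall>i<n. reval g (vs ! i # i # xs) (vs ! Suc i)" "vs ! n = y"
      using \<open>reval (Pr f g) (n # xs) y \<Longrightarrow> _\<close>[OF r] by blast
    then show ?thesis by (intro exI[of _ "list_encode vs"]) simp
  qed
next
  assume "\<exists>V. reval f xs (nthc V 0) \<and> (\<forall>i<n. reval g (nthc V i # i # xs) (nthc V (Suc i))) \<and> nthc V n = y"
  then obtain V where V: "reval f xs (nthc V 0)" "\<And>i. i < n \<Longrightarrow> reval g (nthc V i # i # xs) (nthc V (Suc i))"
    "nthc V n = y" by blast
  have "i \<le> n \<Longrightarrow> reval (Pr f g) (i # xs) (nthc V i)" for i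
  proof (induction i)
    case 0 then show ?case using V(1) by (auto intro: reval.intros(5))
  next
    case (Suc i) then show ?case using V(2)[of i] by (auto intro: reval.intros(6))
  qed
  then show "reval (Pr f g) (n # xs) y" using V(3) by auto
qed

text \<open>This replaces a universal program: Kleene's normal form theorem for each fixed program, by induction on it.\<close>

lemma semidec_reval: "semidec (\<lambda>p. reval c (list_decode (pfst p)) (psnd p))"
proof (induction c)
  case Zr
  have "semidec (\<lambda>p. psnd p = 0)" by (intro semidec_intros)
  then show ?case by (rule semidec_cong) (auto elim: reval_ZrE intro: reval.intros)
next
  case Sc
  have "semidec (\<lambda>p. pfst p \<noteq> 0 \<and> psnd p = Suc (hdc (pfst p)))" by (intro semidec_intros)
  then show ?case
  proof (rule semidec_cong)
    fix p
    show "pfst p \<noteq> 0 \<and> psnd p = Suc (hdc (pfst p)) \<longleftrightarrow> reval Sc (list_decode (pfst p)) (psnd p)"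
    proof (cases "pfst p = 0")
      case False
      then show ?thesis unfolding list_decode_ne[OF False] by (auto elim: reval_ScE intro: reval.intros)
    qed (auto elim: reval_ScE)
  qed
next
  case (Pj i)
  have "semidec (\<lambda>p. i < lenc (pfst p) \<and> psnd p = nthc (pfst p) i)" by (intro semidec_intros)
  then show ?case
    by (rule semidec_cong) (auto simp: lenc_eq nthc_eq elim: reval_PjE intro: reval.intros)
next
  case (Cn f gs)
  \<comment> \<open>The list \<open>gs\<close> is part of the fixed program, so the simultaneous
    evaluation of its members can be treated by an inner induction on it.\<close>
  have gs: "semidec (\<lambda>p. list_all2 (\<lambda>g y. reval g (list_decode (pfst p)) y) gs (list_decode (psnd p)))"
    using Cn(2)
  proof (induction gs)
    case Nil
    have "semidec (\<lambda>p. psnd p = 0)" by (intro semidec_intros)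
    then show ?case
    proof (rule semidec_cong)
      show "psnd p = 0 \<longleftrightarrow> list_all2 (\<lambda>g y. reval g (list_decode (pfst p)) y) [] (list_decode (psnd p))" for p
        by (cases "psnd p = 0") (auto simp: list_decode_ne)
    qed
  next
    case (Cons g gs)
    have IH: "semidec (\<lambda>p. list_all2 (\<lambda>g y. reval g (list_decode (pfst p)) y) gs (list_decode (psnd p)))"
      by (rule Cons.IH) (use Cons.prems in auto)
    have g: "semidec (\<lambda>p. reval g (list_decode (pfst p)) (psnd p))" using Cons.prems by simp
    have "semidec (\<lambda>p. psnd p \<noteq> 0 \<and> reval g (list_decode (pfst p)) (hdc (psnd p)) \<and>
        list_all2 (\<lambda>g y. reval g (list_decode (pfst p)) y) gs (list_decode (tlc (psnd p))))"
      by (intro semidec_intros semidec_compose2[of "\<lambda>L y. reval g (list_decode L) y", OF g]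
        semidec_compose2[of "\<lambda>L Y. list_all2 (\<lambda>g y. reval g (list_decode L) y) gs (list_decode Y)", OF IH])
    then show ?case
    proof (rule semidec_cong)
      show "(psnd p \<noteq> 0 \<and> reval g (list_decode (pfst p)) (hdc (psnd p)) \<and>
        list_all2 (\<lambda>g y. reval g (list_decode (pfst p)) y) gs (list_decode (tlc (psnd p))))
        \<longleftrightarrow> list_all2 (\<lambda>g y. reval g (list_decode (pfst p)) y) (g # gs) (list_decode (psnd p))" for p
        by (cases "psnd p = 0") (auto simp: list_decode_ne)
    qed
  qed
  have "semidec (\<lambda>p. \<exists>Y. list_all2 (\<lambda>g y. reval g (list_decode (pfst p)) y) gs (list_decode Y) \<and>
      reval f (list_decode Y) (psnd p))"
    by (intro semidec_intros semidec_compose2[of "\<lambda>L y. reval f (list_decode L) y", OF Cn(1)]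
        semidec_compose2[of "\<lambda>L Y. list_all2 (\<lambda>g y. reval g (list_decode L) y) gs (list_decode Y)", OF gs])
  then show ?case
  proof (rule semidec_cong, intro iffI)
    fix p assume "reval (Cn f gs) (list_decode (pfst p)) (psnd p)"
    then obtain ys where "list_all2 (\<lambda>g y. reval g (list_decode (pfst p)) y) gs ys" "reval f ys (psnd p)"
      by (rule reval_CnE)
    then show "\<exists>Y. list_all2 (\<lambda>g y. reval g (list_decode (pfst p)) y) gs (list_decode Y) \<and>
      reval f (list_decode Y) (psnd p)" by (intro exI[of _ "list_encode ys"]) simp
  qed (auto intro: reval.intros(4))
next
  case (Pr f g)
  have "semidec (\<lambda>p. pfst p \<noteq> 0 \<and> (\<exists>V. reval f (list_decode (tlc (pfst p))) (nthc V 0) \<and>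
     (\<forall>i<hdc (pfst p). reval g (list_decode (Suc (pair (nthc V i) (Suc (pair i (tlc (pfst p))))))) (nthc V (Suc i)))
     \<and> nthc V (hdc (pfst p)) = psnd p))"
    by (intro semidec_intros semidec_compose2[of "\<lambda>L y. reval f (list_decode L) y", OF Pr(1)]
      semidec_compose2[of "\<lambda>L y. reval g (list_decode L) y", OF Pr(2)])
  then show ?case
  proof (rule semidec_cong)
    fix p
    show "pfst p \<noteq> 0 \<and> (\<exists>V. reval f (list_decode (tlc (pfst p))) (nthc V 0) \<and>
     (\<forall>i<hdc (pfst p). reval g (list_decode (Suc (pair (nthc V i) (Suc (pair i (tlc (pfst p))))))) (nthc V (Suc i)))
     \<and> nthc V (hdc (pfst p)) = psnd p) \<longleftrightarrow> reval (Pr f g) (list_decode (pfst p)) (psnd p)"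
    proof (cases "pfst p = 0")
      case True
      then show ?thesis by (auto elim: reval_PrE)
    next
      case False
      then show ?thesis unfolding list_decode_ne[OF False] reval_Pr_iff list_decode_code by simp
    qed
  qed
next
  case (Mn f)
  have "semidec (\<lambda>p. reval f (list_decode (Suc (pair (psnd p) (pfst p)))) 0 \<and>
    (\<forall>i<psnd p. \<exists>m. reval f (list_decode (Suc (pair i (pfst p)))) (Suc m)))"
    by (intro semidec_intros semidec_compose2[of "\<lambda>L y. reval f (list_decode L) y", OF Mn])
  then show ?case
  proof (rule semidec_cong)
    show "reval f (list_decode (Suc (pair (psnd p) (pfst p)))) 0 \<and>
      (\<forall>i<psnd p. \<exists>m. reval f (list_decode (Suc (pair i (pfst p)))) (Suc m))
      \<longleftrightarrow> reval (Mn f) (list_decode (pfst p)) (psnd p)" for p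
      unfolding list_decode_code by (rule iffI) (auto elim: reval_MnE intro: reval.intros(7))
  qed
qed

lemma re_set_iff_semidec: "re_set A \<longleftrightarrow> semidec (\<lambda>x. x \<in> A)"
proof
  assume "re_set A"
  then obtain c where c: "\<And>x. x \<in> A \<longleftrightarrow> (\<exists>y. reval c [x] y)" unfolding re_set_def by blast
  \<comment> \<open>\<open>Suc (pair x 0)\<close> is the code of the list
    \<open>[x]\<close>.\<close>
  have "semidec (\<lambda>x. \<exists>y. reval c (list_decode (Suc (pair x 0))) y)"
    by (intro semidec_intros semidec_compose2[of "\<lambda>L y. reval c (list_decode L) y", OF semidec_reval])
  then show "semidec (\<lambda>x. x \<in> A)" by (rule semidec_cong) (simp only: c list_decode_code list_decode.simps(1))
qed (use re_set_semidec in force)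

section \<open>Codes of types\<close>

definition cDia :: "nat \<Rightarrow> nat \<Rightarrow> nat \<Rightarrow> nat" where "cDia b k z = pair 4 (pair b (pair k z))"
definition cNeg :: "nat \<Rightarrow> nat" where "cNeg z = pair 2 z"
definition cConj :: "nat \<Rightarrow> nat \<Rightarrow> nat" where "cConj x y = pair 3 (pair x y)"
definition cEq :: "nat \<Rightarrow> nat \<Rightarrow> nat \<Rightarrow> nat" where
  "cEq b k z = cConj (cDia b k z) (cNeg (cDia b (Suc k) z))"

lemma computable_cDia: "computable f \<Longrightarrow> computable g \<Longrightarrow> computable h \<Longrightarrow> computable (\<lambda>x. cDia (f x) (g x) (h x))"
  and computable_cNeg: "computable f \<Longrightarrow> computable (\<lambda>x. cNeg (f x))"
  and computable_cConj: "computable f \<Longrightarrow> computable g \<Longrightarrow> computable (\<lambda>x. cConj (f x) (g x))"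
  unfolding cDia_def cNeg_def cConj_def by (intro semidec_intros; assumption)+

lemma computable_cEq: "computable f \<Longrightarrow> computable g \<Longrightarrow> computable h \<Longrightarrow> computable (\<lambda>x. cEq (f x) (g x) (h x))"
  unfolding cEq_def by (intro computable_cDia computable_cNeg computable_cConj computable_Suc)

text \<open>Since \<open>fm_enc Top = 0\<close>, a literal 0 in the place of a formula code stands
  for \<open>Top\<close> from here on.\<close>

lemma fm_enc_code: "fm_enc Top = 0" "fm_enc (Neg f) = cNeg (fm_enc f)"
  "fm_enc (Conj f g) = cConj (fm_enc f) (fm_enc g)" "fm_enc (Dia b k f) = cDia b k (fm_enc f)"
  "fm_enc (diaeq b k f) = cEq b k (fm_enc f)"
  by (simp_all add: cDia_def cNeg_def cConj_def cEq_def diaeq_def prod_encode_def)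

lemma fm_enc_eq_iff: "fm_enc f = fm_enc g \<longleftrightarrow> f = g"
  using inj_fm_enc by (auto dest: injD)

definition countc :: "nat \<Rightarrow> nat \<Rightarrow> nat" where
  "countc L x = rec_nat 0 (\<lambda>j y. if nthc L j = x then Suc y else y) (lenc L)"

lemma computable_countc: "computable f \<Longrightarrow> computable g \<Longrightarrow> computable (\<lambda>x. countc (f x) (g x))"
proof -
  assume "computable f" "computable g"
  have "computable (\<lambda>p. countc (pfst p) (psnd p))"
    unfolding countc_def by (intro computable_rec semidec_intros)
  from computable_compose2[OF this \<open>computable f\<close> \<open>computable g\<close>] show ?thesis .
qed

lemma countc_list_encode [simp]: "countc (list_encode xs) x = count (mset xs) x"
proof -
  have "n \<le> length xs \<Longrightarrow> rec_nat 0 (\<lambda>j y. if nthc (list_encode xs) j = x then Suc y else y) n = count (mset (take n xs)) x" for n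
    by (induction n) (auto simp: take_Suc_conv_app_nth)
  from this[of "length xs"] show ?thesis by (simp add: countc_def)
qed

text \<open>A fold from the right that starts with the last entry, because a nonempty
  \<open>conj_list\<close> ends in its last member and not in \<open>Top\<close>; hence also the
  index \<open>lenc Z - 2 - j\<close>.\<close>

definition conjc :: "nat \<Rightarrow> nat" where
  "conjc Z = rec_nat (nthc Z (lenc Z - 1)) (\<lambda>j y. cConj (nthc Z (lenc Z - 2 - j)) y) (lenc Z - 1)"

lemma computable_conjc: "computable f \<Longrightarrow> computable (\<lambda>x. conjc (f x))"
proof -
  assume f: "computable f"
  have "computable (\<lambda>Z. conjc Z)"
    unfolding conjc_def by (intro computable_rec computable_cConj semidec_intros)
  from computable_compose[OF this f] show ?thesis .
qed

lemma conj_list_Cons: "fs \<noteq> [] \<Longrightarrow> conj_list (f # fs) = Conj f (conj_list fs)"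
  by (cases fs) auto

lemma conjc_list_encode:
  assumes "fs \<noteq> []"
  shows "conjc (list_encode (map fm_enc fs)) = fm_enc (conj_list fs)"
proof -
  let ?n = "length fs" and ?Z = "list_encode (map fm_enc fs)"
  have "j < ?n \<Longrightarrow> rec_nat (nthc ?Z (lenc ?Z - 1)) (\<lambda>j y. cConj (nthc ?Z (lenc ?Z - 2 - j)) y) j
    = fm_enc (conj_list (drop (?n - 1 - j) fs))" for j
  proof (induction j)
    case 0
    have "drop (?n - 1) fs = [fs ! (?n - 1)]" using assms
      by (metis Cons_nth_drop_Suc Suc_pred' diff_less drop_all length_greater_0_conv order_refl zero_less_one)
    then show ?case using assms by simp
  next
    case (Suc j)
    define i where "i = ?n - 2 - j"
    have i: "i < ?n" "?n - 1 - Suc j = i" "?n - 1 - j = Suc i" "Suc i < ?n" using Suc.prems by (auto simp: i_def)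
    have "drop i fs = fs ! i # drop (Suc i) fs" using i(1) by (simp add: Cons_nth_drop_Suc)
    then show ?case using Suc i by (simp add: conj_list_Cons cConj_def i_def[symmetric])
  qed
  from this[of "?n - 1"] assms show ?thesis by (simp add: conjc_def)
qed

definition memc :: "nat \<Rightarrow> nat \<Rightarrow> bool" where
  "memc x Z \<longleftrightarrow> (\<exists>i. i < lenc Z \<and> nthc Z i = x)"

lemma memc_list_encode [simp]: "memc x (list_encode xs) \<longleftrightarrow> x \<in> set xs"
  by (auto simp: memc_def in_set_conv_nth)

lemma semidec_memc: "computable f \<Longrightarrow> computable g \<Longrightarrow> semidec (\<lambda>x. memc (f x) (g x))"
proof -
  assume fg: "computable f" "computable g"
  have "semidec (\<lambda>p. memc (pfst p) (psnd p))" unfolding memc_def by (intro semidec_intros)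
  from semidec_compose2[OF this fg] show ?thesis .
qed

text \<open>The graph of \<open>type_of_succs\<close> on codes: \<open>e\<close> codes the depth-0
  part, and entry \<open>b\<close> of \<open>Ns\<close> lists the successor types along label
  \<open>Suc b\<close>. The sorted list of conjunct codes behind \<open>cconj\<close> is guessed, as
  a strictly increasing \<open>Z\<close> that contains exactly the right codes.\<close>

definition mkrel :: "nat \<Rightarrow> nat \<Rightarrow> nat \<Rightarrow> nat \<Rightarrow> bool" where
  "mkrel a e Ns y \<longleftrightarrow> (\<exists>Z. 0 < lenc Z \<and> (\<forall>i<lenc Z - 1. nthc Z i < nthc Z (Suc i)) \<and> memc e Z
    \<and> (\<forall>b<a. memc (cEq (Suc b) (lenc (nthc Ns b)) 0) Z \<and> (\<forall>j<lenc (nthc Ns b).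
        memc (cEq (Suc b) (countc (nthc Ns b) (nthc (nthc Ns b) j)) (nthc (nthc Ns b) j)) Z))
    \<and> (\<forall>i<lenc Z. nthc Z i = e \<or> (\<exists>b. b < a \<and> (nthc Z i = cEq (Suc b) (lenc (nthc Ns b)) 0 \<or>
        (\<exists>j. j < lenc (nthc Ns b) \<and> nthc Z i = cEq (Suc b) (countc (nthc Ns b) (nthc (nthc Ns b) j)) (nthc (nthc Ns b) j)))))
    \<and> y = conjc Z)"

lemma semidec_mkrel:
  assumes "computable f" "computable g" "computable h"
  shows "semidec (\<lambda>x. mkrel a (f x) (g x) (h x))"
proof -
  have "semidec (\<lambda>p. mkrel a (pfst p) (pfst (psnd p)) (psnd (psnd p)))"
    unfolding mkrel_def by (intro semidec_intros semidec_memc computable_cEq computable_countc computable_conjc)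
  from semidec_compose3[OF this assms] show ?thesis .
qed

lemma count_map_fm_enc: "count (mset (map fm_enc l)) (fm_enc s) = count (mset l) s"
  by (induction l) (auto simp: fm_enc_eq_iff)

lemma bex_set_nth: "(\<exists>s\<in>set xs. Q s) \<longleftrightarrow> (\<exists>j. j < length xs \<and> Q (xs ! j))"
  by (metis in_set_conv_nth)

definition codeset :: "nat \<Rightarrow> nat \<Rightarrow> (nat \<Rightarrow> nat list) \<Rightarrow> nat set" where
  "codeset a e L = {e} \<union> {cEq (Suc b) (count (mset (L b)) z) z | b z. b < a \<and> z \<in> set (L b)}
    \<union> {cEq (Suc b) (length (L b)) 0 | b. b < a}"

lemma finite_codeset: "finite (codeset a e L)"
proof -
  have "codeset a e L = {e} \<union> (\<lambda>(b, z). cEq (Suc b) (count (mset (L b)) z) z) ` (SIGMA b:{..<a}. set (L b))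
    \<union> (\<lambda>b. cEq (Suc b) (length (L b)) 0) ` {..<a}"
    by (auto simp: codeset_def)
  then show ?thesis by simp
qed

lemma mkrel_iff:
  assumes L: "\<And>b. b < a \<Longrightarrow> nthc Ns b = list_encode (L b)"
  shows "mkrel a e Ns y \<longleftrightarrow> y = conjc (list_encode (sorted_list_of_set (codeset a e L)))"
proof -
  have "mkrel a e Ns y \<longleftrightarrow> (\<exists>zs. sorted_wrt (<) zs \<and> set zs = codeset a e L \<and> y = conjc (list_encode zs))"
  proof -
    have "(0 < lenc (list_encode zs) \<and> (\<forall>i<lenc (list_encode zs) - 1. nthc (list_encode zs) i < nthc (list_encode zs) (Suc i)) \<and> memc e (list_encode zs)
    \<and> (\<forall>b<a. memc (cEq (Suc b) (lenc (nthc Ns b)) 0) (list_encode zs) \<and> (\<forall>j<lenc (nthc Ns b).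
        memc (cEq (Suc b) (countc (nthc Ns b) (nthc (nthc Ns b) j)) (nthc (nthc Ns b) j)) (list_encode zs)))
    \<and> (\<forall>i<lenc (list_encode zs). nthc (list_encode zs) i = e \<or> (\<exists>b. b < a \<and> (nthc (list_encode zs) i = cEq (Suc b) (lenc (nthc Ns b)) 0 \<or>
        (\<exists>j. j < lenc (nthc Ns b) \<and> nthc (list_encode zs) i = cEq (Suc b) (countc (nthc Ns b) (nthc (nthc Ns b) j)) (nthc (nthc Ns b) j)))))
    \<and> y = conjc (list_encode zs)) \<longleftrightarrow> sorted_wrt (<) zs \<and> set zs = codeset a e L \<and> y = conjc (list_encode zs)"
      (is "?pos \<and> ?sorted \<and> ?e \<and> ?sup \<and> ?sub \<and> ?y \<longleftrightarrow> ?R") for zs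
    proof -
      have 1: "?sorted \<longleftrightarrow> sorted_wrt (<) zs"
        by (simp add: sorted_wrt_iff_nth_Suc_transp less_diff_conv)
      have 2: "?e \<and> ?sup \<longleftrightarrow> codeset a e L \<subseteq> set zs"
      proof -
        have "?sup \<longleftrightarrow> (\<forall>b<a. cEq (Suc b) (length (L b)) 0 \<in> set zs \<and>
            (\<forall>z\<in>set (L b). cEq (Suc b) (count (mset (L b)) z) z \<in> set zs))"
          by (intro all_cong) (simp add: L all_set_conv_all_nth)
        then show ?thesis unfolding codeset_def by auto
      qed
      have 3: "?sub \<longleftrightarrow> set zs \<subseteq> codeset a e L"
      proof -
        have "(\<exists>b. b < a \<and> (z = cEq (Suc b) (lenc (nthc Ns b)) 0 \<or>
          (\<exists>j. j < lenc (nthc Ns b) \<and> z = cEq (Suc b) (countc (nthc Ns b) (nthc (nthc Ns b) j)) (nthc (nthc Ns b) j))))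
          \<longleftrightarrow> (\<exists>b. b < a \<and> (z = cEq (Suc b) (length (L b)) 0 \<or>
          (\<exists>s\<in>set (L b). z = cEq (Suc b) (count (mset (L b)) s) s)))" for z
          by (intro ex_cong1 conj_cong refl) (simp add: L bex_set_nth cong: conj_cong)
        then have "?sub \<longleftrightarrow> (\<forall>z\<in>set zs. z \<in> codeset a e L)"
          unfolding codeset_def all_set_conv_all_nth by (simp add: L) blast
        then show ?thesis by blast
      qed
      have 4: "?e \<Longrightarrow> ?pos" by (auto simp: memc_def)
      show ?thesis using 1 2 3 4 by blast
    qed
    then show ?thesis unfolding mkrel_def by (subst ex_list_code[symmetric]) (rule ex_cong1)
  qed
  also have "\<dots> \<longleftrightarrow> y = conjc (list_encode (sorted_list_of_set (codeset a e L)))"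
  proof -
    \<comment> \<open>A finite set has only one strictly increasing enumeration, so the guess is
      forced.\<close>
    have "sorted_wrt (<) zs \<and> set zs = codeset a e L \<longleftrightarrow> zs = sorted_list_of_set (codeset a e L)" for zs
      using finite_codeset[of a e L] by (metis strict_sorted_equal strict_sorted_list_of_set set_sorted_list_of_set)
    then show ?thesis by (simp add: conj_assoc[symmetric])
  qed
  finally show ?thesis .
qed

text \<open>\<open>cconj\<close> orders its members by their codes, so sorting the set of codes
  yields the same list. The lists \<open>L b\<close> may enumerate the multisets in any
  order.\<close>

lemma mkrel_fm_enc:
  assumes L: "\<And>b. b < a \<Longrightarrow> nthc Ns b = list_encode (map fm_enc (L b))"
    and N: "\<And>b. b < a \<Longrightarrow> N (Suc b) = mset (L b)"
  shows "mkrel a (fm_enc (eps0 P E)) Ns y \<longleftrightarrow> y = fm_enc (type_of_succs P {1..a} E N)"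
proof -
  have I: "{1..a} = Suc ` {..<a}" by (simp add: image_Suc_lessThan)
  define X where "X = conjuncts_of_succs P {1..a} E N"
  have finX: "finite X" unfolding X_def by (rule finite_conjuncts_of_succs) simp
  have "fm_enc ` X = codeset a (fm_enc (eps0 P E)) (\<lambda>b. map fm_enc (L b))"
  proof -
    have "{diaeq b (count (N b) s) s | b s. b \<in> {1..a} \<and> s \<in># N b} = {diaeq (Suc b) (count (mset (L b)) s) s | b s. b < a \<and> s \<in> set (L b)}"
      unfolding I using N by force
    moreover have "{diaeq b (size (N b)) Top | b. b \<in> {1..a}} = {diaeq (Suc b) (length (L b)) Top | b. b < a}"
      unfolding I using N by force
    ultimately have "X = {eps0 P E} \<union> {diaeq (Suc b) (count (mset (L b)) s) s | b s. b < a \<and> s \<in> set (L b)}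
      \<union> {diaeq (Suc b) (length (L b)) Top | b. b < a}" unfolding X_def conjuncts_of_succs_def by simp
    moreover have "fm_enc ` {diaeq (Suc b) (count (mset (L b)) s) s | b s. b < a \<and> s \<in> set (L b)}
      = {cEq (Suc b) (count (mset (map fm_enc (L b))) z) z | b z. b < a \<and> z \<in> set (map fm_enc (L b))}"
      (is "_ ` ?A = ?B")
    proof
      show "fm_enc ` ?A \<subseteq> ?B"
      proof clarify
        fix b s assume "b < a" "s \<in> set (L b)"
        then show "\<exists>b' z. fm_enc (diaeq (Suc b) (count (mset (L b)) s) s) = cEq (Suc b') (count (mset (map fm_enc (L b'))) z) z
            \<and> b' < a \<and> z \<in> set (map fm_enc (L b'))"
          by (intro exI[of _ b] exI[of _ "fm_enc s"]) (simp add: fm_enc_code count_map_fm_enc del: mset_map)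
      qed
      show "?B \<subseteq> fm_enc ` ?A"
      proof clarify
        fix b z assume "b < a" "z \<in> set (map fm_enc (L b))"
        then obtain s where "s \<in> set (L b)" "z = fm_enc s" by auto
        then show "cEq (Suc b) (count (mset (map fm_enc (L b))) z) z \<in> fm_enc ` ?A"
          using \<open>b < a\<close> by (intro image_eqI[of _ _ "diaeq (Suc b) (count (mset (L b)) s) s"])
            (auto simp: fm_enc_code count_map_fm_enc simp del: mset_map)
      qed
    qed
    moreover have "fm_enc ` {diaeq (Suc b) (length (L b)) Top | b. b < a} = {cEq (Suc b) (length (map fm_enc (L b))) 0 | b. b < a}"
      by (simp add: setcompr_eq_image image_image fm_enc_code(1,5) del: fm_enc.simps)
    ultimately show ?thesis unfolding codeset_def by (simp only: image_Un image_insert image_empty)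
  qed
  then have 1: "mkrel a (fm_enc (eps0 P E)) Ns y \<longleftrightarrow> y = conjc (list_encode (sorted_list_of_set (fm_enc ` X)))"
    using mkrel_iff[OF L] by metis
  define fs where "fs = map (the_inv fm_enc) (sorted_list_of_set (fm_enc ` X))"
  have "map fm_enc fs = map (\<lambda>x. x) (sorted_list_of_set (fm_enc ` X))"
    unfolding fs_def map_map by (rule map_cong) (use finX in \<open>auto simp: the_inv_f_f[OF inj_fm_enc]\<close>)
  moreover have "fs \<noteq> []" unfolding fs_def using finX by (auto simp: X_def conjuncts_of_succs_def)
  ultimately have "conjc (list_encode (sorted_list_of_set (fm_enc ` X))) = fm_enc (cconj X)"
    using conjc_list_encode[of fs] by (simp add: cconj_def fs_def)
  then show ?thesis unfolding 1 type_of_succs_def X_def[symmetric] by simp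
qed

section \<open>Evaluating formulae on types\<close>

lemma finite_index: "finite {1..a::nat}" by simp

definition judg :: "nat \<Rightarrow> nat \<Rightarrow> nat \<Rightarrow> nat \<Rightarrow> nat" where
  "judg n t f b = pair n (pair t (pair f b))"

lemma computable_judg: "computable f \<Longrightarrow> computable g \<Longrightarrow> computable h \<Longrightarrow> computable k \<Longrightarrow> computable (\<lambda>x. judg (f x) (g x) (h x) (k x))"
  unfolding judg_def by (intro computable_pair)

lemma judg_eq_iff [simp]: "judg n t f b = judg n' t' f' b' \<longleftrightarrow> n = n' \<and> t = t' \<and> f = f' \<and> b = b'"
  by (simp add: judg_def)

text \<open>For finite \<open>P\<close> a finite truth table: depth-0 type, atomic formula, truth
  value. As \<open>Top\<close> has code 0 and is always true,
  \<open>pair e (pair 0 1) \<in> atoms P\<close> says that \<open>e\<close> codes a depth-0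
  type.\<close>

definition atoms :: "nat set \<Rightarrow> nat set" where
  "atoms P = (\<lambda>(E, f). pair (fm_enc (eps0 P E)) (pair (fm_enc f) (if f = Top \<or> f \<in> Prop ` E then 1 else 0)))
    ` (Pow P \<times> insert Top (Prop ` P))"

lemma finite_atoms: "finite P \<Longrightarrow> finite (atoms P)"
  by (simp add: atoms_def)

lemma atomsE:
  assumes "pair e (pair f b) \<in> atoms P"
  obtains E g where "E \<subseteq> P" "e = fm_enc (eps0 P E)" "f = fm_enc g" "wf_fm P I g" "md g = 0"
    "\<forall>(M :: nat kmodel) w. val P M w = E \<longrightarrow> b = (if sat M w g then 1 else 0)"
proof -
  obtain E g where E: "E \<subseteq> P" and g: "g = Top \<or> g \<in> Prop ` P" and
    eq: "e = fm_enc (eps0 P E)" "f = fm_enc g" "b = (if g = Top \<or> g \<in> Prop ` E then 1 else 0)"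
  proof -
    from assms obtain x where x: "x \<in> Pow P \<times> insert Top (Prop ` P)" "pair e (pair f b) =
      (\<lambda>(E, f). pair (fm_enc (eps0 P E)) (pair (fm_enc f) (if f = Top \<or> f \<in> Prop ` E then 1 else 0))) x"
      unfolding atoms_def by (rule imageE)
    show thesis by (rule that[of "fst x" "snd x"]) (use x in \<open>auto simp: case_prod_beta simp del: fm_enc.simps\<close>)
  qed
  have "b = (if sat M w g then 1 else 0)" if "val P M w = E" for M :: "nat kmodel" and w
    using g eq(3) that by auto
  then show thesis using E g eq by (intro that[of E g]) auto
qed

lemma atomsI:
  assumes "f = Top \<or> f \<in> Prop ` P"
  shows "pair (fm_enc (eps0 P (val P M w))) (pair (fm_enc f) (if sat M w f then 1 else 0)) \<in> atoms P"
proof -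
  have "sat M w f \<longleftrightarrow> f = Top \<or> f \<in> Prop ` val P M w" using assms by auto
  then show ?thesis unfolding atoms_def using assms
    by (intro image_eqI[of _ _ "(val P M w, f)"]) auto
qed

text \<open>That the listed successors are types of depth \<open>n\<close> is expressed by judging
  \<open>Top\<close> true at them; typehood thus becomes part of the same inductive definition as
  truth.\<close>

definition prem :: "nat \<Rightarrow> nat \<Rightarrow> nat \<Rightarrow> nat \<Rightarrow> bool" where
  "prem a u Ns n \<longleftrightarrow> (\<forall>b<a. \<forall>j<lenc (nthc Ns b). memc (judg n (nthc (nthc Ns b) j) 0 1) u)"

text \<open>In a judgement \<open>n, t, f, b\<close>, the number \<open>t\<close> codes a type of depth \<open>n\<close>, \<open>f\<close> a formula of
  modal depth at most \<open>n\<close>, and \<open>b\<close> its truth value at the points of type \<open>t\<close>. The last premise of the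
  diamond rule guarantees that \<open>f\<close> codes such a formula even if there are no successors.\<close>

definition eval_step :: "nat set \<Rightarrow> nat \<Rightarrow> nat \<Rightarrow> nat \<Rightarrow> bool" where
  "eval_step P a u q \<longleftrightarrow>
    (\<exists>e f b. q = judg 0 e f b \<and> pair e (pair f b) \<in> atoms P)
  \<or> (\<exists>n t f b e Ns. q = judg (Suc n) t f b \<and> pair e (pair f b) \<in> atoms P \<and> mkrel a e Ns t \<and> prem a u Ns n)
  \<or> (\<exists>n t f b. q = judg n t (cNeg f) (1 - b) \<and> memc (judg n t f b) u)
  \<or> (\<exists>n t f g b c. q = judg n t (cConj f g) (if b = 1 \<and> c = 1 then 1 else 0) \<and>
       memc (judg n t f b) u \<and> memc (judg n t g c) u)
  \<or> (\<exists>n t f i k e Ns Bs t' b'. q = judg (Suc n) t (cDia (Suc i) k f) (if k \<le> countc Bs 1 then 1 else 0) \<and>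
       i < a \<and> pair e (pair 0 1) \<in> atoms P \<and> mkrel a e Ns t \<and> prem a u Ns n \<and>
       lenc Bs = lenc (nthc Ns i) \<and> (\<forall>j<lenc (nthc Ns i). memc (judg n (nthc (nthc Ns i) j) f (nthc Bs j)) u) \<and>
       memc (judg n t' f b') u)"

lemma eval_step_atom: "pair e (pair f b) \<in> atoms P \<Longrightarrow> eval_step P a u (judg 0 e f b)"
  unfolding eval_step_def by (rule disjI1) (intro exI conjI, rule refl, assumption)

lemma eval_step_node: "pair e (pair f b) \<in> atoms P \<Longrightarrow> mkrel a e Ns t \<Longrightarrow> prem a u Ns n \<Longrightarrow>
    eval_step P a u (judg (Suc n) t f b)"
  unfolding eval_step_def by (rule disjI2, rule disjI1) (intro exI conjI, rule refl)

lemma eval_step_Neg: "memc (judg n t f b) u \<Longrightarrow> eval_step P a u (judg n t (cNeg f) (1 - b))"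
  unfolding eval_step_def by (rule disjI2, rule disjI2, rule disjI1) (intro exI conjI, rule refl)

lemma eval_step_Conj: "memc (judg n t f b) u \<Longrightarrow> memc (judg n t g c) u \<Longrightarrow>
    eval_step P a u (judg n t (cConj f g) (if b = 1 \<and> c = 1 then 1 else 0))"
  unfolding eval_step_def by (rule disjI2, rule disjI2, rule disjI2, rule disjI1) (intro exI conjI, rule refl)

lemma eval_step_Dia: "i < a \<Longrightarrow> pair e (pair 0 1) \<in> atoms P \<Longrightarrow> mkrel a e Ns t \<Longrightarrow> prem a u Ns n \<Longrightarrow>
    lenc Bs = lenc (nthc Ns i) \<Longrightarrow> \<forall>j<lenc (nthc Ns i). memc (judg n (nthc (nthc Ns i) j) f (nthc Bs j)) u \<Longrightarrow>
    memc (judg n t' f b') u \<Longrightarrow>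
    eval_step P a u (judg (Suc n) t (cDia (Suc i) k f) (if k \<le> countc Bs 1 then 1 else 0))"
  unfolding eval_step_def by (rule disjI2, rule disjI2, rule disjI2, rule disjI2) (intro exI conjI, rule refl)

lemma semidec_eval_step: "finite P \<Longrightarrow> semidec (\<lambda>p. eval_step P a (pfst p) (psnd p))"
  unfolding eval_step_def prem_def
  by (intro semidec_finite[OF finite_atoms] semidec_intros semidec_memc semidec_mkrel computable_judg computable_cNeg computable_cConj computable_cDia computable_countc)

abbreviation evaluates :: "nat set \<Rightarrow> nat \<Rightarrow> nat \<Rightarrow> bool" where
  "evaluates P a \<equiv> der (eval_step P a)"

lemma semidec_evaluates: "finite P \<Longrightarrow> computable f \<Longrightarrow> semidec (\<lambda>x. evaluates P a (f x))"
  by (intro semidec_compose[OF semidec_der[OF semidec_eval_step]])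

section \<open>Soundness and completeness of the evaluation rules\<close>

text \<open>Truth at a type. Any realizing point may be used: for formulae over \<open>P\<close> and
  \<open>I\<close> of modal depth at most \<open>n\<close>, \<open>dtype_determines_sat\<close>
  makes the choice immaterial.\<close>

definition type_sat :: "nat set \<Rightarrow> nat set \<Rightarrow> nat \<Rightarrow> fm \<Rightarrow> fm \<Rightarrow> bool" where
  "type_sat P I n f s \<longleftrightarrow> (\<exists>(M :: nat kmodel) w. pointed_model P I M w \<and> dtype P I n M w = s \<and> sat M w f)"

lemma type_sat_dtype:
  fixes M :: "nat kmodel"
  assumes "finite P" "finite I" "pointed_model P I M w" "md f \<le> n" "wf_fm P I f"
  shows "type_sat P I n f (dtype P I n M w) \<longleftrightarrow> sat M w f"
proof
  assume "type_sat P I n f (dtype P I n M w)"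
  then obtain M' :: "nat kmodel" and w' where "pointed_model P I M' w'" "dtype P I n M' w' = dtype P I n M w" "sat M' w' f"
    unfolding type_sat_def by auto
  then show "sat M w f" using dtype_determines_sat[OF assms(1,2) _ assms(3,4) _ assms(5)] by simp
qed (use assms(3) type_sat_def in auto)

lemma card_sat_nbrs:
  fixes M :: "nat kmodel"
  assumes "finite P" "finite I" "pointed_model P I M w" "md f \<le> n" "wf_fm P I f"
  shows "card {v \<in> nbrs M c w. sat M v f} =
    size (filter_mset (type_sat P I n f) (image_mset (dtype P I n M) (mset_set (nbrs M c w))))"
proof -
  have "{v \<in> nbrs M c w. sat M v f} = {v \<in> nbrs M c w. type_sat P I n f (dtype P I n M v)}"
    using type_sat_dtype[OF assms(1,2) pointed_nbrs[OF assms(3)] assms(4,5)] by auto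
  then show ?thesis by (simp add: filter_mset_image_mset o_def filter_mset_mset_set finite_nbrs[OF assms(3)])
qed

lemma count_indicator: "count (mset (map (\<lambda>s. if Q s then 1 else 0) l)) (1::nat) = size (filter_mset Q (mset l))"
  by (induction l) auto

definition valid :: "nat set \<Rightarrow> nat \<Rightarrow> nat \<Rightarrow> bool" where
  "valid P a q \<longleftrightarrow> (\<exists>n f (M :: nat kmodel) w. pointed_model P {1..a} M w \<and> wf_fm P {1..a} f \<and> md f \<le> n \<and>
     q = judg n (fm_enc (dtype P {1..a} n M w)) (fm_enc f) (if sat M w f then 1 else 0))"

lemma validI:
  fixes M :: "nat kmodel"
  assumes "pointed_model P {1..a} M w" "wf_fm P {1..a} f" "md f \<le> n"
    "t = fm_enc (dtype P {1..a} n M w)" "z = fm_enc f" "b = (if sat M w f then 1 else 0)"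
  shows "valid P a (judg n t z b)"
  unfolding valid_def using assms by (intro exI[of _ n] exI[of _ f] exI[of _ M] exI[of _ w]) simp

lemma validE:
  assumes "valid P a (judg n t z b)"
  obtains f and M :: "nat kmodel" and w where "pointed_model P {1..a} M w" "wf_fm P {1..a} f" "md f \<le> n"
    "t = fm_enc (dtype P {1..a} n M w)" "z = fm_enc f" "b = (if sat M w f then 1 else 0)"
  using assms unfolding valid_def by auto

text \<open>Each judgement in \<open>prem\<close> certifies that a listed number is the code of a
  type of depth \<open>n\<close>, so lists of codes can be lifted to lists of types.\<close>

lemma prem_lists:
  assumes "prem a (list_encode us) Ns n" "\<And>y. y \<in> set us \<Longrightarrow> valid P a y"
  obtains L where "\<forall>b<a. nthc Ns b = list_encode (map fm_enc (L b))"
    "\<forall>b<a. set (L b) \<subseteq> dtypes P {1..a} n"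
proof -
  have "\<exists>l. nthc Ns b = list_encode (map fm_enc l) \<and> set l \<subseteq> dtypes P {1..a} n" if "b < a" for b
  proof -
    define zs where "zs = list_decode (nthc Ns b)"
    then have zs: "nthc Ns b = list_encode zs" by simp
    have z: "\<exists>s \<in> dtypes P {1..a} n. z = fm_enc s" if z: "z \<in> set zs" for z
    proof -
      obtain j where "j < length zs" "zs ! j = z" using z by (auto simp: in_set_conv_nth)
      then have "judg n z 0 1 \<in> set us" using assms(1) \<open>b < a\<close> unfolding prem_def by (auto simp: zs)
      then have "valid P a (judg n z 0 1)" by (rule assms(2))
      then obtain f and M :: "nat kmodel" and w where "pointed_model P {1..a} M w" "z = fm_enc (dtype P {1..a} n M w)"
        by (rule validE)
      then show ?thesis using dtype_in_dtypes by (intro bexI[of _ "dtype P {1..a} n M w"])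
    qed
    then have "\<exists>l. zs = map fm_enc l" unfolding ex_map_conv by blast
    then obtain l where l: "zs = map fm_enc l" ..
    have "s \<in> dtypes P {1..a} n" if "s \<in> set l" for s
      using z[of "fm_enc s"] that unfolding l by (auto simp: fm_enc_eq_iff)
    then show ?thesis using zs l by auto
  qed
  then obtain L where "\<forall>b<a. nthc Ns b = list_encode (map fm_enc (L b)) \<and> set (L b) \<subseteq> dtypes P {1..a} n"
    using choice[of "\<lambda>b l. b < a \<longrightarrow> nthc Ns b = list_encode (map fm_enc l) \<and> set l \<subseteq> dtypes P {1..a} n"] by auto
  then show thesis by (intro that[of L]) blast+
qed

lemma model_of_val:
  assumes "E \<subseteq> P"
  obtains M :: "nat kmodel" and w where "pointed_model P I M w" "val P M w = E"
proof
  let ?M = "\<lparr>mW = {0}, mR = (\<lambda>_. {}), mV = (\<lambda>p. if p \<in> E then {0} else {})\<rparr> :: nat kmodel"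
  show "pointed_model P I ?M 0" using assms by (auto simp: pointed_model_def is_model_def)
  show "val P ?M 0 = E" using assms by auto
qed

text \<open>A type assembled on the level of codes comes without a model; \<open>join_model\<close>
  supplies one, at which the conclusion of a rule can be checked.\<close>

lemma mkrel_model:
  assumes "E \<subseteq> P" and L: "\<And>b. b < a \<Longrightarrow> nthc Ns b = list_encode (map fm_enc (L b))"
    and dtypes: "\<And>b. b < a \<Longrightarrow> set (L b) \<subseteq> dtypes P {1..a} n"
    and type_of_succs: "mkrel a (fm_enc (eps0 P E)) Ns t"
  obtains M :: "nat kmodel" and w where "pointed_model P {1..a} M w" "val P M w = E"
    "t = fm_enc (dtype P {1..a} (Suc n) M w)"
    "\<forall>b<a. image_mset (dtype P {1..a} n M) (mset_set (nbrs M (Suc b) w)) = mset (L b)"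
proof -
  define N where "N c = mset (L (c - 1))" for c
  have N: "set_mset (N c) \<subseteq> dtypes P {1..a} n" if "c \<in> {1..a}" for c
    using dtypes[of "c - 1"] that by (cases c) (auto simp: N_def)
  obtain M :: "nat kmodel" and w where M: "pointed_model P {1..a} M w" "val P M w = E"
    "\<forall>c\<in>{1..a}. image_mset (dtype P {1..a} n M) (mset_set (nbrs M c w)) = N c"
    using finite_index assms(1) N by (rule join_model)
  have "t = fm_enc (type_of_succs P {1..a} E N)"
    using type_of_succs mkrel_fm_enc[OF L, of a N P E t] by (simp add: N_def)
  moreover have "type_of_succs P {1..a} E N = dtype P {1..a} (Suc n) M w"
    unfolding dtype.simps M(2) by (rule type_of_succs_cong) (rule M(3)[rule_format, symmetric])
  moreover have "image_mset (dtype P {1..a} n M) (mset_set (nbrs M (Suc b) w)) = mset (L b)" if "b < a" for b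
    using M(3)[rule_format, of "Suc b"] that by (simp add: N_def)
  ultimately show thesis using M(1,2) by (intro that[of M w]) (simp_all del: dtype.simps)
qed

lemma evaluates_sound:
  assumes P: "finite P"
  shows "evaluates P a q \<Longrightarrow> valid P a q"
proof (induction rule: der.induct)
  case (1 us q)
  note IH = "1.IH"
  from \<open>eval_step P a (list_encode us) q\<close> show ?case
    unfolding eval_step_def memc_list_encode
  proof (elim disjE exE conjE)
    fix e f b assume q: "q = judg 0 e f b" and "pair e (pair f b) \<in> atoms P"
    from this(2) obtain E g where E: "E \<subseteq> P" "e = fm_enc (eps0 P E)" "f = fm_enc g" "wf_fm P {1..a} g" "md g = 0"
      "\<forall>(M :: nat kmodel) w. val P M w = E \<longrightarrow> b = (if sat M w g then 1 else 0)" by (rule atomsE[where I = "{1..a}"])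
    obtain M :: "nat kmodel" and w where M: "pointed_model P {1..a} M w" "val P M w = E"
      using E(1) by (rule model_of_val)
    show ?thesis unfolding q by (rule validI[OF M(1) E(4)]) (use E M in auto)
  next
    fix n t f b e Ns
    assume q: "q = judg (Suc n) t f b" and at: "pair e (pair f b) \<in> atoms P"
      and type_of_succs: "mkrel a e Ns t" and pr: "prem a (list_encode us) Ns n"
    from at obtain E g where E: "E \<subseteq> P" "e = fm_enc (eps0 P E)" "f = fm_enc g" "wf_fm P {1..a} g" "md g = 0"
      "\<forall>(M :: nat kmodel) w. val P M w = E \<longrightarrow> b = (if sat M w g then 1 else 0)" by (rule atomsE[where I = "{1..a}"])
    from pr IH obtain L where L0: "\<forall>b<a. nthc Ns b = list_encode (map fm_enc (L b))"
      "\<forall>b<a. set (L b) \<subseteq> dtypes P {1..a} n" by (rule prem_lists)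
    note L = L0[rule_format]
    obtain M :: "nat kmodel" and w where M: "pointed_model P {1..a} M w" "val P M w = E"
      "t = fm_enc (dtype P {1..a} (Suc n) M w)"
      using E(1) L type_of_succs[unfolded E(2)] by (rule mkrel_model)
    show ?thesis unfolding q by (rule validI[OF M(1) E(4)]) (use E M in auto)
  next
    fix n t f b assume q: "q = judg n t (cNeg f) (1 - b)" and "judg n t f b \<in> set us"
    from IH[OF this(2)] obtain g and M :: "nat kmodel" and w where M: "pointed_model P {1..a} M w" "wf_fm P {1..a} g" "md g \<le> n"
      "t = fm_enc (dtype P {1..a} n M w)" "f = fm_enc g" "b = (if sat M w g then 1 else 0)" by (rule validE)
    show ?thesis unfolding q by (rule validI[OF M(1), of "Neg g"]) (use M in \<open>simp_all add: fm_enc_code(2) del: fm_enc.simps\<close>)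
  next
    fix n t f f' b b' assume q: "q = judg n t (cConj f f') (if b = 1 \<and> b' = 1 then 1 else 0)"
      and us: "judg n t f b \<in> set us" "judg n t f' b' \<in> set us"
    from IH[OF us(1)] obtain g and M :: "nat kmodel" and w where M: "pointed_model P {1..a} M w" "wf_fm P {1..a} g" "md g \<le> n"
      "t = fm_enc (dtype P {1..a} n M w)" "f = fm_enc g" "b = (if sat M w g then 1 else 0)" by (rule validE)
    from IH[OF us(2)] obtain g' and M' :: "nat kmodel" and w' where M': "pointed_model P {1..a} M' w'" "wf_fm P {1..a} g'" "md g' \<le> n"
      "t = fm_enc (dtype P {1..a} n M' w')" "f' = fm_enc g'" "b' = (if sat M' w' g' then 1 else 0)" by (rule validE)
    \<comment> \<open>The two premises may come from different realizations of the same type; truth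
      of \<open>g'\<close> is moved to the first.\<close>
    have "dtype P {1..a} n M w = dtype P {1..a} n M' w'" using M(4) M'(4) by (simp add: fm_enc_eq_iff)
    then have "sat M' w' g' \<longleftrightarrow> sat M w g'"
      using dtype_determines_sat[OF P finite_index M(1) M'(1) M'(3) _ M'(2)] by simp
    then show ?thesis unfolding q using M M'
      by (intro validI[OF M(1), of "Conj g g'"]) (simp_all add: fm_enc_code(3) del: fm_enc.simps)
  next
    fix n t f i k e Ns Bs t' b'
    assume q: "q = judg (Suc n) t (cDia (Suc i) k f) (if k \<le> countc Bs 1 then 1 else 0)" and i: "i < a"
      and at: "pair e (pair 0 1) \<in> atoms P" and type_of_succs: "mkrel a e Ns t" and pr: "prem a (list_encode us) Ns n"
      and len: "lenc Bs = lenc (nthc Ns i)"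
      and bits: "\<forall>j<lenc (nthc Ns i). judg n (nthc (nthc Ns i) j) f (nthc Bs j) \<in> set us"
      and f: "judg n t' f b' \<in> set us"
    from IH[OF f] obtain g where g: "wf_fm P {1..a} g" "md g \<le> n" "f = fm_enc g" by (rule validE)
    from at obtain E where E: "E \<subseteq> P" "e = fm_enc (eps0 P E)" by (rule atomsE[where I = "{1..a}"])
    from pr IH obtain L where L0: "\<forall>b<a. nthc Ns b = list_encode (map fm_enc (L b))"
      "\<forall>b<a. set (L b) \<subseteq> dtypes P {1..a} n" by (rule prem_lists)
    note L = L0[rule_format]
    obtain M :: "nat kmodel" and w where M: "pointed_model P {1..a} M w" "val P M w = E"
      "t = fm_enc (dtype P {1..a} (Suc n) M w)"
      "\<forall>b<a. image_mset (dtype P {1..a} n M) (mset_set (nbrs M (Suc b) w)) = mset (L b)"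
      using E(1) L type_of_succs[unfolded E(2)] by (rule mkrel_model)
    define bs where "bs = list_decode Bs"
    have Bs: "Bs = list_encode bs" by (simp add: bs_def)
    \<comment> \<open>The bits stem from unrelated realizations of the successor types. As truth at
      a type does not depend on the realization, they can be counted as truth values at the
      successors of \<open>w\<close>.\<close>
    have "bs = map (\<lambda>s. if type_sat P {1..a} n g s then 1 else 0) (L i)"
    proof (rule nth_equalityI)
      show "length bs = length (map (\<lambda>s. if type_sat P {1..a} n g s then 1 else 0) (L i))"
        using len by (simp add: Bs L(1)[OF i])
      fix j assume j: "j < length bs"
      then have j': "j < length (L i)" using len by (simp add: Bs L(1)[OF i])
      then have "judg n (fm_enc (L i ! j)) f (bs ! j) \<in> set us"
        using bits[rule_format, of j] j by (simp add: Bs L(1)[OF i])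
      from IH[OF this] obtain g' and M' :: "nat kmodel" and w' where M': "pointed_model P {1..a} M' w'"
        "fm_enc (L i ! j) = fm_enc (dtype P {1..a} n M' w')" "f = fm_enc g'" "bs ! j = (if sat M' w' g' then 1 else 0)"
        by (rule validE)
      then have "g' = g" "L i ! j = dtype P {1..a} n M' w'" using g(3) by (auto simp: fm_enc_eq_iff)
      then show "bs ! j = map (\<lambda>s. if type_sat P {1..a} n g s then 1 else 0) (L i) ! j"
        using M'(4) type_sat_dtype[OF P finite_index M'(1) g(2,1)] j' by simp
    qed
    then have "countc Bs 1 = card {v \<in> nbrs M (Suc i) w. sat M v g}"
      unfolding Bs countc_list_encode
      using count_indicator[of "type_sat P {1..a} n g" "L i"] card_sat_nbrs[OF P finite_index M(1) g(2,1)] M(4)[rule_format, OF i] by simp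
    then have "(if k \<le> countc Bs 1 then 1 else 0) = (if sat M w (Dia (Suc i) k g) then 1 else (0::nat))"
      by (simp add: nbrs_def)
    then show ?thesis unfolding q using i g M(3)
      by (intro validI[OF M(1), of "Dia (Suc i) k g"]) (simp_all add: fm_enc_code(4) del: fm_enc.simps sat.simps)
  qed
qed

text \<open>The last conclusion speaks of all larger premise lists because the diamond rule adds
  premises of its own to those that certify the successors.\<close>

lemma evaluates_node:
  fixes M :: "nat kmodel"
  assumes "pointed_model P {1..a} M w"
    and IH: "\<And>v. pointed_model P {1..a} M v \<Longrightarrow> evaluates P a (judg n (fm_enc (dtype P {1..a} n M v)) 0 1)"
  obtains L Ns us where "\<forall>b<a. nthc Ns b = list_encode (map fm_enc (L b))"
    "\<forall>b<a. mset (L b) = image_mset (dtype P {1..a} n M) (mset_set (nbrs M (Suc b) w))"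
    "mkrel a (fm_enc (eps0 P (val P M w))) Ns (fm_enc (dtype P {1..a} (Suc n) M w))"
    "\<forall>y\<in>set us. evaluates P a y" "\<forall>us'. set us \<subseteq> set us' \<longrightarrow> prem a (list_encode us') Ns n"
proof -
  obtain L where L: "\<And>b. mset (L b) = image_mset (dtype P {1..a} n M) (mset_set (nbrs M (Suc b) w))"
    using ex_mset[of "image_mset (dtype P {1..a} n M) (mset_set (nbrs M (Suc _) w))"] by metis
  define Ns where "Ns = list_encode (map (\<lambda>b. list_encode (map fm_enc (L b))) [0..<a])"
  have Ns: "nthc Ns b = list_encode (map fm_enc (L b))" if "b < a" for b using that by (simp add: Ns_def)
  define us where "us = concat (map (\<lambda>b. map (\<lambda>s. judg n (fm_enc s) 0 1) (L b)) [0..<a])"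
  have "evaluates P a y" if y: "y \<in> set us" for y
  proof -
    obtain b s where s: "s \<in> set (L b)" "y = judg n (fm_enc s) 0 1" using y unfolding us_def by auto
    then have "s \<in># mset (L b)" by simp
    then obtain v where "v \<in> nbrs M (Suc b) w" "s = dtype P {1..a} n M v"
      unfolding L using finite_nbrs[OF assms(1)] by auto
    then show ?thesis using IH pointed_nbrs[OF assms(1)] s by blast
  qed
  moreover have "prem a (list_encode us') Ns n" if sub: "set us \<subseteq> set us'" for us'
    unfolding prem_def memc_list_encode
  proof (intro allI impI)
    fix b j assume b: "b < a" and j: "j < lenc (nthc Ns b)"
    have "judg n (nthc (nthc Ns b) j) 0 1 \<in> set us" using b j by (auto simp: Ns us_def intro!: bexI[of _ b] imageI)
    then show "judg n (nthc (nthc Ns b) j) 0 1 \<in> set us'" using sub by blast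
  qed
  moreover have "mkrel a (fm_enc (eps0 P (val P M w))) Ns (fm_enc (dtype P {1..a} (Suc n) M w))"
    using mkrel_fm_enc[OF Ns, of a "\<lambda>c. image_mset (dtype P {1..a} n M) (mset_set (nbrs M c w))"] L by simp
  ultimately show thesis using Ns L by (intro that[of Ns L us]) auto
qed

lemma evaluates_node':
  fixes M :: "nat kmodel"
  assumes "pointed_model P {1..a} M w"
    and IH: "\<And>v. pointed_model P {1..a} M v \<Longrightarrow> evaluates P a (judg n (fm_enc (dtype P {1..a} n M v)) 0 1)"
  obtains Ns us where "mkrel a (fm_enc (eps0 P (val P M w))) Ns (fm_enc (dtype P {1..a} (Suc n) M w))"
    "\<forall>y\<in>set us. evaluates P a y" "prem a (list_encode us) Ns n"
proof -
  obtain L Ns us where node: "mkrel a (fm_enc (eps0 P (val P M w))) Ns (fm_enc (dtype P {1..a} (Suc n) M w))"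
    "\<forall>y\<in>set us. evaluates P a y" "\<forall>us'. set us \<subseteq> set us' \<longrightarrow> prem a (list_encode us') Ns n"
    using assms by (rule evaluates_node)
  show thesis by (rule that[OF node(1,2) node(3)[rule_format, OF subset_refl]])
qed

lemma evaluates_I: "eval_step P a (list_encode us) q \<Longrightarrow> (\<And>y. y \<in> set us \<Longrightarrow> evaluates P a y) \<Longrightarrow> evaluates P a q"
  by (rule der.intros)

text \<open>Proved ahead of the general case: whatever the formula, the rules that assemble a type
  of positive depth require judgements on \<open>Top\<close> at its successors.\<close>

lemma evaluates_Top:
  fixes M :: "nat kmodel"
  assumes "pointed_model P {1..a} M w"
  shows "evaluates P a (judg n (fm_enc (dtype P {1..a} n M w)) 0 1)"
  using assms
proof (induction n arbitrary: w)
  case 0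
  show ?case
    by (rule evaluates_I[of _ _ "[]"], unfold dtype.simps, rule eval_step_atom) (use atomsI[where f = Top and P = P and M = M and w = w] in \<open>simp_all add: fm_enc_code(1) del: fm_enc.simps\<close>)
next
  case (Suc n)
  obtain Ns us where node: "mkrel a (fm_enc (eps0 P (val P M w))) Ns (fm_enc (dtype P {1..a} (Suc n) M w))"
    "\<forall>y\<in>set us. evaluates P a y" "prem a (list_encode us) Ns n"
    using Suc.prems Suc.IH by (rule evaluates_node')
  have "pair (fm_enc (eps0 P (val P M w))) (pair 0 1) \<in> atoms P"
    using atomsI[where f = Top and P = P and M = M and w = w] by (simp add: fm_enc_code(1) del: fm_enc.simps)
  then have "eval_step P a (list_encode us) (judg (Suc n) (fm_enc (dtype P {1..a} (Suc n) M w)) 0 1)"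
    using node(1,3) by (rule eval_step_node)
  then show ?case using node(2)[rule_format] by (rule evaluates_I)
qed

lemma evaluates_complete:
  fixes M :: "nat kmodel"
  assumes P: "finite P"
  shows "pointed_model P {1..a} M w \<Longrightarrow> wf_fm P {1..a} f \<Longrightarrow> md f \<le> n \<Longrightarrow>
    evaluates P a (judg n (fm_enc (dtype P {1..a} n M w)) (fm_enc f) (if sat M w f then 1 else 0))"
proof (induction f arbitrary: w n)
  case Top
  then show ?case using evaluates_Top[OF Top(1), of n] by (simp add: fm_enc_code(1) del: fm_enc.simps)
next
  case (Prop p)
  then have at: "pair (fm_enc (eps0 P (val P M w))) (pair (fm_enc (Prop p)) (if sat M w (Prop p) then 1 else 0)) \<in> atoms P"
    by (intro atomsI) auto
  show ?case
  proof (cases n)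
    case 0
    have "eval_step P a (list_encode []) (judg n (fm_enc (dtype P {1..a} n M w)) (fm_enc (Prop p)) (if sat M w (Prop p) then 1 else 0))"
      unfolding 0 dtype.simps using at by (rule eval_step_atom)
    then show ?thesis by (rule evaluates_I) simp
  next
    case (Suc m)
    obtain Ns us where node: "mkrel a (fm_enc (eps0 P (val P M w))) Ns (fm_enc (dtype P {1..a} (Suc m) M w))"
      "\<forall>y\<in>set us. evaluates P a y" "prem a (list_encode us) Ns m"
      using Prop(1) evaluates_Top by (rule evaluates_node')
    have "eval_step P a (list_encode us) (judg n (fm_enc (dtype P {1..a} n M w)) (fm_enc (Prop p)) (if sat M w (Prop p) then 1 else 0))"
      unfolding Suc using at node(1,3) by (rule eval_step_node)
    then show ?thesis using node(2)[rule_format] by (rule evaluates_I)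
  qed
next
  case (Neg f)
  have "evaluates P a (judg n (fm_enc (dtype P {1..a} n M w)) (fm_enc f) (if sat M w f then 1 else 0))"
    (is "evaluates P a ?j") using Neg by simp
  moreover have "eval_step P a (list_encode [?j]) (judg n (fm_enc (dtype P {1..a} n M w)) (cNeg (fm_enc f)) (1 - (if sat M w f then 1 else 0)))"
    by (rule eval_step_Neg) (simp del: list_encode.simps)
  ultimately show ?case using evaluates_I[of P a "[?j]"] by (auto simp: fm_enc_code(2) simp del: fm_enc.simps)
next
  case (Conj f g)
  let ?j = "judg n (fm_enc (dtype P {1..a} n M w)) (fm_enc f) (if sat M w f then 1 else 0)"
  let ?k = "judg n (fm_enc (dtype P {1..a} n M w)) (fm_enc g) (if sat M w g then 1 else 0)"
  let ?b = "if (if sat M w f then 1 else 0 :: nat) = 1 \<and> (if sat M w g then 1 else 0 :: nat) = 1 then 1 else 0 :: nat"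
  have jk: "evaluates P a ?j" "evaluates P a ?k" using Conj by simp_all
  have "eval_step P a (list_encode [?j, ?k]) (judg n (fm_enc (dtype P {1..a} n M w)) (cConj (fm_enc f) (fm_enc g)) ?b)"
    by (rule eval_step_Conj) (simp_all del: list_encode.simps)
  then have "evaluates P a (judg n (fm_enc (dtype P {1..a} n M w)) (cConj (fm_enc f) (fm_enc g)) ?b)"
  proof (rule evaluates_I)
    fix y assume "y \<in> set [?j, ?k]"
    then have "y = ?j \<or> y = ?k" by simp
    then show "evaluates P a y" using jk by (elim disjE) (simp_all only:)
  qed
  moreover have "?b = (if sat M w (Conj f g) then 1 else 0)" by simp
  ultimately show ?case by (simp only: fm_enc_code(3))
next
  case (Dia c k f)
  then obtain m where n: "n = Suc m" and m: "md f \<le> m" by (cases n) auto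
  obtain i where i: "c = Suc i" "i < a" using Dia.prems(2) by (cases c) auto
  have f: "wf_fm P {1..a} f" using Dia.prems(2) by simp
  note pm = Dia.prems(1)
  obtain L Ns us where node0: "\<forall>b<a. nthc Ns b = list_encode (map fm_enc (L b))"
    "\<forall>b<a. mset (L b) = image_mset (dtype P {1..a} m M) (mset_set (nbrs M (Suc b) w))"
    "mkrel a (fm_enc (eps0 P (val P M w))) Ns (fm_enc (dtype P {1..a} (Suc m) M w))"
    "\<forall>y\<in>set us. evaluates P a y" "\<forall>us'. set us \<subseteq> set us' \<longrightarrow> prem a (list_encode us') Ns m"
    using pm evaluates_Top by (rule evaluates_node)
  note node = node0[rule_format]
  \<comment> \<open>The truth value of \<open>f\<close> at \<open>w\<close> itself, taken at depth
    \<open>m\<close>, supplies the last premise of the diamond rule; unlike a successor,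
    \<open>w\<close> is always available.\<close>
  let ?j = "judg m (fm_enc (dtype P {1..a} m M w)) (fm_enc f) (if sat M w f then 1 else 0)"
  define bit where "bit s = (if type_sat P {1..a} m f s then 1 else 0 :: nat)" for s
  define Bs where "Bs = list_encode (map bit (L i))"
  define us' where "us' = us @ ?j # map (\<lambda>s. judg m (fm_enc s) (fm_enc f) (bit s)) (L i)"
  have "evaluates P a y" if "y \<in> set us'" for y
  proof -
    from that consider "y \<in> set us" | "y = ?j" | s where "s \<in> set (L i)" "y = judg m (fm_enc s) (fm_enc f) (bit s)"
      unfolding us'_def by auto
    then show ?thesis
    proof cases
      case 1 then show ?thesis by (rule node(4))
    next
      case 2 then show ?thesis using Dia.IH[OF pm f m] by simp
    next
      case 3
      have "s \<in># mset (L i)" using 3 by simp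
      then obtain v where v: "v \<in> nbrs M (Suc i) w" "s = dtype P {1..a} m M v"
        unfolding node(2)[OF i(2)] using finite_nbrs[OF pm] by auto
      then have "bit s = (if sat M v f then 1 else 0)"
        unfolding bit_def using type_sat_dtype[OF P finite_index pointed_nbrs[OF pm v(1)] m f] by simp
      then show ?thesis using Dia.IH[OF pointed_nbrs[OF pm v(1)] f m] 3 v by simp
    qed
  qed
  moreover have "eval_step P a (list_encode us') (judg (Suc m) (fm_enc (dtype P {1..a} (Suc m) M w)) (cDia (Suc i) k (fm_enc f)) (if k \<le> countc Bs 1 then 1 else 0))"
  proof -
    have "pair (fm_enc (eps0 P (val P M w))) (pair 0 1) \<in> atoms P"
      using atomsI[where f = Top and P = P and M = M and w = w] by (simp add: fm_enc_code(1) del: fm_enc.simps)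
    moreover have "prem a (list_encode us') Ns m" by (rule node(5)) (auto simp: us'_def)
    moreover have "lenc Bs = lenc (nthc Ns i)" by (simp add: Bs_def node(1)[OF i(2)])
    moreover have "\<forall>j<lenc (nthc Ns i). memc (judg m (nthc (nthc Ns i) j) (fm_enc f) (nthc Bs j)) (list_encode us')"
      by (auto simp: Bs_def node(1)[OF i(2)] us'_def)
    moreover have "memc ?j (list_encode us')" by (simp add: us'_def)
    ultimately show ?thesis by (intro eval_step_Dia[OF i(2) _ node(3)])
  qed
  ultimately have "evaluates P a (judg (Suc m) (fm_enc (dtype P {1..a} (Suc m) M w)) (cDia (Suc i) k (fm_enc f)) (if k \<le> countc Bs 1 then 1 else 0))"
    using evaluates_I by blast
  moreover have "countc Bs 1 = card {v \<in> nbrs M (Suc i) w. sat M v f}"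
    unfolding Bs_def countc_list_encode bit_def
    using count_indicator[of "type_sat P {1..a} m f" "L i"] card_sat_nbrs[OF P finite_index pm m f] node(2)[OF i(2)] by simp
  ultimately show ?case unfolding n i by (simp add: fm_enc_code(4) nbrs_def del: fm_enc.simps dtype.simps)
qed

lemma evaluates_iff:
  assumes "finite P"
  shows "evaluates P a (judg n t z b) \<longleftrightarrow> (\<exists>f (M :: nat kmodel) w. pointed_model P {1..a} M w \<and> wf_fm P {1..a} f \<and> md f \<le> n
    \<and> t = fm_enc (dtype P {1..a} n M w) \<and> z = fm_enc f \<and> b = (if sat M w f then 1 else 0))"
proof
  assume "evaluates P a (judg n t z b)"
  then have "valid P a (judg n t z b)" by (rule evaluates_sound[OF assms])
  then show "\<exists>f (M :: nat kmodel) w. pointed_model P {1..a} M w \<and> wf_fm P {1..a} f \<and> md f \<le> n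
    \<and> t = fm_enc (dtype P {1..a} n M w) \<and> z = fm_enc f \<and> b = (if sat M w f then 1 else 0)"
    by (rule validE) blast
next
  show "\<exists>f (M :: nat kmodel) w. pointed_model P {1..a} M w \<and> wf_fm P {1..a} f \<and> md f \<le> n
    \<and> t = fm_enc (dtype P {1..a} n M w) \<and> z = fm_enc f \<and> b = (if sat M w f then 1 else 0) \<Longrightarrow> evaluates P a (judg n t z b)"
    using evaluates_complete[OF assms] by blast
qed

section \<open>Inputs of mixed depth\<close>

text \<open>\<open>z\<close> codes \<open>k\<close> nested diamonds with threshold 1 around
  \<open>Top\<close>, a formula that says that a path of length \<open>k\<close> exists;
  \<open>Z\<close> lists the codes of its subformulae from the outside in.\<close>

definition chainrel :: "nat \<Rightarrow> nat \<Rightarrow> nat \<Rightarrow> bool" where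
  "chainrel a z k \<longleftrightarrow> (\<exists>Z. nthc Z k = 0 \<and> nthc Z 0 = z \<and>
     (\<forall>i<k. \<exists>b. b < a \<and> nthc Z i = cDia (Suc b) 1 (nthc Z (Suc i))))"

lemma chainrel_0: "chainrel a z 0 \<longleftrightarrow> z = 0"
proof
  assume "z = 0"
  then show "chainrel a z 0" unfolding chainrel_def by (intro exI[of _ "list_encode [0]"]) (simp del: list_encode.simps)
qed (auto simp: chainrel_def)

lemma chainrel_Suc: "chainrel a z (Suc k) \<longleftrightarrow> (\<exists>b z'. b < a \<and> z = cDia (Suc b) 1 z' \<and> chainrel a z' k)"
proof
  assume "chainrel a z (Suc k)"
  then obtain Z where Z: "nthc Z (Suc k) = 0" "nthc Z 0 = z"
    "\<forall>i<Suc k. \<exists>b. b < a \<and> nthc Z i = cDia (Suc b) 1 (nthc Z (Suc i))" unfolding chainrel_def by blast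
  obtain b where b: "b < a" "z = cDia (Suc b) 1 (nthc Z (Suc 0))" using Z(2,3) by auto
  define Z' where "Z' = list_encode (map (\<lambda>i. nthc Z (Suc i)) [0..<Suc k])"
  have Z': "nthc Z' i = nthc Z (Suc i)" if "i \<le> k" for i
    using that unfolding Z'_def by (subst nthc_list_encode) (simp_all del: upt_Suc)
  have "chainrel a (nthc Z (Suc 0)) k"
    unfolding chainrel_def by (rule exI[of _ Z']) (use Z Z' in auto)
  then show "\<exists>b z'. b < a \<and> z = cDia (Suc b) 1 z' \<and> chainrel a z' k" using b by blast
next
  assume "\<exists>b z'. b < a \<and> z = cDia (Suc b) 1 z' \<and> chainrel a z' k"
  then obtain b Z where b: "b < a" "z = cDia (Suc b) 1 (nthc Z 0)" and Z: "nthc Z k = 0"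
    "\<forall>i<k. \<exists>b. b < a \<and> nthc Z i = cDia (Suc b) 1 (nthc Z (Suc i))" unfolding chainrel_def by blast
  define Z' where "Z' = list_encode (z # map (nthc Z) [0..<Suc k])"
  have Z': "nthc Z' 0 = z" "\<And>i. i \<le> k \<Longrightarrow> nthc Z' (Suc i) = nthc Z i"
    unfolding Z'_def by (subst nthc_list_encode; simp del: upt_Suc)+
  have "\<exists>b. b < a \<and> nthc Z' i = cDia (Suc b) 1 (nthc Z' (Suc i))" if "i < Suc k" for i
    using that b Z(2) Z' by (cases i) auto
  then show "chainrel a z (Suc k)"
    unfolding chainrel_def by (intro exI[of _ Z']) (use Z Z' in auto)
qed

lemma chainrel_sound:
  "chainrel a z k \<Longrightarrow> \<exists>f. z = fm_enc f \<and> (\<forall>(M :: nat kmodel) w. sat M w f \<longrightarrow> haspath {1..a} k M w)"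
proof (induction k arbitrary: z)
  case 0
  then show ?case by (intro exI[of _ Top]) (simp add: chainrel_0 fm_enc_code(1) del: fm_enc.simps)
next
  case (Suc k)
  then obtain b z' where b: "b < a" "z = cDia (Suc b) 1 z'" "chainrel a z' k" unfolding chainrel_Suc by blast
  from Suc.IH[OF b(3)] obtain f where f: "z' = fm_enc f" "\<forall>(M :: nat kmodel) w. sat M w f \<longrightarrow> haspath {1..a} k M w"
    by blast
  have "haspath {1..a} (Suc k) M w" if "sat M w (Dia (Suc b) 1 f)" for M :: "nat kmodel" and w
  proof -
    have "{v. (w, v) \<in> mR M (Suc b) \<and> sat M v f} \<noteq> {}"
    proof
      assume e: "{v. (w, v) \<in> mR M (Suc b) \<and> sat M v f} = {}"
      show False using that unfolding sat.simps e by simp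
    qed
    then obtain v where "v \<in> nbrs M (Suc b) w" "sat M v f" by (auto simp: nbrs_def)
    then show ?thesis using f(2) b(1) unfolding haspath.simps
      by (intro bexI[of "\<lambda>c. \<exists>v\<in>nbrs M c w. _ v" "Suc b"] bexI[of _ v "nbrs M (Suc b) w"]) auto
  qed
  then show ?case using b(2) f(1) by (intro exI[of _ "Dia (Suc b) 1 f"]) (simp add: fm_enc_code(4) del: fm_enc.simps sat.simps haspath.simps)
qed

lemma chainrel_complete:
  fixes M :: "nat kmodel"
  shows "pointed_model P {1..a} M w \<Longrightarrow> haspath {1..a} k M w \<Longrightarrow>
    \<exists>f. chainrel a (fm_enc f) k \<and> wf_fm P {1..a} f \<and> md f = k \<and> sat M w f"
proof (induction k arbitrary: w)
  case 0
  then show ?case by (intro exI[of _ Top]) (simp add: chainrel_0 fm_enc_code(1) del: fm_enc.simps)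
next
  case (Suc k)
  then obtain c v where c: "c \<in> {1..a}" "v \<in> nbrs M c w" "haspath {1..a} k M v" by auto
  then obtain b where b: "c = Suc b" "b < a" by (cases c) auto
  from Suc.IH[OF pointed_nbrs[OF Suc.prems(1) c(2)] c(3)] obtain f where
    f: "chainrel a (fm_enc f) k" "wf_fm P {1..a} f" "md f = k" "sat M v f" by blast
  \<comment> \<open>Finiteness matters, as the cardinality of an infinite set would be 0.\<close>
  have "finite {v. (w, v) \<in> mR M c \<and> sat M v f}"
    using finite_nbrs[OF Suc.prems(1), of c] by (rule finite_subset[rotated]) (auto simp: nbrs_def)
  moreover have "v \<in> {v. (w, v) \<in> mR M c \<and> sat M v f}" using c(2) f(4) by (simp add: nbrs_def)
  ultimately have "1 \<le> card {v. (w, v) \<in> mR M c \<and> sat M v f}" by (auto simp: Suc_le_eq card_gt_0_iff)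
  then have "sat M w (Dia c 1 f)" by simp
  moreover have "chainrel a (fm_enc (Dia c 1 f)) (Suc k)"
    unfolding chainrel_Suc fm_enc_code(4) b(1) using b(2) f(1) by blast
  ultimately show ?case using f c(1) by (intro exI[of _ "Dia c 1 f"]) (simp del: fm_enc.simps sat.simps)
qed

definition pathc :: "nat set \<Rightarrow> nat \<Rightarrow> nat \<Rightarrow> nat \<Rightarrow> nat \<Rightarrow> bool" where
  "pathc P a n t k \<longleftrightarrow> (\<exists>z. chainrel a z k \<and> evaluates P a (judg n t z 1))"

text \<open>The path formula of length \<open>k\<close> has modal depth \<open>k\<close>, so
  \<open>k \<le> n\<close> keeps it among the formulae that types of depth \<open>n\<close>
  decide.\<close>

lemma pathc_iff:
  assumes "finite P" "k \<le> n"
  shows "pathc P a n t k \<longleftrightarrow> (\<exists>(M :: nat kmodel) w. pointed_model P {1..a} M w \<and>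
    t = fm_enc (dtype P {1..a} n M w) \<and> haspath {1..a} k M w)"
proof
  assume "pathc P a n t k"
  then obtain z where z: "chainrel a z k" "evaluates P a (judg n t z 1)" unfolding pathc_def by blast
  from z(2) obtain f and M :: "nat kmodel" and w where M: "pointed_model P {1..a} M w"
    "t = fm_enc (dtype P {1..a} n M w)" "z = fm_enc f" "1 = (if sat M w f then 1 else (0::nat))"
    unfolding evaluates_iff[OF assms(1)] by blast
  have "sat M w f" using M(4) by (simp split: if_splits)
  then have "haspath {1..a} k M w" using chainrel_sound[OF z(1)] M(3) by (auto simp: fm_enc_eq_iff)
  then show "\<exists>(M :: nat kmodel) w. pointed_model P {1..a} M w \<and>
    t = fm_enc (dtype P {1..a} n M w) \<and> haspath {1..a} k M w" using M by blast
next
  assume "\<exists>(M :: nat kmodel) w. pointed_model P {1..a} M w \<and>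
    t = fm_enc (dtype P {1..a} n M w) \<and> haspath {1..a} k M w"
  then obtain M :: "nat kmodel" and w where M: "pointed_model P {1..a} M w"
    "t = fm_enc (dtype P {1..a} n M w)" "haspath {1..a} k M w" by blast
  from chainrel_complete[OF M(1,3)] obtain f where
    f: "chainrel a (fm_enc f) k" "wf_fm P {1..a} f" "md f = k" "sat M w f" by blast
  have "evaluates P a (judg n t (fm_enc f) 1)"
    using evaluates_complete[OF assms(1) M(1) f(2), of n] f(3,4) assms(2) M(2) by simp
  then show "pathc P a n t k" unfolding pathc_def using f(1) by blast
qed

lemma haspath_mono: "haspath I n M w \<Longrightarrow> k \<le> n \<Longrightarrow> haspath I k M w"
proof (induction n arbitrary: w k)
  case (Suc n)
  show ?case
  proof (cases k)
    case (Suc j)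
    then show ?thesis using Suc.prems Suc.IH by auto
  qed simp
qed simp

text \<open>Fix a depth and a realization for each type. If none had a path as long as its depth,
  all types would be stable from there on and hence share the maximal depth. So some
  \<open>s\<close> has such a path, at depth \<open>nn s\<close>. A type \<open>s'\<close> that is
  not of this depth has a path as long as the smaller of the two depths, or it would be stable
  between them and be of depth \<open>nn s\<close> after all.\<close>

lemma nonuniform_witness:
  assumes P: "finite P" and I: "finite I" and X: "finite X" "X \<subseteq> (\<Union>n. dtypes P I n)" and no: "\<And>n. \<not> X \<subseteq> dtypes P I n"
  obtains n n' and M M' :: "nat kmodel" and w w' where "pointed_model P I M w" "pointed_model P I M' w'"
    "dtype P I n M w \<in> X" "dtype P I n' M' w' \<in> X" "n \<noteq> n'" "haspath I n M w" "haspath I (min n n') M' w'"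
proof -
  have "\<forall>s\<in>X. \<exists>n (M :: nat kmodel) w. pointed_model P I M w \<and> s = dtype P I n M w"
  proof
    fix s assume "s \<in> X"
    then obtain n where "s \<in> dtypes P I n" using X(2) by blast
    then show "\<exists>n (M :: nat kmodel) w. pointed_model P I M w \<and> s = dtype P I n M w"
      unfolding dtypes_def by auto
  qed
  then obtain nn and MM :: "fm \<Rightarrow> nat kmodel" and ww where
    r: "\<forall>s\<in>X. pointed_model P I (MM s) (ww s) \<and> s = dtype P I (nn s) (MM s) (ww s)" by metis
  have "\<exists>s\<in>X. haspath I (nn s) (MM s) (ww s)"
  proof (rule ccontr)
    assume none: "\<not> (\<exists>s\<in>X. haspath I (nn s) (MM s) (ww s))"
    have "s \<in> dtypes P I (Max (nn ` X))" if s: "s \<in> X" for s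
    proof -
      have "nn s \<le> Max (nn ` X)" using X(1) s by simp
      then have "dtype P I (Max (nn ` X)) (MM s) (ww s) = s"
        using dtype_stable[OF P I, of "MM s" "ww s" "nn s"] r none s by metis
      then show ?thesis using dtype_in_dtypes[of P I "MM s" "ww s" "Max (nn ` X)"] r s by simp
    qed
    then show False using no by blast
  qed
  then obtain s where s: "s \<in> X" "haspath I (nn s) (MM s) (ww s)" by blast
  obtain s' where s': "s' \<in> X" "s' \<notin> dtypes P I (nn s)" using no by blast
  have ne: "nn s \<noteq> nn s'" using s' r dtype_in_dtypes by metis
  have "haspath I (min (nn s) (nn s')) (MM s') (ww s')"
  proof (rule ccontr)
    assume "\<not> ?thesis"
    then have "dtype P I (nn s) (MM s') (ww s') = dtype P I (nn s') (MM s') (ww s')"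
      using dtype_stable[OF P I, of "MM s'" "ww s'" "min (nn s) (nn s')"] r s'(1) by (metis min.cobounded1 min.cobounded2)
    then show False using s' r dtype_in_dtypes by metis
  qed
  then show thesis using that[of "MM s" "ww s" "MM s'" "ww s'" "nn s" "nn s'"] s s' ne r by auto
qed

text \<open>By its path of length \<open>n\<close>, the first type is of depth \<open>n\<close>
  only, so the common depth \<open>m\<close> equals \<open>n\<close>; the shorter path then forces
  \<open>n' = m\<close> as well.\<close>

lemma uniform_no_witness:
  fixes M M' :: "nat kmodel"
  assumes P: "finite P" and I: "finite I" "I \<noteq> {}" and pm: "pointed_model P I M w" "pointed_model P I M' w'"
    and X: "dtype P I n M w \<in> dtypes P I m" "dtype P I n' M' w' \<in> dtypes P I m"
    and hp: "haspath I n M w" "haspath I (min n n') M' w'"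
  shows "n = n'"
proof -
  obtain M2 :: "nat kmodel" and w2 where 2: "pointed_model P I M2 w2" "dtype P I n M w = dtype P I m M2 w2"
    using X(1) by (auto simp: dtypes_def)
  have "n = m" using dtype_depth_unique[OF P I pm(1) 2] haspath_mono[OF hp(1)] by simp
  obtain M3 :: "nat kmodel" and w3 where 3: "pointed_model P I M3 w3" "dtype P I n' M' w' = dtype P I m M3 w3"
    using X(2) by (auto simp: dtypes_def)
  have "n' = m" using dtype_depth_unique[OF P I pm(2) 3] hp(2) \<open>n = m\<close> by (simp add: min.commute)
  then show ?thesis using \<open>n = m\<close> by simp
qed

section \<open>The automaton and the class it recognizes\<close>

definition entries :: "nat set \<Rightarrow> (nat \<Rightarrow> fm multiset) \<Rightarrow> fm \<Rightarrow> fm set" where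
  "entries I N t = insert t (\<Union>b\<in>I. set_mset (N b))"

definition step_type :: "nat set \<Rightarrow> nat set \<Rightarrow> (nat \<Rightarrow> fm multiset) \<Rightarrow> fm \<Rightarrow> fm" where
  "step_type P I N t = cconj ({typ0 P t}
     \<union> {diaeq a k s | a k s. a \<in> I \<and> 1 \<le> k \<and> k \<le> size (N a) \<and> count (N a) s = k}
     \<union> {diaeq a (size (N a)) Top | a. a \<in> I})"

text \<open>Inputs of mixed depth must still be sent to types, computably; keeping the own state serves the purpose.\<close>

definition type_delta :: "nat set \<Rightarrow> nat set \<Rightarrow> (nat \<Rightarrow> fm multiset) \<Rightarrow> fm \<Rightarrow> fm" where
  "type_delta P I N t = (if \<exists>n. entries I N t \<subseteq> dtypes P I n then step_type P I N t else t)"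

lemma step_type_dtype:
  assumes "finite P" "finite I" "pointed_model P I M w"
  shows "step_type P I N (dtype P I n M w) = type_of_succs P I (val P M w) N"
  unfolding step_type_def typ0_dtype[OF assms] type_of_succs_def conjuncts_of_succs_eq ..

lemma step_type_in_dtypes:
  assumes P: "finite P" and I: "finite I" and "entries I N t \<subseteq> dtypes P I n"
  shows "step_type P I N t \<in> dtypes P I (Suc n)"
proof -
  have "t \<in> dtypes P I n" and N: "\<And>b. b \<in> I \<Longrightarrow> set_mset (N b) \<subseteq> dtypes P I n"
    using assms(3) by (auto simp: entries_def)
  then obtain M :: "nat kmodel" and w where t: "t = dtype P I n M w" "pointed_model P I M w"
    by (auto simp: dtypes_def)
  obtain M' :: "nat kmodel" and w' where M': "pointed_model P I M' w'" "val P M' w' = val P M w"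
    "\<forall>b\<in>I. image_mset (dtype P I n M') (mset_set (nbrs M' b w')) = N b"
    using I Collect_subset N by (rule join_model)
  have "step_type P I N t = dtype P I (Suc n) M' w'"
    unfolding t(1) step_type_dtype[OF P I t(2)] dtype.simps M'(2)
    by (rule type_of_succs_cong) (rule M'(3)[rule_format, symmetric])
  then show ?thesis using dtype_in_dtypes[OF M'(1)] by metis
qed

definition accepting :: "nat set \<Rightarrow> nat set \<Rightarrow> fm set \<Rightarrow> fm set" where
  "accepting P I S = {t. \<exists>n (M :: nat kmodel) w f. pointed_model P I M w \<and> f \<in> S \<and> md f \<le> n \<and>
     t = dtype P I n M w \<and> sat M w f}"

abbreviation full_type_automaton :: "nat set \<Rightarrow> nat set \<Rightarrow> fm set \<Rightarrow> fm cmmpa" where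
  "full_type_automaton P I S \<equiv> (eps0 P, type_delta P I, accepting P I S)"

lemma Types_eq: "finite P \<Longrightarrow> finite I \<Longrightarrow> Types P I = (\<Union>n. dtypes P I n)"
  by (simp add: Types_def FT_eq_dtypes)

lemma type_automaton_full_type_automaton:
  assumes P: "finite P" and I: "finite I"
  shows "type_automaton P I (full_type_automaton P I S)"
  unfolding type_automaton_def prod.case
proof (intro conjI allI impI)
  show "accepting P I S \<subseteq> Types P I"
  proof
    fix t assume "t \<in> accepting P I S"
    then obtain n and M :: "nat kmodel" and w where "pointed_model P I M w" "t = dtype P I n M w"
      unfolding accepting_def by auto
    then show "t \<in> Types P I" unfolding Types_eq[OF P I] using dtype_in_dtypes[of P I M w n] by auto
  qed
next
  fix N t assume t: "t \<in> Types P I \<and> (\<forall>a\<in>I. set_mset (N a) \<subseteq> Types P I)"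
  show "type_delta P I N t \<in> Types P I"
  proof (cases "\<exists>n. entries I N t \<subseteq> dtypes P I n")
    case True
    then show ?thesis using step_type_in_dtypes[OF P I] unfolding type_delta_def Types_eq[OF P I] by auto
  next
    case False
    then show ?thesis using t unfolding type_delta_def by simp
  qed
next
  fix N t n assume "t \<in> FT P I n \<and> (\<forall>a\<in>I. set_mset (N a) \<subseteq> FT P I n)"
  then have "entries I N t \<subseteq> dtypes P I n" unfolding FT_eq_dtypes[OF P I] entries_def by auto
  then show "type_delta P I N t = cconj ({typ0 P t}
     \<union> {diaeq a k s | a k s. a \<in> I \<and> 1 \<le> k \<and> k \<le> size (N a) \<and> count (N a) s = k}
     \<union> {diaeq a (size (N a)) Top | a. a \<in> I})"
    unfolding type_delta_def step_type_def by auto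
qed simp

lemma run_full_type_automaton:
  assumes P: "finite P" and I: "finite I"
  shows "pointed_model P I M w \<Longrightarrow> run (full_type_automaton P I S) P I M n w = dtype P I n M w"
proof (induction n arbitrary: w)
  case (Suc n)
  let ?N = "\<lambda>a. if a \<in> I then image_mset (run (full_type_automaton P I S) P I M n) (mset_set (nbrs M a w)) else {#}"
  have N: "image_mset (run (full_type_automaton P I S) P I M n) (mset_set (nbrs M a w)) = image_mset (dtype P I n M) (mset_set (nbrs M a w))" for a
    by (rule image_mset_cong) (use Suc.IH pointed_nbrs[OF Suc.prems] finite_nbrs[OF Suc.prems] in simp)
  have "set_mset (?N a) \<subseteq> dtypes P I n" if "a \<in> I" for a
    using that N dtype_in_dtypes[OF pointed_nbrs[OF Suc.prems]] finite_nbrs[OF Suc.prems] by auto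
  then have "entries I ?N (dtype P I n M w) \<subseteq> dtypes P I n"
    unfolding entries_def using dtype_in_dtypes[OF Suc.prems] by blast
  then have "type_delta P I ?N (dtype P I n M w) = step_type P I ?N (dtype P I n M w)"
    unfolding type_delta_def by auto
  also have "\<dots> = type_of_succs P I (val P M w) ?N" by (rule step_type_dtype[OF P I Suc.prems])
  also have "\<dots> = dtype P I (Suc n) M w" unfolding dtype.simps by (rule type_of_succs_cong) (simp add: N)
  finally show ?case using Suc.IH[OF Suc.prems] by simp
qed simp

lemma recognizes_full_type_automaton:
  assumes P: "finite P" and I: "finite I" and S: "disj_defines P I S K"
  shows "recognizes (full_type_automaton P I S) P I K"
  unfolding recognizes_def
proof (intro allI impI)
  fix M :: "'a kmodel" and w assume pm: "pointed_model P I M w"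
  \<comment> \<open>Accepting states are described through models over \<open>nat\<close>, so the
    given point is replaced by a copy there.\<close>
  obtain M0 :: "nat kmodel" and w0 where M0: "pointed_model P I M0 w0"
    "\<And>n. dtype P I n M0 w0 = dtype P I n M w" "\<And>f. sat M0 w0 f \<longleftrightarrow> sat M w f"
    using pm by (rule nat_copy) (rule that)
  have wf: "wf_fm P I f" if "f \<in> S" for f using S that by (simp add: disj_defines_def)
  have K: "(M, w) \<in> K \<longleftrightarrow> (\<exists>f\<in>S. sat M w f)" using S pm by (simp add: disj_defines_def)
  have acc: "accepts (full_type_automaton P I S) P I M w \<longleftrightarrow> (\<exists>n. dtype P I n M0 w0 \<in> accepting P I S)"
    unfolding accepts_def run_full_type_automaton[OF P I pm] M0(2) by simp
  show "accepts (full_type_automaton P I S) P I M w \<longleftrightarrow> (M, w) \<in> K"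
  proof
    assume "accepts (full_type_automaton P I S) P I M w"
    then obtain n where "dtype P I n M0 w0 \<in> accepting P I S" unfolding acc by blast
    then obtain m f and M1 :: "nat kmodel" and w1 where 1: "pointed_model P I M1 w1" "f \<in> S" "md f \<le> m"
      "dtype P I n M0 w0 = dtype P I m M1 w1" "sat M1 w1 f"
      unfolding accepting_def mem_Collect_eq by blast
    have "sat M0 w0 (dtype P I m M1 w1)" using sat_dtype[OF P I M0(1) M0(1), of n] 1(4) by simp
    then have "dtype P I m M0 w0 = dtype P I m M1 w1" using sat_dtype[OF P I M0(1) 1(1)] by simp
    then have "sat M0 w0 f" using dtype_determines_sat[OF P I M0(1) 1(1,3) _ wf[OF 1(2)]] 1(5) by simp
    then show "(M, w) \<in> K" using K M0(3) 1(2) by blast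
  next
    assume "(M, w) \<in> K"
    then obtain f where f: "f \<in> S" "sat M0 w0 f" using K M0(3) by blast
    \<comment> \<open>Round \<open>md f\<close> is late enough, since the type then decides
      \<open>f\<close>.\<close>
    then have "dtype P I (md f) M0 w0 \<in> accepting P I S" unfolding accepting_def using M0(1) by blast
    then show "accepts (full_type_automaton P I S) P I M w" unfolding acc by blast
  qed
qed

section \<open>Enumerability of the accepting states and computability of the transitions\<close>

text \<open>A code is accepting if, for some depth and some member of \<open>S\<close>, evaluation
  to true is derivable; the bound \<open>md f \<le> n\<close> is built into derivable
  judgements.\<close>

lemma re_set_accepting:
  assumes P: "finite P" and wf: "\<forall>f\<in>S. wf_fm P {1..a} f" and S: "re_set (fm_enc ` S)"
  shows "re_set (fm_enc ` accepting P {1..a} S)"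
proof -
  have Ss: "semidec (\<lambda>x. x \<in> fm_enc ` S)" using S by (simp add: re_set_iff_semidec)
  have "semidec (\<lambda>x. \<exists>n z. z \<in> fm_enc ` S \<and> evaluates P a (judg n x z 1))"
    by (intro semidec_compose[OF Ss] semidec_intros semidec_evaluates[OF P] computable_judg)
  then have "re_set {x. \<exists>n z. z \<in> fm_enc ` S \<and> evaluates P a (judg n x z 1)}" by (rule re_set_semidec)
  moreover have "{x. \<exists>n z. z \<in> fm_enc ` S \<and> evaluates P a (judg n x z 1)} = fm_enc ` accepting P {1..a} S"
  proof (intro set_eqI iffI)
    fix x assume "x \<in> {x. \<exists>n z. z \<in> fm_enc ` S \<and> evaluates P a (judg n x z 1)}"
    then obtain n f where f: "f \<in> S" "evaluates P a (judg n x (fm_enc f) 1)" by auto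
    from f(2) obtain g and M :: "nat kmodel" and w where M: "pointed_model P {1..a} M w" "md g \<le> n"
      "x = fm_enc (dtype P {1..a} n M w)" "fm_enc f = fm_enc g" "1 = (if sat M w g then 1 else (0::nat))"
      unfolding evaluates_iff[OF P] by blast
    have "g = f" "sat M w g" using M(4,5) by (simp_all add: fm_enc_eq_iff split: if_splits)
    then show "x \<in> fm_enc ` accepting P {1..a} S" unfolding accepting_def using M f(1) by blast
  next
    fix x assume "x \<in> fm_enc ` accepting P {1..a} S"
    then obtain n f and M :: "nat kmodel" and w where M: "pointed_model P {1..a} M w" "f \<in> S" "md f \<le> n"
      "x = fm_enc (dtype P {1..a} n M w)" "sat M w f" unfolding accepting_def by blast
    have "evaluates P a (judg n x (fm_enc f) 1)" using evaluates_complete[OF P M(1) bspec[OF wf M(2)] M(3)] M(4,5) by simp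
    then show "x \<in> {x. \<exists>n z. z \<in> fm_enc ` S \<and> evaluates P a (judg n x z 1)}" using M(2) by blast
  qed
  ultimately show ?thesis by simp
qed

lemma wf_conj_list: "(\<And>f. f \<in> set fs \<Longrightarrow> wf_fm P I f) \<Longrightarrow> wf_fm P I (conj_list fs)"
  by (induction fs rule: conj_list.induct) auto

text \<open>Depth-0 types are themselves evaluated as formulae when the transition function looks
  for the depth-0 part of a state.\<close>

lemma wf_eps0:
  assumes "finite P"
  shows "wf_fm P I (eps0 P E)"
  unfolding eps0_def cconj_def
proof (rule wf_conj_list)
  fix f assume "f \<in> set (map (the_inv fm_enc) (sorted_list_of_set (fm_enc ` (\<lambda>p. if p \<in> E then Prop p else Neg (Prop p)) ` P)))"
  then have "f \<in> (\<lambda>p. if p \<in> E then Prop p else Neg (Prop p)) ` P"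
    using set_map_the_inv_fm_enc[OF finite_imageI[OF assms]] by metis
  then show "wf_fm P I f" by (auto split: if_splits simp del: if_image_distrib)
qed

text \<open>In an input code, component \<open>b < a\<close> holds the multiset for label
  \<open>Suc b\<close>, and component \<open>a\<close> the own state.\<close>

definition entryc :: "nat \<Rightarrow> nat \<Rightarrow> nat \<Rightarrow> bool" where
  "entryc a s x \<longleftrightarrow> s = nthc x a \<or> (\<exists>b. b < a \<and> memc s (nthc x b))"

text \<open>Here \<open>n - (n - n')\<close> is the minimum of \<open>n\<close> and \<open>n'\<close>. The entry \<open>s\<close>, realized
  above a path of length \<open>n\<close>, is a type of depth \<open>n\<close> only, and \<open>s'\<close> is not a type of depth \<open>n\<close>
  because of the path of length \<open>min n n'\<close>.\<close>

definition mixedc :: "nat set \<Rightarrow> nat \<Rightarrow> nat \<Rightarrow> bool" where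
  "mixedc P a x \<longleftrightarrow> (\<exists>s s' n n'. entryc a s x \<and> entryc a s' x \<and> n \<noteq> n' \<and> pathc P a n s n \<and> pathc P a n' s' (n - (n - n')))"

text \<open>The depth-0 part of the own state is found by evaluation and not by parsing: it is the
  depth-0 type \<open>e\<close> that is true there.\<close>

definition uniformc :: "nat set \<Rightarrow> nat \<Rightarrow> nat \<Rightarrow> nat \<Rightarrow> bool" where
  "uniformc P a x y \<longleftrightarrow> (\<exists>n e. pair e (pair 0 1) \<in> atoms P \<and> evaluates P a (judg n (nthc x a) e 1) \<and>
     (\<forall>b<a. \<forall>j<lenc (nthc x b). evaluates P a (judg n (nthc (nthc x b) j) 0 1)) \<and> mkrel a e x y)"

lemma semidec_deltac:
  assumes P: "finite P"
  shows "semidec (\<lambda>p. uniformc P a (pfst p) (psnd p) \<or> (mixedc P a (pfst p) \<and> psnd p = nthc (pfst p) a))"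
  unfolding uniformc_def mixedc_def entryc_def pathc_def chainrel_def
  by (intro semidec_finite[OF finite_atoms[OF P]] semidec_intros semidec_memc semidec_mkrel semidec_evaluates[OF P] computable_judg computable_cDia)

lemma input_lists:
  obtains L where "\<forall>b<a. nthc (input_enc a N t) b = list_encode (map fm_enc (L b))"
    "\<forall>b<a. mset (L b) = N (Suc b)" "nthc (input_enc a N t) a = fm_enc t"
proof -
  define L where "L b = map (the_inv fm_enc) (sorted_list_of_multiset (image_mset fm_enc (N (Suc b))))" for b
  have "nthc (input_enc a N t) b = list_encode (map fm_enc (L b))" if "b < a" for b
  proof -
    have "nthc (input_enc a N t) b = ms_enc (N (Suc b))"
      unfolding input_enc_def using that by (subst nthc_list_encode) (simp_all add: nth_append del: upt_Suc)
    moreover have "map fm_enc (L b) = map (\<lambda>x. x) (sorted_list_of_multiset (image_mset fm_enc (N (Suc b))))"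
      unfolding L_def map_map by (rule map_cong) (auto simp: the_inv_f_f[OF inj_fm_enc])
    ultimately show ?thesis by (simp add: ms_enc_def)
  qed
  moreover have "mset (L b) = N (Suc b)" for b
  proof -
    have "the_inv fm_enc \<circ> fm_enc = id" by (simp add: fun_eq_iff the_inv_f_f[OF inj_fm_enc])
    then show ?thesis by (simp add: L_def multiset.map_comp)
  qed
  moreover have "nthc (input_enc a N t) a = fm_enc t"
    unfolding input_enc_def by (subst nthc_list_encode) (simp_all add: nth_append del: upt_Suc)
  ultimately show thesis using that by blast
qed

text \<open>On inputs made of types exactly one of two semidecidable alternatives holds, a common
  depth or conflicting depths. Together they describe the graph of the transition function, so a
  search for a value always ends. Positivity of \<open>a\<close> enters through the uniqueness of
  the depth.\<close>

lemma deltac_correct: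
  assumes P: "finite P" and a: "0 < a" and t: "t \<in> Types P {1..a}" and N: "\<forall>b\<in>{1..a}. set_mset (N b) \<subseteq> Types P {1..a}"
  shows "uniformc P a (input_enc a N t) y \<or> (mixedc P a (input_enc a N t) \<and> y = nthc (input_enc a N t) a)
    \<longleftrightarrow> y = fm_enc (type_delta P {1..a} N t)"
proof -
  let ?I = "{1..a}" and ?x = "input_enc a N t"
  let ?X = "entries ?I N t"
  obtain L where L: "\<forall>b<a. nthc ?x b = list_encode (map fm_enc (L b))" "\<forall>b<a. mset (L b) = N (Suc b)"
    and xa: "nthc ?x a = fm_enc t" by (rule input_lists)
  have setL: "set (L b) = set_mset (N (Suc b))" if "b < a" for b using L(2) that by (metis set_mset_mset)
  have entry: "entryc a s ?x \<longleftrightarrow> s \<in> fm_enc ` ?X" for s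
  proof -
    have "(\<exists>b. b < a \<and> memc s (nthc ?x b)) \<longleftrightarrow> (\<exists>b. b < a \<and> s \<in> fm_enc ` set_mset (N (Suc b)))"
      using L(1) setL by auto
    also have "\<dots> \<longleftrightarrow> (\<exists>b\<in>?I. s \<in> fm_enc ` set_mset (N b))"
    proof -
      have I: "?I = Suc ` {..<a}" by (simp add: image_Suc_lessThan)
      show ?thesis unfolding I by auto
    qed
    finally show ?thesis unfolding entryc_def xa entries_def by auto
  qed
  have X: "finite ?X" "?X \<subseteq> (\<Union>n. dtypes P ?I n)"
    using t N unfolding Types_eq[OF P finite_index] entries_def by auto
  have uniform: "uniformc P a ?x y \<longleftrightarrow> (\<exists>n. ?X \<subseteq> dtypes P ?I n) \<and> y = fm_enc (step_type P ?I N t)" for y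
  proof
    assume "uniformc P a ?x y"
    then obtain n e where n: "pair e (pair 0 1) \<in> atoms P" "evaluates P a (judg n (fm_enc t) e 1)"
      "\<forall>b<a. \<forall>j<lenc (nthc ?x b). evaluates P a (judg n (nthc (nthc ?x b) j) 0 1)" "mkrel a e ?x y"
      unfolding uniformc_def xa by blast
    from n(1) obtain E where E: "E \<subseteq> P" "e = fm_enc (eps0 P E)" by (rule atomsE[where I = ?I])
    from n(2) obtain f and M :: "nat kmodel" and w where M: "pointed_model P ?I M w"
      "fm_enc t = fm_enc (dtype P ?I n M w)" "e = fm_enc f" "1 = (if sat M w f then 1 else (0::nat))"
      unfolding evaluates_iff[OF P] by blast
    have tM: "t = dtype P ?I n M w" using M(2) by (simp only: fm_enc_eq_iff)
    have "f = eps0 P E" using M(3) E(2) by (simp only: fm_enc_eq_iff)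
    moreover have "sat M w f" using M(4) by (cases "sat M w f") simp_all
    \<comment> \<open>Only one depth-0 type holds at a point, so truth of \<open>e\<close>
      identifies it as the depth-0 part of \<open>t\<close>.\<close>
    ultimately have EM: "E = val P M w" using sat_eps0[OF P E(1), of M w] by simp
    have "s \<in> dtypes P ?I n" if b: "b < a" and s: "s \<in> set (L b)" for b s
    proof -
      obtain j where "j < length (L b)" "L b ! j = s" using s by (auto simp: in_set_conv_nth)
      then have "evaluates P a (judg n (fm_enc s) 0 1)" using n(3) L(1) b by auto
      then obtain M :: "nat kmodel" and w where "pointed_model P ?I M w" "fm_enc s = fm_enc (dtype P ?I n M w)"
        unfolding evaluates_iff[OF P] by blast
      then show ?thesis using dtype_in_dtypes by (metis fm_enc_eq_iff)
    qed
    then have L_dtypes: "set (L b) \<subseteq> dtypes P ?I n" if "b < a" for b using that by blast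
    have "set_mset (N b) \<subseteq> dtypes P ?I n" if "b \<in> ?I" for b
      using setL[of "b - 1"] L_dtypes[of "b - 1"] that by (cases b) auto
    then have "?X \<subseteq> dtypes P ?I n" unfolding entries_def using tM dtype_in_dtypes[OF M(1)] by blast
    moreover have "y = fm_enc (step_type P ?I N t)"
      unfolding tM step_type_dtype[OF P finite_index M(1)]
      using n(4) mkrel_fm_enc[of a ?x L N P E y] L unfolding E(2) EM by simp
    ultimately show "(\<exists>n. ?X \<subseteq> dtypes P ?I n) \<and> y = fm_enc (step_type P ?I N t)" by blast
  next
    assume "(\<exists>n. ?X \<subseteq> dtypes P ?I n) \<and> y = fm_enc (step_type P ?I N t)"
    then obtain n where n: "?X \<subseteq> dtypes P ?I n" and y: "y = fm_enc (step_type P ?I N t)" by blast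
    then obtain M :: "nat kmodel" and w where M: "pointed_model P ?I M w" "t = dtype P ?I n M w"
      unfolding entries_def dtypes_def by auto
    let ?e = "fm_enc (eps0 P (val P M w))"
    have "pair ?e (pair 0 1) \<in> atoms P"
      using atomsI[where f = Top and P = P and M = M and w = w] by (simp add: fm_enc_code(1) del: fm_enc.simps)
    moreover have "evaluates P a (judg n (fm_enc t) ?e 1)"
    proof -
      have "wf_fm P ?I (eps0 P (val P M w))" "md (eps0 P (val P M w)) \<le> n" "sat M w (eps0 P (val P M w))"
        using P md_eps0[OF P] by (simp_all add: wf_eps0 sat_eps0[OF P Collect_subset])
      then show ?thesis using evaluates_complete[OF P M(1), of "eps0 P (val P M w)" n] M(2) by simp
    qed
    moreover have "\<forall>b<a. \<forall>j<lenc (nthc ?x b). evaluates P a (judg n (nthc (nthc ?x b) j) 0 1)"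
    proof (intro allI impI)
      fix b j assume b: "b < a" and j: "j < lenc (nthc ?x b)"
      then have j': "j < length (L b)" "nthc (nthc ?x b) j = fm_enc (L b ! j)" using L(1) by auto
      then have "L b ! j \<in># N (Suc b)" using setL[OF b] by (metis nth_mem)
      moreover have "Suc b \<in> ?I" using b by simp
      ultimately have "L b ! j \<in> dtypes P ?I n" using n unfolding entries_def by blast
      then obtain M' :: "nat kmodel" and w' where "pointed_model P ?I M' w'" "L b ! j = dtype P ?I n M' w'"
        by (auto simp: dtypes_def)
      then show "evaluates P a (judg n (nthc (nthc ?x b) j) 0 1)" using evaluates_Top j'(2) by metis
    qed
    moreover have "mkrel a ?e ?x y"
      using mkrel_fm_enc[of a ?x L N P "val P M w" y] L y step_type_dtype[OF P finite_index M(1)] M(2) by simp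
    ultimately show "uniformc P a ?x y" unfolding uniformc_def xa by blast
  qed
  have mixed: "mixedc P a ?x \<longleftrightarrow> \<not> (\<exists>n. ?X \<subseteq> dtypes P ?I n)"
  proof
    assume "mixedc P a ?x"
    then obtain s s' n n' where s: "s \<in> ?X" "s' \<in> ?X" "n \<noteq> n'" "pathc P a n (fm_enc s) n"
      "pathc P a n' (fm_enc s') (n - (n - n'))" unfolding mixedc_def entry by blast
    have min: "n - (n - n') = min n n'" by simp
    from s(4) obtain M :: "nat kmodel" and w where M: "pointed_model P ?I M w"
      "fm_enc s = fm_enc (dtype P ?I n M w)" "haspath ?I n M w" using pathc_iff[OF P order_refl] by blast
    from s(5) obtain M' :: "nat kmodel" and w' where M': "pointed_model P ?I M' w'"
      "fm_enc s' = fm_enc (dtype P ?I n' M' w')" "haspath ?I (min n n') M' w'"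
      unfolding min using pathc_iff[OF P, of "min n n'" n'] by auto
    have "s = dtype P ?I n M w" "s' = dtype P ?I n' M' w'" using M(2) M'(2) by (simp_all add: fm_enc_eq_iff)
    then show "\<not> (\<exists>n. ?X \<subseteq> dtypes P ?I n)"
      using uniform_no_witness[OF P finite_index _ M(1) M'(1) _ _ M(3) M'(3)] s(1-3) a by auto
  next
    assume "\<not> (\<exists>n. ?X \<subseteq> dtypes P ?I n)"
    then have no: "\<And>n. \<not> ?X \<subseteq> dtypes P ?I n" by blast
    obtain n n' and M M' :: "nat kmodel" and w w' where w: "pointed_model P ?I M w" "pointed_model P ?I M' w'"
      "dtype P ?I n M w \<in> ?X" "dtype P ?I n' M' w' \<in> ?X" "n \<noteq> n'" "haspath ?I n M w" "haspath ?I (min n n') M' w'"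
      using P finite_index X no by (rule nonuniform_witness)
    have min: "n - (n - n') = min n n'" by simp
    have "pathc P a n (fm_enc (dtype P ?I n M w)) n" using w(1,6) pathc_iff[OF P order_refl] by blast
    moreover have "pathc P a n' (fm_enc (dtype P ?I n' M' w')) (n - (n - n'))"
      unfolding min using w(2,7) pathc_iff[OF P, of "min n n'" n'] by auto
    ultimately show "mixedc P a ?x" unfolding mixedc_def entry using w(3-5) by blast
  qed
  show ?thesis unfolding uniform mixed xa type_delta_def by auto
qed

text \<open>The program searches the graph of the transition function. On other inputs it may
  diverge, which \<open>re_automaton\<close> permits, as it constrains only inputs made of
  types.\<close>

lemma re_automaton_full_type_automaton:
  assumes P: "finite P" and a: "0 < a" and wf: "\<forall>f\<in>S. wf_fm P {1..a} f" and S: "re_set (fm_enc ` S)"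
  shows "re_automaton P a (full_type_automaton P {1..a} S)"
proof -
  let ?G = "\<lambda>x y. uniformc P a x y \<or> (mixedc P a x \<and> y = nthc x a)"
  obtain c where c: "\<forall>x. (\<exists>y. ?G x y) \<longrightarrow> (\<exists>y. ?G x y \<and> reval c [x] y)"
    using semidec_deltac[OF P, of a] by (rule program_of_semidec_graph)
  have "reval c [input_enc a N t] (fm_enc (type_delta P {1..a} N t))"
    if "t \<in> Types P {1..a}" "\<forall>b\<in>{1..a}. set_mset (N b) \<subseteq> Types P {1..a}" for N t
    using c[rule_format, of "input_enc a N t"] unfolding deltac_correct[OF P a that] by auto
  then show ?thesis unfolding re_automaton_def prod.case using re_set_accepting[OF P wf S] by blast
qed

theorem theorem1:
  fixes P :: "nat set" and a :: nat and S :: "fm set" and K :: "('w kmodel \<times> 'w) set"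
  assumes "finite P" and "0 < a" and "disj_defines P {1..a} S K"
  shows "(\<exists>A. type_automaton P {1..a} A \<and> recognizes A P {1..a} K)
       \<and> (re_set (fm_enc ` S) \<longrightarrow>
           (\<exists>A. type_automaton P {1..a} A \<and> recognizes A P {1..a} K \<and> re_automaton P a A))"
proof -
  have "\<forall>f\<in>S. wf_fm P {1..a} f" using assms(3) by (simp add: disj_defines_def)
  then show ?thesis
    using type_automaton_full_type_automaton[OF assms(1) finite_index] recognizes_full_type_automaton[OF assms(1) finite_index assms(3)]
      re_automaton_full_type_automaton[OF assms(1,2)] by blast
qed

end
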